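(* Let $J, K \in \mathbb{N}$ with $K \geq 2$. Let $(X, \mathcal{F}, \mu, T)$ be a $(J+K-1)$-th order Wiener-Wintner system (of power type $\alpha$ in $L^p$ for some $\alpha>0$ and $p\in[1,\infty]$), and let $f_1, f_2, \ldots, f_J \in L^\infty(\mu)$. Suppose that for some $j \in \{1,\dots,J\}$, $f_j \in L^2(\mathcal{Z}_{J+K-1})^\perp$. Then there exists a set $X' \subset X$ such that $\mu(X') = 1$, and for every $x \in X'$ and any other probability measure-preserving system $(Y, \mathcal{G}, \nu, S)$ and $g_1, g_2, \ldots, g_K \in L^\infty(\nu)$, we have $$\lim_{N \to \infty} \frac{1}{N} \sum_{n=1}^N \prod_{j=1}^J f_j(T^{jn}x) \prod_{k=1}^K g_k(S^{kn}y) = 0$$ for $\nu$-a.e. $y \in Y$.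
   Context: A system $(X,\mathcal{F},\mu,T)$ is a probability space with a measure-preserving map $T$. Notation: $[M]=\{1,\dots,M\}$; $V_k=\{0,1\}^k$; for $\eta\in V_k$, $|\eta|=\sum_j\eta_j$ and $h\cdot\eta=\sum_j h_j\eta_j$; $c$ is complex conjugation, so $c^{|\eta|}g$ equals $g$ if $|\eta|$ is even and $\overline g$ if $|\eta|$ is odd. Wiener-Wintner (WW) functions. For $k\ge2$, $p\in[1,\infty]$, $\alpha>0$, $f\in L^\infty(\mu)$ is a $k$-th order WW function of power type $\alpha$ in $L^p$ if there is $C_f>0$ such that for all $N\in\mathbb{N}$ $$\frac{1}{\lfloor \sqrt{N} \rfloor^{k-1}} \sum_{h \in [\lfloor \sqrt{N} \rfloor]^{k-1}}\left\| \sup_{t\in\mathbb{R}} \left| \frac{1}{N} \sum_{n=1}^N e^{2\pi i n t} \left[\prod_{\eta\in V_{k-1}} c^{|\eta|} f \circ T^{h \cdot \eta} \right]\circ T^n \right| \right\|_p^{2/3} \leq \frac{C_f}{N^\alpha}.$$ Host-Kra-Ziegler factors. For an ergodic system and $f\in L^\infty(\mu)$ put $|||f|||_2^4=\lim_H\frac1H\sum_{h=1}^H\left|\int f\cdot\overline{f\circ T^h}\,d\mu\right|^2$ and, for $k\ge3$, $|||f|||_k^{2^k}=\lim_H\frac1H\sum_{h=1}^H|||f\cdot\overline{f\circ T^h}|||_{k-1}^{2^{k-1}}$. For $k\ge1$, $\mathcal{Z}_k$ is the $k$-th Host-Kra-Ziegler factor: the invariant sub-$\sigma$-algebra characterized by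 $\mathbb{E}(f|\mathcal{Z}_k)=0\iff|||f|||_{k+1}=0$ for $f\in L^\infty(\mu)$ ($\mathcal{Z}_1$ is the Kronecker factor). $L^2(\mathcal{Z}_k)^\perp=\{f\in L^2(\mu):\mathbb{E}(f|\mathcal{Z}_k)=0\}$. WW systems. An ergodic system is a $k$-th order WW system of power type $\alpha$ in $L^p$ if there is a set of $k$-th order WW functions of power type $\alpha$ in $L^p$ that is $L^2$-dense in $L^2(\mathcal{Z}_k)^\perp$. *)

theory Defs
  imports "HOL-Probability.Probability"
begin

section \<open>Systems and function spaces\<close>

definition mps :: "'a measure \<Rightarrow> ('a \<Rightarrow> 'a) \<Rightarrow> bool" where
  "mps M T \<longleftrightarrow> prob_space M \<and> T \<in> measurable M M \<and> distr M M T = M"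

definition ergodic_mps :: "'a measure \<Rightarrow> ('a \<Rightarrow> 'a) \<Rightarrow> bool" where
  "ergodic_mps M T \<longleftrightarrow> mps M T \<and>
     (\<forall>A\<in>sets M. T -` A \<inter> space M = A \<longrightarrow> measure M A = 0 \<or> measure M A = 1)"

text \<open>Elements of the function spaces are representatives, not classes modulo null sets.\<close>

definition Linf :: "'a measure \<Rightarrow> ('a \<Rightarrow> complex) set" where
  "Linf M = {f \<in> borel_measurable M. \<exists>B. AE x in M. cmod (f x) \<le> B}"

definition L2 :: "'a measure \<Rightarrow> ('a \<Rightarrow> complex) set" where
  "L2 M = {f \<in> borel_measurable M. integrable M (\<lambda>x. (cmod (f x))\<^sup>2)}"

text \<open>The $L^p$ norm for $1 \le p \le \infty$. It is real-valued, hence meaningful only where the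
  norm is finite; below it is applied only to essentially bounded functions or, for $p = 2$, to
  square-integrable ones.\<close>

definition Lp_norm :: "ennreal \<Rightarrow> 'a measure \<Rightarrow> ('a \<Rightarrow> real) \<Rightarrow> real" where
  "Lp_norm p M u =
     (if p = \<infinity> then real_of_ereal (esssup M (\<lambda>x. ereal \<bar>u x\<bar>))
      else (\<integral>x. \<bar>u x\<bar> powr enn2real p \<partial>M) powr (1 / enn2real p))"

section \<open>Wiener-Wintner functions\<close>

text \<open>Index vectors are extensional functions on \<open>{1..d}\<close>.\<close>

definition index_box :: "nat \<Rightarrow> nat \<Rightarrow> (nat \<Rightarrow> nat) set" where
  "index_box d m = (\<Pi>\<^sub>E j\<in>{1..d}. {1..m})"

definition cube :: "nat \<Rightarrow> (nat \<Rightarrow> nat) set" where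
  "cube d = (\<Pi>\<^sub>E j\<in>{1..d}. {0, 1})"

definition cube_prod ::
  "('a \<Rightarrow> 'a) \<Rightarrow> nat \<Rightarrow> ('a \<Rightarrow> complex) \<Rightarrow> (nat \<Rightarrow> nat) \<Rightarrow> 'a \<Rightarrow> complex" where
  "cube_prod T d f h x =
     (\<Prod>\<eta>\<in>cube d. (cnj ^^ (\<Sum>j=1..d. \<eta> j)) (f ((T ^^ (\<Sum>j=1..d. h j * \<eta> j)) x)))"

definition WW_function ::
  "'a measure \<Rightarrow> ('a \<Rightarrow> 'a) \<Rightarrow> nat \<Rightarrow> real \<Rightarrow> ennreal \<Rightarrow> ('a \<Rightarrow> complex) \<Rightarrow> bool" where
  "WW_function M T k \<alpha> p f \<longleftrightarrow> f \<in> Linf M \<and>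
     (\<exists>C>0. \<forall>N\<ge>1::nat.
        (1 / real (nat \<lfloor>sqrt (real N)\<rfloor> ^ (k - 1))) *
        (\<Sum>h\<in>index_box (k - 1) (nat \<lfloor>sqrt (real N)\<rfloor>).
           Lp_norm p M (\<lambda>x. \<Squnion>t::real.
             cmod ((1 / of_nat N) *
               (\<Sum>n=1..N. exp (2 * of_real pi * \<i> * of_nat n * of_real t) *
                           cube_prod T (k - 1) f h ((T ^^ n) x)))) powr (2/3))
        \<le> C / real N powr \<alpha>)"

section \<open>Host-Kra-Ziegler factors\<close>

text \<open>The seminorms are defined from order 2 on. The operator \<open>lim\<close> is only meaningful when the
  limit exists, which it does for bounded functions on an ergodic system.\<close>

fun hk_seminorm :: "'a measure \<Rightarrow> ('a \<Rightarrow> 'a) \<Rightarrow> nat \<Rightarrow> ('a \<Rightarrow> complex) \<Rightarrow> real" where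
  "hk_seminorm M T (Suc (Suc 0)) f =
     root 4 (lim (\<lambda>H. (1 / real H) *
       (\<Sum>h=1..H. (cmod (\<integral>x. f x * cnj (f ((T ^^ h) x)) \<partial>M))\<^sup>2)))"
| "hk_seminorm M T (Suc (Suc (Suc k))) f =
     root (2 ^ (k + 3)) (lim (\<lambda>H. (1 / real H) *
       (\<Sum>h=1..H. hk_seminorm M T (Suc (Suc k)) (\<lambda>x. f x * cnj (f ((T ^^ h) x))) ^ (2 ^ (k + 2)))))"
| "hk_seminorm M T k f = undefined"

definition complex_cond_exp :: "'a measure \<Rightarrow> 'a measure \<Rightarrow> ('a \<Rightarrow> complex) \<Rightarrow> 'a \<Rightarrow> complex" where
  "complex_cond_exp M F f x =
     Complex (real_cond_exp M F (\<lambda>x. Re (f x)) x) (real_cond_exp M F (\<lambda>x. Im (f x)) x)"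

text \<open>The factor \<open>\<Z>\<^sub>k\<close> is determined by its characterization only modulo null sets, so it
  is a predicate on sub-\<open>\<sigma>\<close>-algebras. A sub-\<open>\<sigma>\<close>-algebra is represented, as in
  \<open>HOL-Probability.Conditional_Expectation\<close>, by a measure of which only \<open>space\<close> and \<open>sets\<close> matter.
  Nothing in the sequel depends on which version of the factor is chosen.\<close>

definition HKZ_factor :: "'a measure \<Rightarrow> ('a \<Rightarrow> 'a) \<Rightarrow> nat \<Rightarrow> 'a measure \<Rightarrow> bool" where
  "HKZ_factor M T k Z \<longleftrightarrow> subalgebra M Z \<and> T \<in> measurable Z Z \<and>
     (\<forall>f\<in>Linf M. (AE x in M. complex_cond_exp M Z f x = 0) \<longleftrightarrow> hk_seminorm M T (Suc k) f = 0)"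

definition L2_perp :: "'a measure \<Rightarrow> 'a measure \<Rightarrow> ('a \<Rightarrow> complex) set" where
  "L2_perp M Z = {f \<in> L2 M. AE x in M. complex_cond_exp M Z f x = 0}"

text \<open>In the next definition \<open>Z\<close> stands for the factor \<open>\<Z>\<^sub>k\<close>.\<close>

definition WW_system ::
  "'a measure \<Rightarrow> ('a \<Rightarrow> 'a) \<Rightarrow> 'a measure \<Rightarrow> nat \<Rightarrow> real \<Rightarrow> ennreal \<Rightarrow> bool" where
  "WW_system M T Z k \<alpha> p \<longleftrightarrow> ergodic_mps M T \<and>
     (\<exists>D\<subseteq>L2_perp M Z. (\<forall>g\<in>D. WW_function M T k \<alpha> p g) \<and>
        (\<forall>f\<in>L2_perp M Z. \<forall>\<epsilon>>0. \<exists>g\<in>D. Lp_norm 2 M (\<lambda>x. cmod (f x - g x)) < \<epsilon>))"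

section \<open>Points at which all double averages vanish\<close>

text \<open>The points \<open>x\<close> for which the averages tend to 0 almost everywhere, for every system whose
  underlying set is a subset of the type \<open>'b\<close>, and all bounded \<open>g\<^sub>1, \<dots>, g\<^sub>K\<close> on it.\<close>

definition vanishing_points ::
  "'b itself \<Rightarrow> 'a measure \<Rightarrow> ('a \<Rightarrow> 'a) \<Rightarrow> nat \<Rightarrow> nat \<Rightarrow> (nat \<Rightarrow> 'a \<Rightarrow> complex) \<Rightarrow> 'a set" where
  "vanishing_points _ M T J K f = {x \<in> space M.
     \<forall>(N :: 'b measure) S g. mps N S \<and> (\<forall>k\<in>{1..K}. g k \<in> Linf N) \<longrightarrow>
       (AE y in N. (\<lambda>n. (1 / of_nat n) *
          (\<Sum>i=1..n. (\<Prod>j=1..J. f j ((T ^^ (j * i)) x)) * (\<Prod>k=1..K. g k ((S ^^ (k * i)) y))))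
        \<longlonglongrightarrow> 0)}"

text \<open>HOL cannot quantify over types inside a formula, so a set of points serving the systems on
  every type at once has to be named without mentioning those types. The type below makes this
  possible: for any system and \<open>g\<^sub>1, \<dots>, g\<^sub>K\<close> the law of \<open>(g\<^sub>k(S\<^sup>n y))\<^sub>n\<^sub>,\<^sub>k\<close> is a shift-invariant
  probability measure on it,
  so a point that is vanishing for this type is vanishing for every type \<open>'b\<close>.\<close>

type_synonym orbit_space = "nat \<Rightarrow> nat \<Rightarrow> complex"

end

(*
  Fix x and regard a(n) = f_1(T^n x) ... f_J(T^{Jn} x) as a weight. K applications of van der Corput's
  inequality on Y, each removing one g_k by invariance of nu, bound the L^1(nu) norm of the N-th
  average by an average over h_1, ..., h_K of |1/N sum_n D_{h_1} ... D_{h_K} a(n)|, where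
  D_h a(n) = a(n) conj(a(n+h)). This bound depends on x only, so the exceptional set of x serves every
  system (Y, S). Integrating it in x and applying van der Corput J - 1 more times on X leaves only the
  special function f_s, differenced J + K - 1 times. The last difference is removed by Parseval, which
  brings in sup_t |1/N sum_n e(nt) u_n|; the other J + K - 2 differences are the cube product of the
  Wiener-Wintner condition. With N = l^(2r+2), shifts up to l^r and a last shift up to l^(2r+1), the
  power decay absorbs all polynomial losses in l, and the bound is summable along a sparse sequence of
  powers, whose gaps are harmless. A general f_s is approximated in L^2 by Wiener-Wintner functions;
  the maximal ergodic inequality controls the error for almost every x uniformly in N and in (Y, S).
*)
theory Submission
  imports Defs
begin

subsection \<open>Van der Corput's inequality\<close>

text \<open>The Wiener-Wintner condition speaks of undilated shifts in a box of side floor(sqrt N),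
  while van der Corput multiplies the shifts by slopes up to J, as f_s moves s steps when n moves
  one. The dilated shifts are therefore embedded in the full box of side R = sqrt N, which costs the
  ratio (R/H)^d with d = J + K - 2. This explains the scales: N = R^2 with R = l^(r+1), and H = l^r
  leaves a factor l of room for the slopes. Parseval with a last shift up to H' = l^(2r+1) costs
  N/H' = l and, for boundary terms, H'/N = 1/l. The exponent r is so large that N^\<alpha> is at
  least l^(d+2): l^d pays for the embedding, l for Parseval, and 1/l is gained. Since T need not be
  invertible, shifting by invariance can free only the function of smallest slope from n; when that
  function is f_s itself, the summation interval is reflected, which reverses the order of the
  slopes.\<close>

lemma norm_sum_square_expand:
  fixes x :: "nat \<Rightarrow> complex"
  shows "(cmod (\<Sum>j<H. x j))\<^sup>2 = (\<Sum>j<H. (cmod (x j))\<^sup>2) + 2 * (\<Sum>j<H. \<Sum>i<j. Re (x j * cnj (x i)))"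
proof (induction H)
  case (Suc H)
  have sq: "(cmod (s + z))\<^sup>2 = (cmod s)\<^sup>2 + (cmod z)\<^sup>2 + 2 * Re (z * cnj s)" for s z :: complex
    unfolding cmod_power2 by (simp add: power2_eq_square algebra_simps)
  have re: "Re (x H * cnj (\<Sum>j<H. x j)) = (\<Sum>i<H. Re (x H * cnj (x i)))"
    by (simp only: cnj_sum sum_distrib_left Re_sum)
  show ?case
    unfolding sum.lessThan_Suc sq Suc.IH re by (simp only: distrib_left ac_simps)
qed simp

text \<open>There are \<open>H - d\<close> pairs \<open>i < j < H\<close> with difference
  \<open>d\<close>; the term for \<open>d = H\<close> vanishes.\<close>

lemma sum_triangle_differences:
  fixes r :: "nat \<Rightarrow> real"
  shows "(\<Sum>j<H. \<Sum>i<j. r (j - i)) = (\<Sum>d=1..H. real (H - d) * r d)"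
proof (induction H)
  case (Suc H)
  have "(\<Sum>i<H. r (H - i)) = (\<Sum>d=1..H. r d)"
    by (rule sum.reindex_bij_witness[of _ "\<lambda>d. H - d" "\<lambda>i. H - i"]) auto
  moreover have "(\<Sum>d=1..H. real (Suc H - d) * r d) = (\<Sum>d=1..H. real (H - d) * r d) + (\<Sum>d=1..H. r d)"
    unfolding sum.distrib[symmetric]
    by (rule sum.cong) (auto simp: Suc_diff_le algebra_simps)
  ultimately show ?case using Suc by simp
qed simp

text \<open>Every term of \<open>b\<close> is counted by \<open>H\<close> of the sliding windows
  \<open>B n\<close>, so the windows sum to \<open>H\<close> times the sum of \<open>b\<close>.
  Cauchy-Schwarz over the \<open>N + H\<close> positions leaves the squares of the windows, whose
  cross terms depend, after translation, only on the difference of the two offsets.\<close>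

lemma van_der_Corput:
  fixes b :: "nat \<Rightarrow> complex"
  assumes b: "\<And>n. cmod (b n) \<le> 1" and supp: "\<And>n. n \<notin> {1..N} \<Longrightarrow> b n = 0"
  shows "(real H)\<^sup>2 * (cmod (\<Sum>n=1..N. b n))\<^sup>2
     \<le> real (N + H) * (real H * real N + 2 * (\<Sum>d=1..H. real (H - d) * Re (\<Sum>n=1..N. b n * cnj (b (n + d)))))"
proof -
  define c where "c d = (\<Sum>n=1..N. b n * cnj (b (n + d)))" for d
  \<comment> \<open>The truncated subtraction is harmless: for \<open>n < j\<close> the index is 0,
    where \<open>b\<close> vanishes.\<close>
  define B where "B n = (\<Sum>j<H. b (n - j))" for n
  have shift: "(\<Sum>n=1..N+H. g (n - j)) = (\<Sum>n=1..N. g n)"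
    if "j < H" "\<And>n. n \<notin> {1..N} \<Longrightarrow> g n = 0" for j and g :: "nat \<Rightarrow> complex"
  proof -
    have "(\<Sum>n=1..N+H. g (n - j)) = (\<Sum>n\<in>{1+j..N+j}. g (n - j))"
      using that(1) by (intro sum.mono_neutral_right ballI that(2)) auto
    also have "\<dots> = (\<Sum>n=1..N. g n)"
      by (rule sum.reindex_bij_witness[of _ "\<lambda>n. n + j" "\<lambda>n. n - j"]) auto
    finally show ?thesis .
  qed
  have "(\<Sum>n=1..N+H. B n) = (\<Sum>j<H. \<Sum>n=1..N+H. b (n - j))"
    unfolding B_def by (rule sum.swap)
  also have "\<dots> = (\<Sum>j<H. \<Sum>n=1..N. b n)"
    by (rule sum.cong[OF refl], rule shift) (use supp in auto)
  finally have sB: "(\<Sum>n=1..N+H. B n) = of_nat H * (\<Sum>n=1..N. b n)" by simp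
  have "(real H)\<^sup>2 * (cmod (\<Sum>n=1..N. b n))\<^sup>2 = (cmod (\<Sum>n=1..N+H. B n))\<^sup>2"
    unfolding sB by (simp add: norm_mult power_mult_distrib)
  also have "\<dots> \<le> (\<Sum>n=1..N+H. cmod (B n))\<^sup>2"
    by (intro power_mono norm_sum) auto
  also have "\<dots> \<le> (\<Sum>n=1..N+H. (cmod (B n))\<^sup>2) * real (N + H)"
    using Cauchy_Schwarz_ineq_sum[of "\<lambda>n. cmod (B n)" "\<lambda>_. 1" "{1..N+H}"] by simp
  also have "(\<Sum>n=1..N+H. (cmod (B n))\<^sup>2)
     = (\<Sum>j<H. \<Sum>n=1..N+H. (cmod (b (n - j)))\<^sup>2)
       + 2 * (\<Sum>j<H. \<Sum>i<j. \<Sum>n=1..N+H. Re (b (n - j) * cnj (b (n - i))))"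
  proof -
    have 1: "(\<Sum>n=1..N+H. \<Sum>j<H. (cmod (b (n - j)))\<^sup>2) = (\<Sum>j<H. \<Sum>n=1..N+H. (cmod (b (n - j)))\<^sup>2)"
      by (rule sum.swap)
    have 2: "(\<Sum>n=1..N+H. \<Sum>j<H. \<Sum>i<j. Re (b (n - j) * cnj (b (n - i))))
       = (\<Sum>j<H. \<Sum>i<j. \<Sum>n=1..N+H. Re (b (n - j) * cnj (b (n - i))))"
      by (subst sum.swap) (intro sum.cong refl sum.swap)
    show ?thesis
      unfolding B_def norm_sum_square_expand sum.distrib 1 2[symmetric] sum_distrib_left ..
  qed
  also have "\<dots> \<le> real H * real N + 2 * (\<Sum>j<H. \<Sum>i<j. Re (c (j - i)))"
  proof (intro add_mono mult_left_mono sum_mono)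
    have "(\<Sum>j<H. \<Sum>n=1..N+H. (cmod (b (n - j)))\<^sup>2) \<le> (\<Sum>j<H. real N)"
    proof (rule sum_mono)
      fix j assume "j \<in> {..<H}"
      then have "(\<Sum>n=1..N+H. complex_of_real ((cmod (b (n - j)))\<^sup>2)) = (\<Sum>n=1..N. complex_of_real ((cmod (b n))\<^sup>2))"
        by (intro shift) (use supp in auto)
      then have "(\<Sum>n=1..N+H. (cmod (b (n - j)))\<^sup>2) = (\<Sum>n=1..N. (cmod (b n))\<^sup>2)"
        by (simp only: of_real_sum[symmetric] of_real_eq_iff)
      also have "\<dots> \<le> (\<Sum>n=1..N. 1)"
        using b by (intro sum_mono) (simp add: power_le_one)
      finally show "(\<Sum>n=1..N+H. (cmod (b (n - j)))\<^sup>2) \<le> real N" by simp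
    qed
    then show "(\<Sum>j<H. \<Sum>n=1..N+H. (cmod (b (n - j)))\<^sup>2) \<le> real H * real N" by simp
  next
    fix j i assume ij: "j \<in> {..<H}" "i \<in> {..<j}"
    have "(\<Sum>n=1..N+H. b (n - j) * cnj (b (n - i))) = (\<Sum>n=1..N+H. b (n - j) * cnj (b (n - j + (j - i))))"
    proof (rule sum.cong[OF refl])
      fix n show "b (n - j) * cnj (b (n - i)) = b (n - j) * cnj (b (n - j + (j - i)))"
        using ij supp[of 0] by (cases "j \<le> n") auto
    qed
    also have "\<dots> = c (j - i)"
      unfolding c_def using ij supp by (intro shift) auto
    finally show "(\<Sum>n=1..N+H. Re (b (n - j) * cnj (b (n - i)))) \<le> Re (c (j - i))"
      by (simp only: Re_sum[symmetric] order_refl)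
  qed simp
  also have "(\<Sum>j<H. \<Sum>i<j. Re (c (j - i))) = (\<Sum>d=1..H. real (H - d) * Re (c d))"
    by (rule sum_triangle_differences)
  finally show ?thesis
    by (simp add: c_def mult.commute mult_right_mono)
qed

subsection \<open>Correlations along a progression and exponential sums\<close>

text \<open>The ratio \<open>z\<close> of the two characters is a Q-th root of unity, and
  \<open>a, b < Q\<close> keeps it different from 1 unless \<open>a = b\<close>, so its geometric
  sum vanishes.\<close>

lemma cis_orthogonality:
  assumes "a < Q" "b < Q"
  shows "(\<Sum>t<Q. cis (2 * pi * real a * (real t / real Q)) * cnj (cis (2 * pi * real b * (real t / real Q))))
    = (if a = b then of_nat Q else 0)"
proof -
  define z where "z = cis (2 * pi * (real a - real b) / real Q)"
  have Q: "Q > 0" using assms by simp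
  have "cis (2 * pi * real a * (real t / real Q)) * cnj (cis (2 * pi * real b * (real t / real Q))) = z ^ t" for t
    unfolding z_def cis_cnj cis_mult by (subst Complex.DeMoivre, rule arg_cong[of _ _ cis]) (simp add: algebra_simps diff_divide_distrib)
  then have eq: "(\<Sum>t<Q. cis (2 * pi * real a * (real t / real Q)) * cnj (cis (2 * pi * real b * (real t / real Q))))
      = (\<Sum>t<Q. z ^ t)" by simp
  show ?thesis
  proof (cases "a = b")
    case True
    then show ?thesis unfolding eq by (simp add: z_def)
  next
    case False
    have "z \<noteq> 1"
    proof
      assume "z = 1"
      then have "cos (2 * pi * (real a - real b) / real Q) = 1"
        unfolding z_def by (metis cis.simps(1) one_complex.simps(1))
      then obtain k :: int where "2 * pi * (real a - real b) / real Q = of_int k * 2 * pi"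
        using cos_one_2pi_int by auto
      then have "(2 * pi) * (real a - real b) = (2 * pi) * (of_int k * real Q)"
        using Q by (simp add: field_simps)
      then have "real a - real b = of_int k * real Q"
        by (simp only: mult_cancel_left) simp
      then have k: "int a - int b = k * int Q"
        by (metis (mono_tags, lifting) of_int_diff of_int_eq_iff of_int_mult of_int_of_nat_eq)
      then have "int Q dvd int a - int b" by simp
      moreover have "\<bar>int a - int b\<bar> < int Q" using assms by auto
      ultimately have "int a - int b = 0" using zdvd_not_zless
        by (metis abs_of_pos dvd_abs_iff zero_less_abs_iff)
      then show False using False by simp
    qed
    moreover have "z ^ Q = 1"
    proof -
      have "z ^ Q = cis (2 * pi * of_int (int a - int b))"
        unfolding z_def Complex.DeMoivre using Q by (simp add: right_diff_distrib mult.commute)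
      also have "\<dots> = 1" by (rule cis_multiple_2pi) simp
      finally show ?thesis .
    qed
    ultimately show ?thesis using False unfolding eq by (simp add: geometric_sum)
  qed
qed

lemma finite_Parseval:
  fixes x :: "'i \<Rightarrow> complex" and p :: "'i \<Rightarrow> nat"
  assumes "finite A" "inj_on p A" "\<And>i. i \<in> A \<Longrightarrow> p i < Q"
  shows "(\<Sum>t<Q. (cmod (\<Sum>i\<in>A. x i * cis (2 * pi * real (p i) * (real t / real Q))))\<^sup>2)
     = real Q * (\<Sum>i\<in>A. (cmod (x i))\<^sup>2)"
proof -
  let ?e = "\<lambda>n t. cis (2 * pi * real n * (real t / real Q))"
  have "complex_of_real (\<Sum>t<Q. (cmod (\<Sum>i\<in>A. x i * ?e (p i) t))\<^sup>2)
     = (\<Sum>t<Q. (\<Sum>i\<in>A. x i * ?e (p i) t) * cnj (\<Sum>i\<in>A. x i * ?e (p i) t))"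
    by (simp only: of_real_sum complex_norm_square)
  also have "\<dots> = (\<Sum>t<Q. \<Sum>i\<in>A. \<Sum>j\<in>A. x i * cnj (x j) * (?e (p i) t * cnj (?e (p j) t)))"
    by (simp only: cnj_sum sum_product complex_cnj_mult mult_ac)
  also have "\<dots> = (\<Sum>i\<in>A. \<Sum>j\<in>A. x i * cnj (x j) * (\<Sum>t<Q. ?e (p i) t * cnj (?e (p j) t)))"
    unfolding sum_distrib_left by (subst sum.swap, subst (2) sum.swap) (rule refl)
  also have "\<dots> = (\<Sum>i\<in>A. \<Sum>j\<in>A. if i = j then of_nat Q * (x i * cnj (x j)) else 0)"
  proof (intro sum.cong refl)
    fix i j assume "i \<in> A" "j \<in> A"
    then show "x i * cnj (x j) * (\<Sum>t<Q. ?e (p i) t * cnj (?e (p j) t))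
        = (if i = j then of_nat Q * (x i * cnj (x j)) else 0)"
      using assms(2,3) by (subst cis_orthogonality) (auto simp: inj_on_def)
  qed
  also have "\<dots> = (\<Sum>i\<in>A. of_nat Q * (x i * cnj (x i)))"
    using assms(1) by (simp add: sum.delta)
  also have "\<dots> = complex_of_real (real Q * (\<Sum>i\<in>A. (cmod (x i))\<^sup>2))"
    by (simp only: of_real_mult of_real_sum complex_norm_square of_real_of_nat_eq sum_distrib_left)
  finally show ?thesis using of_real_eq_iff by blast
qed

text \<open>Circle method on the frequencies t/Q. The sum over \<open>t\<close> of
  \<open>U t * W t * cnj (V t)\<close> picks out the triples with \<open>n + c * h = k\<close>,
  which gives the left-hand side up to the factor \<open>Q\<close>. \<open>U\<close> is bounded by
  \<open>S\<close> uniformly, while \<open>W\<close> and \<open>V\<close> are controlled in mean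
  square by Parseval. The weights \<open>\<theta>\<close> leave room for phases.\<close>

lemma correlations_le_exponential_sum:
  fixes u :: "nat \<Rightarrow> complex" and \<theta> :: "nat \<Rightarrow> complex"
  assumes u: "\<And>n. cmod (u n) \<le> 1" and \<theta>: "\<And>h. cmod (\<theta> h) \<le> 1" and c: "c \<ge> 1"
    and S: "\<And>t::real. cmod (\<Sum>n=1..L. u n * cis (2 * pi * real n * t)) \<le> S"
  shows "cmod (\<Sum>h=1..H. \<theta> h * (\<Sum>n=1..L. u n * cnj (u (n + c * h)))) \<le> S * real (L + c * H)"
proof -
  \<comment> \<open>Larger than every index \<open>n + c * h\<close> that occurs, so distinct
    frequencies stay distinct modulo \<open>Q\<close>.\<close>
  define Q where "Q = L + c * H + 1"
  have Q: "Q > 0" by (simp add: Q_def)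
  let ?e = "\<lambda>n t. cis (2 * pi * real n * (real t / real Q))"
  define U where "U t = (\<Sum>n=1..L. u n * ?e n t)" for t
  define V where "V t = (\<Sum>n=1..L + c * H. u n * ?e n t)" for t
  define W where "W t = (\<Sum>h=1..H. \<theta> h * ?e (c * h) t)" for t
  have S0: "S \<ge> 0" using S[of 0] norm_ge_zero order_trans by blast
  have split: "?e (n + k) t = ?e n t * ?e k t" for n k t
    unfolding cis_mult by (rule arg_cong[of _ _ cis]) (simp add: algebra_simps add_divide_distrib)
  have "(\<Sum>t<Q. U t * W t * cnj (V t))
     = (\<Sum>t<Q. \<Sum>n=1..L. \<Sum>h=1..H. \<Sum>k=1..L + c * H.
          u n * \<theta> h * cnj (u k) * (?e (n + c * h) t * cnj (?e k t)))"
  proof (rule sum.cong[OF refl])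
    fix t
    have UW: "U t * W t = (\<Sum>n=1..L. \<Sum>h=1..H. u n * ?e n t * (\<theta> h * ?e (c * h) t))"
      unfolding U_def W_def by (rule sum_product)
    show "U t * W t * cnj (V t) = (\<Sum>n=1..L. \<Sum>h=1..H. \<Sum>k=1..L + c * H.
          u n * \<theta> h * cnj (u k) * (?e (n + c * h) t * cnj (?e k t)))"
      unfolding UW V_def cnj_sum sum_distrib_right unfolding sum_distrib_left
      unfolding split by (intro sum.cong refl) (simp only: complex_cnj_mult mult_ac)
  qed
  also have "\<dots> = (\<Sum>n=1..L. \<Sum>h=1..H. \<Sum>k=1..L + c * H. \<Sum>t<Q.
          u n * \<theta> h * cnj (u k) * (?e (n + c * h) t * cnj (?e k t)))"
    by (subst sum.swap, subst (2) sum.swap, subst (3) sum.swap) (rule refl)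
  also have "\<dots> = (\<Sum>n=1..L. \<Sum>h=1..H. \<Sum>k=1..L + c * H.
          u n * \<theta> h * cnj (u k) * (if n + c * h = k then of_nat Q else 0))"
  proof (intro sum.cong refl)
    fix n h k assume *: "n \<in> {1..L}" "h \<in> {1..H}" "k \<in> {1..L + c * H}"
    then have "n + c * h \<le> L + c * H" by (intro add_mono mult_mono) auto
    then show "(\<Sum>t<Q. u n * \<theta> h * cnj (u k) * (?e (n + c * h) t * cnj (?e k t)))
        = u n * \<theta> h * cnj (u k) * (if n + c * h = k then of_nat Q else 0)"
      using * unfolding sum_distrib_left[symmetric]
      by (subst cis_orthogonality) (auto simp: Q_def)
  qed
  also have "\<dots> = (\<Sum>n=1..L. \<Sum>h=1..H. of_nat Q * (\<theta> h * (u n * cnj (u (n + c * h)))))"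
  proof (intro sum.cong refl)
    fix n h assume *: "n \<in> {1..L}" "h \<in> {1..H}"
    then have "n + c * h \<le> L + c * H" by (intro add_mono mult_mono) auto
    then have "n + c * h \<in> {1..L + c * H}" using * by auto
    then show "(\<Sum>k=1..L + c * H. u n * \<theta> h * cnj (u k) * (if n + c * h = k then of_nat Q else 0))
       = of_nat Q * (\<theta> h * (u n * cnj (u (n + c * h))))"
      by (simp add: if_distrib[of "\<lambda>x. _ * x"] sum.delta' mult_ac cong: if_cong)
  qed
  also have "\<dots> = of_nat Q * (\<Sum>h=1..H. \<theta> h * (\<Sum>n=1..L. u n * cnj (u (n + c * h))))"
    unfolding sum_distrib_left by (rule sum.swap)
  finally have eq: "of_nat Q * (\<Sum>h=1..H. \<theta> h * (\<Sum>n=1..L. u n * cnj (u (n + c * h))))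
     = (\<Sum>t<Q. U t * W t * cnj (V t))" ..
  have U: "cmod (U t) \<le> S" for t unfolding U_def by (rule S)
  have "real Q * cmod (\<Sum>h=1..H. \<theta> h * (\<Sum>n=1..L. u n * cnj (u (n + c * h))))
     = cmod (\<Sum>t<Q. U t * W t * cnj (V t))"
    unfolding eq[symmetric] by (simp add: norm_mult)
  also have "\<dots> \<le> (\<Sum>t<Q. S * (((cmod (W t))\<^sup>2 + (cmod (V t))\<^sup>2) / 2))"
  proof (rule sum_norm_le)
    fix t
    have "cmod (U t * W t * cnj (V t)) = cmod (U t) * (cmod (W t) * cmod (V t))"
      by (simp add: norm_mult)
    also have "\<dots> \<le> S * (((cmod (W t))\<^sup>2 + (cmod (V t))\<^sup>2) / 2)"
      using sum_squares_bound[of "cmod (W t)" "cmod (V t)"]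
      by (intro mult_mono U S0) (auto simp: mult_ac)
    finally show "cmod (U t * W t * cnj (V t)) \<le> S * (((cmod (W t))\<^sup>2 + (cmod (V t))\<^sup>2) / 2)" .
  qed
  also have "\<dots> = S / 2 * ((\<Sum>t<Q. (cmod (W t))\<^sup>2) + (\<Sum>t<Q. (cmod (V t))\<^sup>2))"
    by (simp add: sum_distrib_left sum.distrib field_simps flip: sum_divide_distrib)
  also have "(\<Sum>t<Q. (cmod (W t))\<^sup>2) = real Q * (\<Sum>h=1..H. (cmod (\<theta> h))\<^sup>2)"
    unfolding W_def using c
    by (intro finite_Parseval) (auto simp: inj_on_def Q_def intro!: le_imp_less_Suc trans_le_add2)
  also have "(\<Sum>t<Q. (cmod (V t))\<^sup>2) = real Q * (\<Sum>n=1..L + c * H. (cmod (u n))\<^sup>2)"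
    unfolding V_def by (intro finite_Parseval[where p="\<lambda>n. n"]) (auto simp: Q_def)
  also have "S / 2 * (real Q * (\<Sum>h=1..H. (cmod (\<theta> h))\<^sup>2) + real Q * (\<Sum>n=1..L + c * H. (cmod (u n))\<^sup>2))
     \<le> S / 2 * (real Q * real (L + c * H) + real Q * real (L + c * H))"
  proof (intro mult_left_mono add_mono)
    have "(\<Sum>h=1..H. (cmod (\<theta> h))\<^sup>2) \<le> (\<Sum>h=1..H. 1)"
      using \<theta> by (intro sum_mono) (simp add: power_le_one)
    also have "\<dots> \<le> real (L + c * H)" using c by (simp del: of_nat_add of_nat_mult) (simp add: trans_le_add2)
    finally show "(\<Sum>h=1..H. (cmod (\<theta> h))\<^sup>2) \<le> real (L + c * H)" .
    have "(\<Sum>n=1..L + c * H. (cmod (u n))\<^sup>2) \<le> (\<Sum>n=1..L + c * H. 1)"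
      using u by (intro sum_mono) (simp add: power_le_one)
    then show "(\<Sum>n=1..L + c * H. (cmod (u n))\<^sup>2) \<le> real (L + c * H)" by simp
  qed (use S0 in auto)
  also have "\<dots> = real Q * (S * real (L + c * H))" by (simp add: field_simps)
  finally show ?thesis using Q by simp
qed

subsection \<open>Iterated averages\<close>

definition avg :: "nat \<Rightarrow> (nat \<Rightarrow> real) \<Rightarrow> real" where
  "avg H \<phi> = (\<Sum>h=1..H. \<phi> h) / real H"

text \<open>A list of ranges gives each shift its own scale; the shifts reach \<open>\<phi>\<close>
  in the order in which the differences are taken.\<close>

fun iavg :: "nat list \<Rightarrow> (nat list \<Rightarrow> real) \<Rightarrow> real" where
  "iavg [] \<phi> = \<phi> []"
| "iavg (H # Hs) \<phi> = avg H (\<lambda>h. iavg Hs (\<lambda>hs. \<phi> (h # hs)))"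

definition scales :: "nat \<Rightarrow> nat list \<Rightarrow> bool" where
  "scales N Hs \<longleftrightarrow> (\<forall>H\<in>set Hs. 1 \<le> H \<and> H \<le> N)"

text \<open>Collects the diagonal terms: a van der Corput step with shifts up to \<open>H\<close>
  leaves an error of order 1/H.\<close>

definition recip_sum :: "nat list \<Rightarrow> real" where
  "recip_sum Hs = (\<Sum>H\<leftarrow>Hs. 1 / real H)"

lemma scales_simps [simp]:
  "scales N []" "scales N (H # Hs) \<longleftrightarrow> 1 \<le> H \<and> H \<le> N \<and> scales N Hs"
  "scales N (Hs @ Hs') \<longleftrightarrow> scales N Hs \<and> scales N Hs'"
  by (auto simp: scales_def)

lemma recip_sum_simps [simp]:
  "recip_sum [] = 0" "recip_sum (H # Hs) = 1 / real H + recip_sum Hs"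
  "recip_sum (Hs @ Hs') = recip_sum Hs + recip_sum Hs'"
  by (auto simp: recip_sum_def)

lemma recip_sum_nonneg: "recip_sum Hs \<ge> 0"
  by (induction Hs) auto

lemma avg_mono: "(\<And>h. h \<in> {1..H} \<Longrightarrow> \<phi> h \<le> \<psi> h) \<Longrightarrow> avg H \<phi> \<le> avg H \<psi>"
  unfolding avg_def by (intro divide_right_mono sum_mono) auto

lemma avg_nonneg: "(\<And>h. h \<in> {1..H} \<Longrightarrow> 0 \<le> \<phi> h) \<Longrightarrow> 0 \<le> avg H \<phi>"
  unfolding avg_def by (intro divide_nonneg_nonneg sum_nonneg) auto

lemma avg_add: "avg H (\<lambda>h. \<phi> h + \<psi> h) = avg H \<phi> + avg H \<psi>"
  unfolding avg_def by (simp add: sum.distrib add_divide_distrib)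

lemma avg_cmult: "avg H (\<lambda>h. c * \<phi> h) = c * avg H \<phi>"
  unfolding avg_def by (simp flip: sum_distrib_left)

lemma avg_const: "H \<ge> 1 \<Longrightarrow> avg H (\<lambda>_. c) = c"
  unfolding avg_def by simp

lemma avg_power2_le: "(avg H \<phi>)\<^sup>2 \<le> avg H (\<lambda>h. (\<phi> h)\<^sup>2)"
proof (cases "H = 0")
  case False
  have "(\<Sum>h=1..H. \<phi> h)\<^sup>2 \<le> (\<Sum>h=1..H. (\<phi> h)\<^sup>2) * real H"
    using Cauchy_Schwarz_ineq_sum[of \<phi> "\<lambda>_. 1" "{1..H}"] by simp
  then show ?thesis using False
    unfolding avg_def by (simp add: power_divide power2_eq_square divide_simps mult_ac)
qed (simp add: avg_def)

lemma avg_power_le: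
  assumes "\<And>h. h \<in> {1..H} \<Longrightarrow> 0 \<le> \<phi> h"
  shows "(avg H \<phi>) ^ (2 ^ k) \<le> avg H (\<lambda>h. \<phi> h ^ (2 ^ k))"
proof (induction k)
  case (Suc k)
  have "(avg H \<phi>) ^ (2 ^ Suc k) = ((avg H \<phi>) ^ (2 ^ k))\<^sup>2"
    by (simp add: power_mult[symmetric] mult.commute)
  also have "\<dots> \<le> (avg H (\<lambda>h. \<phi> h ^ (2 ^ k)))\<^sup>2"
    using Suc assms by (intro power_mono zero_le_power avg_nonneg) auto
  also have "\<dots> \<le> avg H (\<lambda>h. (\<phi> h ^ (2 ^ k))\<^sup>2)"
    by (rule avg_power2_le)
  also have "\<dots> = avg H (\<lambda>h. \<phi> h ^ (2 ^ Suc k))"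
    by (simp add: power_mult[symmetric] mult.commute)
  finally show ?case .
qed simp

abbreviation below :: "nat list \<Rightarrow> nat list \<Rightarrow> bool" where
  "below \<equiv> list_all2 (\<lambda>h H. 1 \<le> h \<and> h \<le> H)"

lemma iavg_mono: "(\<And>hs. below hs Hs \<Longrightarrow> \<phi> hs \<le> \<psi> hs) \<Longrightarrow> iavg Hs \<phi> \<le> iavg Hs \<psi>"
  by (induction Hs arbitrary: \<phi> \<psi>) (auto intro!: avg_mono)

lemma iavg_nonneg: "(\<And>hs. below hs Hs \<Longrightarrow> 0 \<le> \<phi> hs) \<Longrightarrow> 0 \<le> iavg Hs \<phi>"
  by (induction Hs arbitrary: \<phi>) (auto intro!: avg_nonneg)

lemma iavg_add: "iavg Hs (\<lambda>hs. \<phi> hs + \<psi> hs) = iavg Hs \<phi> + iavg Hs \<psi>"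
  by (induction Hs arbitrary: \<phi> \<psi>) (auto simp: avg_add)

lemma iavg_cmult: "iavg Hs (\<lambda>hs. c * \<phi> hs) = c * iavg Hs \<phi>"
  by (induction Hs arbitrary: \<phi>) (auto simp: avg_cmult)

lemma iavg_const: "scales N Hs \<Longrightarrow> iavg Hs (\<lambda>_. c) = c"
  by (induction Hs) (auto simp: avg_const)

lemma iavg_append: "iavg (Hs @ Hs') \<phi> = iavg Hs (\<lambda>hs. iavg Hs' (\<lambda>hs'. \<phi> (hs @ hs')))"
  by (induction Hs arbitrary: \<phi>) auto

lemma iavg_power_le:
  "(\<And>hs. below hs Hs \<Longrightarrow> 0 \<le> \<phi> hs) \<Longrightarrow> (iavg Hs \<phi>) ^ (2 ^ k) \<le> iavg Hs (\<lambda>hs. \<phi> hs ^ (2 ^ k))"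
proof (induction Hs arbitrary: \<phi>)
  case (Cons H Hs)
  have "(iavg (H # Hs) \<phi>) ^ (2 ^ k) \<le> avg H (\<lambda>h. (iavg Hs (\<lambda>hs. \<phi> (h # hs))) ^ (2 ^ k))"
    using Cons.prems by (auto intro!: avg_power_le iavg_nonneg)
  also have "\<dots> \<le> iavg (H # Hs) (\<lambda>hs. \<phi> hs ^ (2 ^ k))"
    using Cons.prems by (auto intro!: avg_mono Cons.IH)
  finally show ?case .
qed simp

lemma add_power_le:
  fixes a b :: real
  assumes "0 \<le> a" "0 \<le> b"
  shows "(a + b) ^ p \<le> 2 ^ p * (a ^ p + b ^ p)"
proof -
  have "(a + b) ^ p \<le> (2 * max a b) ^ p" using assms by (intro power_mono) auto
  also have "\<dots> = 2 ^ p * max a b ^ p" by (rule power_mult_distrib)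
  also have "max a b ^ p \<le> a ^ p + b ^ p" using assms by (auto simp: max_def)
  finally show ?thesis by simp
qed

text \<open>The induction step of both elimination chains, with the exponent doubled so that no root
  has to be taken. The base 8 solves 2 * 4 * b = b^2: the 2 comes from splitting the power of a sum,
  the 4 is the coefficient of the average, and b is spent by the inductive bound
  \<open>wz\<close>.\<close>

lemma van_der_Corput_power_step:
  fixes v :: real
  assumes v: "v\<^sup>2 \<le> 2 / real H + 4 * avg H w" and w: "\<And>h. h \<in> {1..H} \<Longrightarrow> 0 \<le> w h" and H: "1 \<le> H"
    and wz: "\<And>h. h \<in> {1..H} \<Longrightarrow> w h ^ (2 ^ k) \<le> 8 ^ (2 ^ k) * (R + z h)" and R: "0 \<le> R"
  shows "v ^ (2 ^ Suc k) \<le> 8 ^ (2 ^ Suc k) * ((1 / real H + R) + avg H z)"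
proof -
  define p where "p = (2::nat) ^ k"
  have p: "p \<ge> 1" by (simp add: p_def)
  have "v ^ (2 ^ Suc k) = (v\<^sup>2) ^ p" by (simp add: p_def power_mult[symmetric] mult.commute)
  also have "\<dots> \<le> (2 / real H + 4 * avg H w) ^ p" using v by (intro power_mono) auto
  also have "\<dots> \<le> 2 ^ p * ((2 / real H) ^ p + (4 * avg H w) ^ p)"
    using w by (intro add_power_le) (auto intro: avg_nonneg)
  also have "\<dots> \<le> 2 ^ p * (4 ^ p * (8 ^ p * (1 / real H)) + 4 ^ p * (8 ^ p * (R + avg H z)))"
  proof (intro mult_left_mono add_mono)
    have "(2 / real H) ^ p = 2 ^ p * (1 / real H) ^ p" by (simp add: power_divide)
    also have "\<dots> \<le> 4 ^ p * (8 ^ p * (1 / real H))"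
    proof -
      have "(1 / real H) ^ p \<le> (1 / real H) ^ 1" using H p by (intro power_decreasing) auto
      also have "\<dots> \<le> 8 ^ p * (1 / real H)" using H by (simp add: divide_right_mono)
      finally show ?thesis by (intro mult_mono power_mono) auto
    qed
    finally show "(2 / real H) ^ p \<le> 4 ^ p * (8 ^ p * (1 / real H))" .
    have "(4 * avg H w) ^ p = 4 ^ p * avg H w ^ p" by (rule power_mult_distrib)
    also have "\<dots> \<le> 4 ^ p * avg H (\<lambda>h. w h ^ p)"
      unfolding p_def using w by (intro mult_left_mono avg_power_le) auto
    also have "\<dots> \<le> 4 ^ p * avg H (\<lambda>h. 8 ^ p * (R + z h))"
      using wz by (intro mult_left_mono avg_mono) (auto simp: p_def)
    also have "avg H (\<lambda>h. 8 ^ p * (R + z h)) = 8 ^ p * (R + avg H z)"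
      using H by (simp add: avg_cmult avg_add avg_const)
    finally show "(4 * avg H w) ^ p \<le> 4 ^ p * (8 ^ p * (R + avg H z))" .
  qed simp
  also have "\<dots> = (2 * 4 * 8) ^ p * ((1 / real H + R) + avg H z)"
    by (simp only: power_mult_distrib) (simp add: algebra_simps)
  also have "(2 * 4 * 8 :: real) ^ p = 8 ^ (2 ^ Suc k)"
    by (simp add: p_def power_mult)
  finally show ?thesis .
qed

subsection \<open>Multiplicative differences\<close>

text \<open>The bound holds at every point, so that sequences along any single orbit are bounded by
  one; essentially bounded functions are brought into this form by \<open>clip\<close>.\<close>

definition unit_bounded :: "'a measure \<Rightarrow> ('a \<Rightarrow> complex) \<Rightarrow> bool" where
  "unit_bounded M F \<longleftrightarrow> F \<in> borel_measurable M \<and> (\<forall>x. cmod (F x) \<le> 1)"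

lemma unit_boundedD [dest]: "unit_bounded M F \<Longrightarrow> F \<in> borel_measurable M" "unit_bounded M F \<Longrightarrow> cmod (F x) \<le> 1"
  by (auto simp: unit_bounded_def)

definition sdiff :: "nat \<Rightarrow> (nat \<Rightarrow> complex) \<Rightarrow> nat \<Rightarrow> complex" where
  "sdiff h a n = a n * cnj (a (n + h))"

fun sdiffs :: "nat list \<Rightarrow> (nat \<Rightarrow> complex) \<Rightarrow> nat \<Rightarrow> complex" where
  "sdiffs [] a = a"
| "sdiffs (h # hs) a = sdiffs hs (sdiff h a)"

definition mdiff :: "('a \<Rightarrow> 'a) \<Rightarrow> nat \<Rightarrow> ('a \<Rightarrow> complex) \<Rightarrow> 'a \<Rightarrow> complex" where
  "mdiff T h F x = F x * cnj (F ((T ^^ h) x))"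

fun mdiffs :: "('a \<Rightarrow> 'a) \<Rightarrow> nat list \<Rightarrow> ('a \<Rightarrow> complex) \<Rightarrow> 'a \<Rightarrow> complex" where
  "mdiffs T [] F = F"
| "mdiffs T (h # hs) F = mdiffs T hs (mdiff T h F)"

text \<open>The truncated subtraction in \<open>sdiff_initial\<close> is intended: a shift beyond \<open>L\<close> leaves the empty
  interval.\<close>

definition initial :: "nat \<Rightarrow> nat \<Rightarrow> complex" where
  "initial L n = (if n \<in> {1..L} then 1 else 0)"

lemma sdiff_initial: "sdiff h (initial L) = initial (L - h)"
  by (auto simp: sdiff_def initial_def fun_eq_iff)

lemma norm_initial: "cmod (initial L n) \<le> 1"
  by (simp add: initial_def)

lemma sdiff_norm: "(\<And>n. cmod (a n) \<le> 1) \<Longrightarrow> cmod (sdiff h a n) \<le> 1"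
  by (simp add: sdiff_def norm_mult mult_le_one)

lemma mdiffs_append: "mdiffs T (hs @ hs') F = mdiffs T hs' (mdiffs T hs F)"
  by (induction hs arbitrary: F) auto

lemma funpow_commute_apply: "(T ^^ m) ((T ^^ n) x) = (T ^^ n) ((T ^^ m) x)"
  by (metis add.commute comp_apply funpow_add)

lemma mdiff_shift: "mdiff T h (\<lambda>x. F ((T ^^ c) x)) = (\<lambda>x. mdiff T h F ((T ^^ c) x))"
  by (simp add: mdiff_def fun_eq_iff funpow_commute_apply[of _ T h])

lemma mdiffs_shift: "mdiffs T hs (\<lambda>x. F ((T ^^ c) x)) = (\<lambda>x. mdiffs T hs F ((T ^^ c) x))"
  by (induction hs arbitrary: F) (simp_all add: mdiff_shift)

section \<open>Measure-preserving systems and the integrated van der Corput inequality\<close>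

locale mp_system = prob_space M for M :: "'a measure" +
  fixes T :: "'a \<Rightarrow> 'a"
  assumes measurable_T [measurable]: "T \<in> measurable M M" and distr_T: "distr M M T = M"

lemma mp_system_iff: "mps M T \<longleftrightarrow> mp_system M T"
  by (auto simp: mps_def mp_system_def mp_system_axioms_def)

lemma borel_measurable_cnj [measurable (raw)]:
  "F \<in> borel_measurable M \<Longrightarrow> (\<lambda>x. cnj (F x)) \<in> borel_measurable M"
  by (rule measurable_compose[where g=cnj]) (auto intro: borel_measurable_continuous_onI continuous_intros)

lemma (in prob_space) integrable_unit_bounded: "unit_bounded M F \<Longrightarrow> integrable M F"
  by (rule integrable_const_bound[of _ 1]) auto

lemma (in prob_space) square_integral_le:
  fixes u :: "'a \<Rightarrow> real"
  assumes "u \<in> borel_measurable M" "\<And>x. \<bar>u x\<bar> \<le> B"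
  shows "(\<integral>x. u x \<partial>M)\<^sup>2 \<le> (\<integral>x. (u x)\<^sup>2 \<partial>M)"
proof -
  have "integrable M u" using assms by (intro integrable_const_bound[of _ B]) auto
  moreover have "integrable M (\<lambda>x. (u x)\<^sup>2)"
  proof (rule integrable_const_bound[of _ "B\<^sup>2"])
    show "AE x in M. norm ((u x)\<^sup>2) \<le> B\<^sup>2"
      using assms(2) power_mono[of "\<bar>u _\<bar>" B 2] by (intro AE_I2) simp
  qed (use assms in measurable)
  ultimately show ?thesis using variance_positive[of u] variance_eq[of u] by simp
qed

text \<open>Pointwise van der Corput, integrated, with Jensen on the left. On the right the modulus
  stays outside the integral, which lets invariance act on every single correlation afterwards.
  Since H <= N gives (N + H)/N <= 2, the constants become 2 and 4.\<close>

lemma (in prob_space) integrated_van_der_Corput: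
  fixes b :: "nat \<Rightarrow> 'a \<Rightarrow> complex"
  assumes b: "\<And>n. unit_bounded M (b n)" and supp: "\<And>n x. n \<notin> {1..N} \<Longrightarrow> b n x = 0"
    and H: "1 \<le> H" "H \<le> N"
  shows "(\<integral>x. cmod ((\<Sum>n=1..N. b n x) / of_nat N) \<partial>M)\<^sup>2
    \<le> 2 / real H + 4 * avg H (\<lambda>h. cmod (\<integral>x. (\<Sum>n=1..N. b n x * cnj (b (n + h) x)) / of_nat N \<partial>M))"
proof -
  have [measurable]: "b n \<in> borel_measurable M" for n using b by auto
  have b1: "cmod (b n x) \<le> 1" for n x using b by auto
  have N: "N > 0" using H by simp
  define c where "c h x = (\<Sum>n=1..N. b n x * cnj (b (n + h) x)) / of_nat N" for h x
  have cm [measurable]: "c h \<in> borel_measurable M" for h unfolding c_def by measurable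
  have "cmod (\<Sum>n=1..N. b n x * cnj (b (n + h) x)) \<le> (\<Sum>n=1..N. 1)" for h x
    by (intro sum_norm_le) (simp add: norm_mult mult_le_one b1)
  then have c1: "cmod (c h x) \<le> 1" for h x
    unfolding c_def using N by (simp add: norm_divide)
  have ci: "integrable M (c h)" for h
    by (intro integrable_unit_bounded) (auto simp: unit_bounded_def c1)
  define A where "A x = cmod ((\<Sum>n=1..N. b n x) / of_nat N)" for x
  have Am [measurable]: "A \<in> borel_measurable M" unfolding A_def by measurable
  have "cmod (\<Sum>n=1..N. b n x) \<le> (\<Sum>n=1..N. 1)" for x
    by (intro sum_norm_le b1)
  then have A1: "\<bar>A x\<bar> \<le> 1" for x unfolding A_def using N by (simp add: norm_divide)
  have pt: "(A x)\<^sup>2 \<le> real (N + H) / (real H * real N)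
      + real (N + H) / real N * (\<Sum>h=1..H. 2 * real (H - h) / (real H)\<^sup>2 * Re (c h x))" for x
  proof -
    have "(real H)\<^sup>2 * (cmod (\<Sum>n=1..N. b n x))\<^sup>2
     \<le> real (N + H) * (real H * real N + 2 * (\<Sum>d=1..H. real (H - d) * Re (\<Sum>n=1..N. b n x * cnj (b (n + d) x))))"
      by (rule van_der_Corput) (auto simp: b1 supp)
    also have "(\<Sum>d=1..H. real (H - d) * Re (\<Sum>n=1..N. b n x * cnj (b (n + d) x)))
      = real N * (\<Sum>d=1..H. real (H - d) * Re (c d x))"
      unfolding c_def sum_distrib_left using N by (intro sum.cong refl) (simp del: Re_sum)
    finally have "(real H)\<^sup>2 * (cmod (\<Sum>n=1..N. b n x))\<^sup>2 / ((real H)\<^sup>2 * (real N)\<^sup>2)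
      \<le> real (N + H) * (real H * real N + 2 * (real N * (\<Sum>d=1..H. real (H - d) * Re (c d x)))) / ((real H)\<^sup>2 * (real N)\<^sup>2)"
      by (rule divide_right_mono) simp
    moreover have "(real H)\<^sup>2 * (cmod (\<Sum>n=1..N. b n x))\<^sup>2 / ((real H)\<^sup>2 * (real N)\<^sup>2) = (A x)\<^sup>2"
      unfolding A_def using H N by (simp add: norm_divide power_divide)
    moreover have "real (N + H) * (real H * real N + 2 * (real N * S)) / ((real H)\<^sup>2 * (real N)\<^sup>2)
       = real (N + H) / (real H * real N) + real (N + H) / real N * (2 / (real H)\<^sup>2 * S)" for S
      using H N by (simp add: field_simps power2_eq_square)
    moreover have "2 / (real H)\<^sup>2 * (\<Sum>d=1..H. real (H - d) * Re (c d x))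
        = (\<Sum>h=1..H. 2 * real (H - h) / (real H)\<^sup>2 * Re (c h x))"
      unfolding sum_distrib_left by (intro sum.cong) auto
    ultimately show ?thesis by (simp only:)
  qed
  have Ai: "integrable M (\<lambda>x. (A x)\<^sup>2)"
    using A1 by (intro integrable_const_bound[of _ 1]) (auto simp: abs_square_le_1)
  have "(\<integral>x. A x \<partial>M)\<^sup>2 \<le> (\<integral>x. (A x)\<^sup>2 \<partial>M)"
    using A1 by (intro square_integral_le) auto
  also have "\<dots> \<le> (\<integral>x. real (N + H) / (real H * real N)
      + real (N + H) / real N * (\<Sum>h=1..H. 2 * real (H - h) / (real H)\<^sup>2 * Re (c h x)) \<partial>M)"
    by (intro integral_mono Ai pt Bochner_Integration.integrable_add integrable_mult_right
        Bochner_Integration.integrable_sum integrable_Re ci) auto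
  also have "\<dots> = real (N + H) / (real H * real N)
      + real (N + H) / real N * (\<Sum>h=1..H. 2 * real (H - h) / (real H)\<^sup>2 * Re (\<integral>x. c h x \<partial>M))"
    using ci by (simp add: prob_space)
  also have "\<dots> \<le> 2 / real H + 2 * (\<Sum>h=1..H. 2 / real H * cmod (\<integral>x. c h x \<partial>M))"
  proof (rule add_mono)
    show "real (N + H) / (real H * real N) \<le> 2 / real H" using H by (simp add: field_simps)
    have "(\<Sum>h=1..H. 2 * real (H - h) / (real H)\<^sup>2 * Re (\<integral>x. c h x \<partial>M)) \<le> (\<Sum>h=1..H. 2 / real H * cmod (\<integral>x. c h x \<partial>M))"
    proof (rule sum_mono)
      fix h assume "h \<in> {1..H}"
      have "2 * real (H - h) / (real H)\<^sup>2 * Re (\<integral>x. c h x \<partial>M) \<le> 2 * real (H - h) / (real H)\<^sup>2 * cmod (\<integral>x. c h x \<partial>M)"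
        by (intro mult_left_mono complex_Re_le_cmod) auto
      also have "\<dots> \<le> 2 / real H * cmod (\<integral>x. c h x \<partial>M)"
        using H by (intro mult_right_mono) (auto simp: field_simps power2_eq_square)
      finally show "2 * real (H - h) / (real H)\<^sup>2 * Re (\<integral>x. c h x \<partial>M) \<le> 2 / real H * cmod (\<integral>x. c h x \<partial>M)" .
    qed
    then have "real (N + H) / real N * (\<Sum>h=1..H. 2 * real (H - h) / (real H)\<^sup>2 * Re (\<integral>x. c h x \<partial>M))
        \<le> real (N + H) / real N * (\<Sum>h=1..H. 2 / real H * cmod (\<integral>x. c h x \<partial>M))"
      by (rule mult_left_mono) simp
    also have "\<dots> \<le> 2 * (\<Sum>h=1..H. 2 / real H * cmod (\<integral>x. c h x \<partial>M))"
      using H by (intro mult_right_mono sum_nonneg) (auto simp: field_simps)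
    finally show "real (N + H) / real N * (\<Sum>h=1..H. 2 * real (H - h) / (real H)\<^sup>2 * Re (\<integral>x. c h x \<partial>M))
        \<le> 2 * (\<Sum>h=1..H. 2 / real H * cmod (\<integral>x. c h x \<partial>M))" .
  qed
  also have "\<dots> = 2 / real H + 4 * avg H (\<lambda>h. cmod (\<integral>x. c h x \<partial>M))"
    unfolding avg_def by (simp add: sum_divide_distrib[symmetric] sum_distrib_left[symmetric])
  finally show ?thesis unfolding A_def c_def .
qed

context mp_system
begin

lemma measurable_iterate [measurable]: "T ^^ n \<in> measurable M M"
  by (rule measurable_compose_n) simp

lemma distr_iterate: "distr M M (T ^^ n) = M"
proof (induction n)
  case (Suc n)
  have "distr M M (T ^^ Suc n) = distr (distr M M (T ^^ n)) M T"
    by (simp add: distr_distr)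
  also have "\<dots> = M" by (simp only: Suc distr_T)
  finally show ?case .
qed (simp add: distr_id id_def)

lemma integral_iterate:
  fixes u :: "'a \<Rightarrow> 'b::{banach, second_countable_topology}"
  assumes "u \<in> borel_measurable M"
  shows "(\<integral>x. u ((T ^^ n) x) \<partial>M) = (\<integral>x. u x \<partial>M)"
  using integral_distr[of "T ^^ n" M M u] assms by (simp add: distr_iterate)

lemma AE_iterate:
  assumes "AE x in M. P x"
  shows "AE x in M. P ((T ^^ n) x)"
proof -
  have "AE x in distr M M (T ^^ n). P x" unfolding distr_iterate by (rule assms)
  then show ?thesis by (rule AE_distrD[rotated]) simp
qed

lemma unit_bounded_mdiff: "unit_bounded M F \<Longrightarrow> unit_bounded M (mdiff T h F)"
  unfolding unit_bounded_def mdiff_def by (auto simp: norm_mult mult_le_one)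

lemma unit_bounded_mdiffs: "unit_bounded M F \<Longrightarrow> unit_bounded M (mdiffs T hs F)"
  by (induction hs arbitrary: F) (auto intro: unit_bounded_mdiff)

lemma unit_bounded_shift: "unit_bounded M F \<Longrightarrow> unit_bounded M (\<lambda>x. F ((T ^^ c) x))"
  unfolding unit_bounded_def by auto

lemma unit_bounded_prod:
  "(\<And>k. k \<in> A \<Longrightarrow> unit_bounded M (g k)) \<Longrightarrow> unit_bounded M (\<lambda>x. \<Prod>k\<in>A. g k x)"
  unfolding unit_bounded_def by (auto simp flip: prod_norm intro!: prod_le_1 borel_measurable_prod)

subsection \<open>Weighted multiple averages\<close>

text \<open>The divisor remains \<open>N\<close> when \<open>a\<close> lives on a shorter interval,
  so the truncations caused by shifts need no renormalisation.\<close>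

definition mean_norm :: "nat \<Rightarrow> nat \<Rightarrow> (nat \<Rightarrow> complex) \<Rightarrow> (nat \<Rightarrow> 'a \<Rightarrow> complex) \<Rightarrow> real" where
  "mean_norm N K a g = (\<integral>x. cmod ((\<Sum>n=1..N. a n * (\<Prod>k=1..K. g k ((T ^^ (k * n)) x))) / of_nat N) \<partial>M)"

lemma norm_average_le:
  assumes "\<And>n. cmod (b n) \<le> 1"
  shows "cmod ((\<Sum>n=1..N. b n) / of_nat N) \<le> 1"
proof (cases "N = 0")
  case False
  have "cmod (\<Sum>n=1..N. b n) \<le> (\<Sum>n=1..N. 1)" by (intro sum_norm_le assms)
  then show ?thesis using False by (simp add: norm_divide)
qed simp

lemma unit_bounded_average:
  assumes "\<And>n. unit_bounded M (b n)"
  shows "unit_bounded M (\<lambda>x. (\<Sum>n=1..N. b n x) / of_nat N)"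
  unfolding unit_bounded_def
proof (intro conjI allI norm_average_le)
  have [measurable]: "b n \<in> borel_measurable M" for n using assms by auto
  show "(\<lambda>x. (\<Sum>n=1..N. b n x) / of_nat N) \<in> borel_measurable M" by measurable
qed (use assms in auto)

lemma unit_bounded_const: "cmod c \<le> 1 \<Longrightarrow> unit_bounded M (\<lambda>_. c)"
  unfolding unit_bounded_def by auto

lemma unit_bounded_mult:
  "unit_bounded M F \<Longrightarrow> unit_bounded M G \<Longrightarrow> unit_bounded M (\<lambda>x. F x * G x)"
  unfolding unit_bounded_def by (auto simp: norm_mult mult_le_one)

lemma unit_bounded_term:
  assumes "\<And>n. cmod (a n) \<le> 1" "\<And>k. unit_bounded M (g k)"
  shows "unit_bounded M (\<lambda>x. a n * (\<Prod>k=1..K. g k ((T ^^ (k * n)) x)))"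
  by (intro unit_bounded_mult unit_bounded_const unit_bounded_prod unit_bounded_shift assms)

lemma mean_norm_nonneg: "0 \<le> mean_norm N K a g"
  unfolding mean_norm_def by (rule integral_nonneg_AE) simp

text \<open>By invariance of the measure each product can be shifted so that one of its factors, \<open>G\<close>, no
  longer depends on \<open>n\<close>.\<close>

lemma norm_integral_average_le:
  assumes "\<And>n. n \<in> {1..N} \<Longrightarrow> (\<integral>x. b n x \<partial>M) = (\<integral>x. G x * b' n x \<partial>M)"
    and b: "\<And>n. unit_bounded M (b n)" and b': "\<And>n. unit_bounded M (b' n)" and G: "unit_bounded M G"
  shows "cmod (\<integral>x. (\<Sum>n=1..N. b n x) / of_nat N \<partial>M) \<le> (\<integral>x. cmod ((\<Sum>n=1..N. b' n x) / of_nat N) \<partial>M)"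
proof -
  have bi: "integrable M (b n)" and bi': "integrable M (\<lambda>x. G x * b' n x)" for n
    using b b' G by (auto intro!: integrable_unit_bounded unit_bounded_mult)
  have "(\<integral>x. (\<Sum>n=1..N. b n x) / of_nat N \<partial>M) = (\<Sum>n=1..N. \<integral>x. G x * b' n x \<partial>M) / of_nat N"
    using bi assms(1) by (simp add: Bochner_Integration.integral_sum)
  also have "\<dots> = (\<integral>x. (\<Sum>n=1..N. G x * b' n x) / of_nat N \<partial>M)"
    using bi' by (simp add: Bochner_Integration.integral_sum)
  also have "cmod \<dots> \<le> (\<integral>x. cmod ((\<Sum>n=1..N. G x * b' n x) / of_nat N) \<partial>M)"
    by (rule integral_norm_bound)
  also have "\<dots> \<le> (\<integral>x. cmod ((\<Sum>n=1..N. b' n x) / of_nat N) \<partial>M)"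
  proof (rule integral_mono)
    show "integrable M (\<lambda>x. cmod ((\<Sum>n=1..N. G x * b' n x) / of_nat N))"
      "integrable M (\<lambda>x. cmod ((\<Sum>n=1..N. b' n x) / of_nat N))"
      using b' G by (intro integrable_norm integrable_unit_bounded unit_bounded_average unit_bounded_mult; simp)+
    fix x
    have "cmod (G x) * cmod ((\<Sum>n=1..N. b' n x) / of_nat N) \<le> 1 * cmod ((\<Sum>n=1..N. b' n x) / of_nat N)"
      using G by (intro mult_right_mono) auto
    then show "cmod ((\<Sum>n=1..N. G x * b' n x) / of_nat N) \<le> cmod ((\<Sum>n=1..N. b' n x) / of_nat N)"
      by (simp add: norm_mult norm_divide flip: sum_distrib_left)
  qed
  finally show ?thesis .
qed

text \<open>The function \<open>g k\<close> moves \<open>k\<close> steps per unit of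
  \<open>n\<close>, so a shift \<open>h\<close> of \<open>n\<close> becomes the difference
  \<open>mdiff T (k * h)\<close>, and a term times its shifted conjugate has the shape of a term
  again.\<close>

lemma van_der_Corput_terms:
  assumes a: "\<And>n. cmod (a n) \<le> 1" and supp: "\<And>n. n \<notin> {1..N} \<Longrightarrow> a n = 0"
    and g: "\<And>k. unit_bounded M (g k)" and H: "1 \<le> H" "H \<le> N"
  shows "(mean_norm N K a g)\<^sup>2 \<le> 2 / real H + 4 * avg H (\<lambda>h.
     cmod (\<integral>x. (\<Sum>n=1..N. sdiff h a n * (\<Prod>k=1..K. mdiff T (k * h) (g k) ((T ^^ (k * n)) x))) / of_nat N \<partial>M))"
proof -
  have expand: "a n * (\<Prod>k=1..K. g k ((T ^^ (k * n)) x)) * cnj (a (n + h) * (\<Prod>k=1..K. g k ((T ^^ (k * (n + h))) x)))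
     = sdiff h a n * (\<Prod>k=1..K. mdiff T (k * h) (g k) ((T ^^ (k * n)) x))" for n h x
  proof -
    have "(T ^^ (k * h)) ((T ^^ (k * n)) x) = (T ^^ (k * (n + h))) x" for k
      by (simp add: funpow_add distrib_left add.commute[of "k * n"])
    then show ?thesis
      by (simp add: sdiff_def mdiff_def prod.distrib cnj_prod mult_ac)
  qed
  have ub: "unit_bounded M (\<lambda>x. a n * (\<Prod>k=1..K. g k ((T ^^ (k * n)) x)))" for n
    by (rule unit_bounded_term[OF a g])
  have zero: "a n * (\<Prod>k=1..K. g k ((T ^^ (k * n)) x)) = 0" if "n \<notin> {1..N}" for n x
    using supp[OF that] by simp
  show ?thesis
    unfolding mean_norm_def
    using integrated_van_der_Corput[of "\<lambda>n x. a n * (\<Prod>k=1..K. g k ((T ^^ (k * n)) x))" N H, OF ub zero H]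
    unfolding expand .
qed

text \<open>All factors of a correlation factor through \<open>T ^^ n\<close>, and invariance
  discards this common shift. The factor of slope one then no longer depends on \<open>n\<close> and
  drops out; slope \<open>Suc k\<close> becomes \<open>k\<close>.\<close>

lemma eliminate_first:
  assumes a: "\<And>n. cmod (a n) \<le> 1" and supp: "\<And>n. n \<notin> {1..N} \<Longrightarrow> a n = 0"
    and g: "\<And>k. unit_bounded M (g k)" and H: "1 \<le> H" "H \<le> N"
  shows "(mean_norm N (Suc K) a g)\<^sup>2
    \<le> 2 / real H + 4 * avg H (\<lambda>h. mean_norm N K (sdiff h a) (\<lambda>k. mdiff T (Suc k * h) (g (Suc k))))"
proof -
  note van_der_Corput_terms[OF a supp g H, where K = "Suc K"]
  also have "avg H (\<lambda>h.
     cmod (\<integral>x. (\<Sum>n=1..N. sdiff h a n * (\<Prod>k=1..Suc K. mdiff T (k * h) (g k) ((T ^^ (k * n)) x))) / of_nat N \<partial>M))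
    \<le> avg H (\<lambda>h. mean_norm N K (sdiff h a) (\<lambda>k. mdiff T (Suc k * h) (g (Suc k))))"
    unfolding mean_norm_def
  proof (intro avg_mono norm_integral_average_le)
    fix h n
    let ?G = "\<lambda>k. mdiff T (k * h) (g k)"
    have G: "unit_bounded M (?G k)" for k by (intro unit_bounded_mdiff g)
    show "unit_bounded M (mdiff T (1 * h) (g 1))" by (rule G)
    show "unit_bounded M (\<lambda>x. sdiff h a n * (\<Prod>k=1..Suc K. ?G k ((T ^^ (k * n)) x)))"
      by (intro unit_bounded_term sdiff_norm a G)
    have 1: "unit_bounded M (\<lambda>x. sdiff h a n * (\<Prod>k=1..K. ?G (Suc k) ((T ^^ (k * n)) x)))"
      by (intro unit_bounded_mult unit_bounded_const unit_bounded_prod unit_bounded_shift sdiff_norm a G)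
    then show "unit_bounded M (\<lambda>x. sdiff h a n * (\<Prod>k=1..K. ?G (Suc k) ((T ^^ (k * n)) x)))" .
    let ?\<phi> = "\<lambda>x. ?G 1 x * (sdiff h a n * (\<Prod>k=1..K. ?G (Suc k) ((T ^^ (k * n)) x)))"
    have "(\<Prod>k=1..Suc K. ?G k ((T ^^ (k * n)) x)) = ?G 1 ((T ^^ n) x) * (\<Prod>k=1..K. ?G (Suc k) ((T ^^ (k * n)) ((T ^^ n) x)))" for x
    proof -
      have fp: "(T ^^ (Suc k * n)) x = (T ^^ (k * n)) ((T ^^ n) x)" for k
        by (metis add.commute comp_apply funpow_add mult_Suc)
      have "(\<Prod>k=1..Suc K. ?G k ((T ^^ (k * n)) x)) = ?G 1 ((T ^^ (1 * n)) x) * (\<Prod>k=Suc 1..Suc K. ?G k ((T ^^ (k * n)) x))"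
        by (rule prod.atLeast_Suc_atMost) simp
      also have "(\<Prod>k=Suc 1..Suc K. ?G k ((T ^^ (k * n)) x)) = (\<Prod>k=1..K. ?G (Suc k) ((T ^^ (Suc k * n)) x))"
        by (rule prod.shift_bounds_cl_Suc_ivl)
      finally show ?thesis by (simp only: fp mult_1)
    qed
    then have "(\<integral>x. sdiff h a n * (\<Prod>k=1..Suc K. ?G k ((T ^^ (k * n)) x)) \<partial>M) = (\<integral>x. ?\<phi> ((T ^^ n) x) \<partial>M)"
      by (simp only: mult_ac)
    also have "\<dots> = (\<integral>x. ?\<phi> x \<partial>M)"
      using unit_bounded_mult[OF G[of 1] 1] by (intro integral_iterate) auto
    finally show "(\<integral>x. sdiff h a n * (\<Prod>k=1..Suc K. ?G k ((T ^^ (k * n)) x)) \<partial>M)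
      = (\<integral>x. mdiff T (1 * h) (g 1) x * (sdiff h a n * (\<Prod>k=1..K. mdiff T (Suc k * h) (g (Suc k)) ((T ^^ (k * n)) x))) \<partial>M)" .
  qed
  finally show ?thesis by simp
qed

text \<open>Eliminating the last function instead, without inverting \<open>T\<close>: the reflection
  \<open>n \<mapsto> L - h + 1 - n\<close> of the interval turns the slope \<open>k\<close> into \<open>Suc K - k\<close>.\<close>

lemma eliminate_last:
  assumes L: "L \<le> N" and g: "\<And>k. unit_bounded M (g k)" and H: "1 \<le> H" "H \<le> N"
  shows "(mean_norm N (Suc K) (initial L) g)\<^sup>2 \<le> 2 / real H + 4 * avg H (\<lambda>h. mean_norm N K (initial (L - h))
    (\<lambda>k x. mdiff T ((Suc K - k) * h) (g (Suc K - k)) ((T ^^ ((Suc K - k) * (L - h + 1))) x)))"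
proof -
  have "initial L n = 0" if "n \<notin> {1..N}" for n
    using that L by (auto simp: initial_def)
  note van_der_Corput_terms[of "initial L" N, OF norm_initial this g H, where K = "Suc K"]
  also have "avg H (\<lambda>h. cmod (\<integral>x. (\<Sum>n=1..N. sdiff h (initial L) n *
       (\<Prod>k=1..Suc K. mdiff T (k * h) (g k) ((T ^^ (k * n)) x))) / of_nat N \<partial>M))
    \<le> avg H (\<lambda>h. mean_norm N K (initial (L - h))
    (\<lambda>k x. mdiff T ((Suc K - k) * h) (g (Suc K - k)) ((T ^^ ((Suc K - k) * (L - h + 1))) x)))"
  proof (rule avg_mono)
    fix h
    define m where "m = L - h"
    define G where "G k = mdiff T (k * h) (g k)" for k
    have G: "unit_bounded M (G k)" for k unfolding G_def by (intro unit_bounded_mdiff g)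
    have m: "m \<le> N" using L by (simp add: m_def)
    let ?b = "\<lambda>n x. initial m (m + 1 - n) * (\<Prod>k=1..Suc K. G k ((T ^^ (k * (m + 1 - n))) x))"
    \<comment> \<open>A permutation of {1..m}. For \<open>n > m\<close> the truncated index
      \<open>m + 1 - n\<close> is 0, where \<open>initial m\<close> vanishes, so both sums extend to
      {1..N}.\<close>
    have reflect: "(\<Sum>n=1..N. initial m n * \<psi> n) = (\<Sum>n=1..N. initial m (m + 1 - n) * \<psi> (m + 1 - n))" for \<psi> :: "nat \<Rightarrow> complex"
    proof -
      have "(\<Sum>n=1..N. initial m n * \<psi> n) = (\<Sum>n=1..m. initial m n * \<psi> n)"
        using m by (intro sum.mono_neutral_right) (auto simp: initial_def)
      also have "\<dots> = (\<Sum>n=1..m. initial m (m + 1 - n) * \<psi> (m + 1 - n))"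
        by (rule sum.reindex_bij_witness[of _ "\<lambda>n. m + 1 - n" "\<lambda>n. m + 1 - n"]) auto
      also have "\<dots> = (\<Sum>n=1..N. initial m (m + 1 - n) * \<psi> (m + 1 - n))"
        using m by (intro sum.mono_neutral_left) (auto simp: initial_def)
      finally show ?thesis .
    qed
    have "cmod (\<integral>x. (\<Sum>n=1..N. ?b n x) / of_nat N \<partial>M)
      \<le> (\<integral>x. cmod ((\<Sum>n=1..N. initial m n * (\<Prod>k=1..K. G (Suc K - k) ((T ^^ ((Suc K - k) * (m + 1))) ((T ^^ (k * n)) x)))) / of_nat N) \<partial>M)"
    proof (rule norm_integral_average_le)
      fix n assume n: "n \<in> {1..N}"
      let ?\<phi> = "\<lambda>n x. G (Suc K) ((T ^^ (Suc K * (m + 1))) x) * (initial m n *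
         (\<Prod>k=1..K. G (Suc K - k) ((T ^^ ((Suc K - k) * (m + 1))) ((T ^^ (k * n)) x))))"
      show "(\<integral>x. ?b n x \<partial>M) = (\<integral>x. ?\<phi> n x \<partial>M)"
      proof (cases "n \<le> m")
        case True
        \<comment> \<open>Exponent count: k * (m + 1 - n) + Suc K * n = k * (m + 1) + (Suc K - k) *
          n. For k = Suc K the dependence on n disappears, and reindexing k to Suc K - k gives the
          slopes 1 to K again.\<close>
        have "?b n ((T ^^ (Suc K * n)) x) = ?\<phi> n x" for x
        proof -
          have "(\<Prod>k=1..K. G k ((T ^^ (k * (m + 1 - n))) ((T ^^ (Suc K * n)) x)))
            = (\<Prod>k=1..K. G (Suc K - k) ((T ^^ ((Suc K - k) * (m + 1 - n))) ((T ^^ (Suc K * n)) x)))"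
            by (rule prod.reindex_bij_witness[of _ "\<lambda>k. Suc K - k" "\<lambda>k. Suc K - k"]) auto
          also have "\<dots> = (\<Prod>k=1..K. G (Suc K - k) ((T ^^ ((Suc K - k) * (m + 1))) ((T ^^ (k * n)) x)))"
          proof (rule prod.cong[OF refl])
            fix k assume "k \<in> {1..K}"
            then obtain l where l: "Suc K = k + l" by (metis atLeastAtMost_iff le_Suc_eq le_iff_add)
            obtain r where r: "m + 1 = n + r" using True by (metis le_iff_add trans_le_add1)
            have "(Suc K - k) * (m + 1 - n) + Suc K * n = (Suc K - k) * (m + 1) + k * n"
              unfolding l r by (simp add: algebra_simps)
            then show "G (Suc K - k) ((T ^^ ((Suc K - k) * (m + 1 - n))) ((T ^^ (Suc K * n)) x))
              = G (Suc K - k) ((T ^^ ((Suc K - k) * (m + 1))) ((T ^^ (k * n)) x))"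
              by (metis comp_apply funpow_add)
          qed
          finally have 1: "(\<Prod>k=1..K. G k ((T ^^ (k * (m + 1 - n))) ((T ^^ (Suc K * n)) x)))
            = (\<Prod>k=1..K. G (Suc K - k) ((T ^^ ((Suc K - k) * (m + 1))) ((T ^^ (k * n)) x)))" .
          have "Suc K * (m + 1 - n) + Suc K * n = Suc K * (m + 1)"
            using True by (simp only: distrib_left[symmetric]) simp
          then have 2: "(T ^^ (Suc K * (m + 1 - n))) ((T ^^ (Suc K * n)) x) = (T ^^ (Suc K * (m + 1))) x"
            by (metis comp_apply funpow_add)
          have "initial m (m + 1 - n) = initial m n" using True n by (auto simp: initial_def)
          then show ?thesis unfolding prod.nat_ivl_Suc'[OF le_SucI[OF le_refl]]
            by (simp only: prod.cl_ivl_Suc if_P[of "1 \<le> Suc K"] 1 2) simp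
        qed
        then have "(\<integral>x. ?\<phi> n x \<partial>M) = (\<integral>x. ?b n ((T ^^ (Suc K * n)) x) \<partial>M)" by simp
        also have "\<dots> = (\<integral>x. ?b n x \<partial>M)"
          using unit_bounded_term[of "\<lambda>_. initial m (m + 1 - n)" G "m + 1 - n" "Suc K", OF norm_initial G]
          by (intro integral_iterate) auto
        finally show ?thesis ..
      next
        case False
        then show ?thesis by (simp add: initial_def)
      qed
    next
      fix n
      show "unit_bounded M (?b n)"
        by (intro unit_bounded_mult unit_bounded_const unit_bounded_prod unit_bounded_shift norm_initial G)
      show "unit_bounded M (\<lambda>x. initial m n * (\<Prod>k=1..K. G (Suc K - k) ((T ^^ ((Suc K - k) * (m + 1))) ((T ^^ (k * n)) x))))"
        by (intro unit_bounded_mult unit_bounded_const unit_bounded_prod norm_initial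
            unit_bounded_shift[of "\<lambda>x. G _ ((T ^^ _) x)"] unit_bounded_shift[of "G _"] G)
      show "unit_bounded M (\<lambda>x. G (Suc K) ((T ^^ (Suc K * (m + 1))) x))"
        by (intro unit_bounded_shift G)
    qed
    also have "(\<lambda>x. (\<Sum>n=1..N. ?b n x)) = (\<lambda>x. \<Sum>n=1..N. initial m n * (\<Prod>k=1..Suc K. G k ((T ^^ (k * n)) x)))"
      by (rule ext, rule reflect[symmetric])
    finally show "cmod (\<integral>x. (\<Sum>n=1..N. sdiff h (initial L) n * (\<Prod>k=1..Suc K. mdiff T (k * h) (g k) ((T ^^ (k * n)) x))) / of_nat N \<partial>M)
      \<le> mean_norm N K (initial (L - h)) (\<lambda>k x. mdiff T ((Suc K - k) * h) (g (Suc K - k)) ((T ^^ ((Suc K - k) * (L - h + 1))) x))"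
      unfolding mean_norm_def G_def m_def sdiff_initial .
  qed
  finally show ?thesis by simp
qed

end

text \<open>The factors with which successive shifts hit the distinguished function, of index
  \<open>s\<close> among \<open>m + 1\<close> functions. While \<open>s\<close> is at least 2, the
  function of slope one is removed and \<open>s\<close> drops by one. At \<open>s = 1\<close> the
  last function is removed instead, and the reflection turns slope one into the largest remaining
  slope.\<close>

fun slopes :: "nat \<Rightarrow> nat \<Rightarrow> nat list" where
  "slopes 0 s = []"
| "slopes (Suc m) s = s # slopes m (if 2 \<le> s then s - 1 else Suc m)"

lemma length_slopes [simp]: "length (slopes m s) = m"
  by (induction m arbitrary: s) auto

lemma slopes_bounds: "1 \<le> s \<Longrightarrow> s \<le> Suc m \<Longrightarrow> c \<in> set (slopes m s) \<Longrightarrow> 1 \<le> c \<and> c \<le> Suc m"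
proof (induction m arbitrary: s)
  case (Suc m)
  then consider "c = s" | "c \<in> set (slopes m (if 2 \<le> s then s - 1 else Suc m))" by auto
  then show ?case
  proof cases
    case 2
    then have "1 \<le> c \<and> c \<le> Suc m" by (rule Suc.IH[rotated 2]) (use Suc.prems in auto)
    then show ?thesis by simp
  qed (use Suc.prems in auto)
qed simp

definition orbit_weights :: "('a \<Rightarrow> 'a) \<Rightarrow> nat \<Rightarrow> nat \<Rightarrow> (nat \<Rightarrow> 'a \<Rightarrow> complex) \<Rightarrow> 'a \<Rightarrow> nat \<Rightarrow> complex" where
  "orbit_weights T L J f x n = initial L n * (\<Prod>j=1..J. f j ((T ^^ (j * n)) x))"

text \<open>The link between the two chains: differences in \<open>n\<close>, produced on the other
  system, are differences of \<open>f j\<close> with slope \<open>j\<close> along the orbit of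
  \<open>x\<close>, on an interval shortened by the shifts.\<close>

lemma sdiffs_orbit_weights:
  "sdiffs hs (orbit_weights T L J f x)
     = orbit_weights T (L - sum_list hs) J (\<lambda>j. mdiffs T (map ((*) j) hs) (f j)) x"
proof (induction hs arbitrary: L f)
  case (Cons h hs)
  have "(T ^^ (j * (n + h))) x = (T ^^ (j * h)) ((T ^^ (j * n)) x)" for j n
    by (metis add.commute comp_apply distrib_left funpow_add)
  moreover have "initial L n * cnj (initial L (n + h)) = initial (L - h) n" for n
    using fun_cong[OF sdiff_initial[of h L], of n] by (simp add: sdiff_def)
  ultimately have "sdiff h (orbit_weights T L J f x) n = orbit_weights T (L - h) J (\<lambda>j. mdiff T (j * h) (f j)) x n" for n
    by (simp add: sdiff_def orbit_weights_def mdiff_def prod.distrib cnj_prod mult_ac)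
  then have "sdiff h (orbit_weights T L J f x) = orbit_weights T (L - h) J (\<lambda>j. mdiff T (j * h) (f j)) x"
    by (rule ext)
  then show ?case by (simp add: Cons.IH)
qed simp

text \<open>What remains of the averages on another system once all its functions are eliminated; it
  depends on the weights alone.\<close>

definition weight_norm :: "nat \<Rightarrow> nat list \<Rightarrow> (nat \<Rightarrow> complex) \<Rightarrow> real" where
  "weight_norm N Hs a = iavg Hs (\<lambda>hs. cmod ((\<Sum>n=1..N. sdiffs hs a n) / of_nat N))"

lemma weight_norm_nonneg: "0 \<le> weight_norm N Hs a"
  unfolding weight_norm_def by (rule iavg_nonneg) simp

context mp_system
begin

text \<open>Each use of \<open>eliminate_first\<close> removes one function and differences the
  weights once. With no function left the integrand is constant.\<close>

lemma weighted_mean_norm_le: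
  assumes "\<And>n. cmod (a n) \<le> 1" "\<And>n. n \<notin> {1..N} \<Longrightarrow> a n = 0"
    and "\<And>k. unit_bounded M (g k)" "scales N Hs"
  shows "mean_norm N (length Hs) a g ^ (2 ^ length Hs)
    \<le> 8 ^ (2 ^ length Hs) * (recip_sum Hs + iavg Hs (\<lambda>hs. cmod ((\<Sum>n=1..N. sdiffs hs a n) / of_nat N)))"
  using assms
proof (induction Hs arbitrary: a g)
  case Nil
  have "0 \<le> cmod ((\<Sum>n=1..N. a n) / of_nat N)" by simp
  then show ?case by (simp add: mean_norm_def prob_space del: norm_ge_zero)
next
  case (Cons H Hs)
  have H: "1 \<le> H" "H \<le> N" "scales N Hs" using Cons.prems(4) by auto
  have "mean_norm N (Suc (length Hs)) a g ^ (2 ^ Suc (length Hs))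
    \<le> 8 ^ (2 ^ Suc (length Hs)) * ((1 / real H + recip_sum Hs)
      + avg H (\<lambda>h. iavg Hs (\<lambda>hs. cmod ((\<Sum>n=1..N. sdiffs hs (sdiff h a) n) / of_nat N))))"
  proof (rule van_der_Corput_power_step[OF eliminate_first[OF Cons.prems(1,2,3) H(1,2)]])
    fix h
    show "mean_norm N (length Hs) (sdiff h a) (\<lambda>k. mdiff T (Suc k * h) (g (Suc k))) ^ (2 ^ length Hs)
      \<le> 8 ^ (2 ^ length Hs) * (recip_sum Hs + iavg Hs (\<lambda>hs. cmod ((\<Sum>n=1..N. sdiffs hs (sdiff h a) n) / of_nat N)))"
      using Cons.prems(1-3) H(3)
      by (intro Cons.IH sdiff_norm unit_bounded_mdiff) (auto simp: sdiff_def)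
  qed (use H in \<open>auto simp: mean_norm_nonneg recip_sum_nonneg\<close>)
  then show ?case by simp
qed

text \<open>Each step removes a function other than \<open>g s\<close>, by
  \<open>eliminate_first\<close> if \<open>s\<close> is at least 2 and by
  \<open>eliminate_last\<close> if \<open>s = 1\<close>. The surviving function ends with slope one
  and carries all differences.\<close>

lemma initial_mean_norm_le:
  assumes "\<And>k. unit_bounded M (g k)" "scales N Hs" "L \<le> N" "1 \<le> s" "s \<le> Suc (length Hs)"
  shows "mean_norm N (Suc (length Hs)) (initial L) g ^ (2 ^ length Hs)
    \<le> 8 ^ (2 ^ length Hs) * (recip_sum Hs + iavg Hs (\<lambda>hs. \<integral>x. cmod ((\<Sum>n=1..L - sum_list hs.
        mdiffs T (map2 (*) (slopes (length Hs) s) hs) (g s) ((T ^^ n) x)) / of_nat N) \<partial>M))"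
  using assms
proof (induction Hs arbitrary: g L s)
  case Nil
  then have s: "s = 1" by simp
  have "(\<Sum>n=1..N. initial L n * g 1 ((T ^^ n) x)) = (\<Sum>n=1..L. g 1 ((T ^^ n) x))" for x
  proof -
    have "(\<Sum>n=1..N. initial L n * g 1 ((T ^^ n) x)) = (\<Sum>n=1..L. initial L n * g 1 ((T ^^ n) x))"
      using Nil.prems(3) by (intro sum.mono_neutral_right) (auto simp: initial_def)
    then show ?thesis by (simp add: initial_def)
  qed
  then have "mean_norm N 1 (initial L) g = (\<integral>x. cmod ((\<Sum>n=1..L. g 1 ((T ^^ n) x)) / of_nat N) \<partial>M)"
    by (simp add: mean_norm_def)
  moreover have "0 \<le> mean_norm N 1 (initial L) g" by (rule mean_norm_nonneg)
  ultimately show ?case by (simp add: s)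
next
  case (Cons H Hs)
  have H: "1 \<le> H" "H \<le> N" "scales N Hs" using Cons.prems(2) by auto
  define m where "m = length Hs"
  define s' where "s' = (if 2 \<le> s then s - 1 else Suc m)"
  have s': "1 \<le> s'" "s' \<le> Suc m" using Cons.prems(4,5) by (auto simp: s'_def m_def)
  define z where "z h = iavg Hs (\<lambda>hs. \<integral>x. cmod ((\<Sum>n=1..L - sum_list (h # hs).
        mdiffs T (map2 (*) (slopes (Suc m) s) (h # hs)) (g s) ((T ^^ n) x)) / of_nat N) \<partial>M)" for h
  have "mean_norm N (Suc (Suc m)) (initial L) g ^ (2 ^ Suc m)
    \<le> 8 ^ (2 ^ Suc m) * ((1 / real H + recip_sum Hs) + avg H z)"
  proof (cases "2 \<le> s")
    case True
    have "initial L n = 0" if "n \<notin> {1..N}" for n using that Cons.prems(3) by (auto simp: initial_def)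
    note van_der_Corput_power_step[OF eliminate_first[OF norm_initial this Cons.prems(1) H(1,2)]]
    then show ?thesis
    proof this
      fix h
      have "mean_norm N (Suc m) (initial (L - h)) (\<lambda>k. mdiff T (Suc k * h) (g (Suc k))) ^ (2 ^ m)
        \<le> 8 ^ (2 ^ m) * (recip_sum Hs + iavg Hs (\<lambda>hs. \<integral>x. cmod ((\<Sum>n=1..L - h - sum_list hs.
        mdiffs T (map2 (*) (slopes m s') hs) (mdiff T (Suc s' * h) (g (Suc s'))) ((T ^^ n) x)) / of_nat N) \<partial>M))"
        unfolding m_def using Cons.prems(1,3) H s'
        by (intro Cons.IH) (auto simp: m_def intro: unit_bounded_mdiff)
      then show "mean_norm N (Suc m) (sdiff h (initial L)) (\<lambda>k. mdiff T (Suc k * h) (g (Suc k))) ^ (2 ^ m)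
        \<le> 8 ^ (2 ^ m) * (recip_sum Hs + z h)"
        using True by (simp add: z_def sdiff_initial s'_def)
    qed (use H in \<open>auto simp: mean_norm_nonneg recip_sum_nonneg\<close>)
  next
    case False
    then have s1: "s = 1" using Cons.prems(4) by simp
    show ?thesis
    proof (rule van_der_Corput_power_step[OF eliminate_last[OF Cons.prems(3,1) H(1,2)]])
      fix h
      let ?c = "\<lambda>k. (Suc (Suc m) - k) * (L - h + 1)"
      have "mean_norm N (Suc m) (initial (L - h))
          (\<lambda>k x. mdiff T ((Suc (Suc m) - k) * h) (g (Suc (Suc m) - k)) ((T ^^ ?c k) x)) ^ (2 ^ m)
        \<le> 8 ^ (2 ^ m) * (recip_sum Hs + iavg Hs (\<lambda>hs. \<integral>x. cmod ((\<Sum>n=1..L - h - sum_list hs.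
        mdiffs T (map2 (*) (slopes m s') hs) (\<lambda>x. mdiff T ((Suc (Suc m) - s') * h) (g (Suc (Suc m) - s')) ((T ^^ ?c s') x)) ((T ^^ n) x)) / of_nat N) \<partial>M))"
        unfolding m_def using Cons.prems(1,3) H s'
        by (intro Cons.IH) (auto simp: m_def intro!: unit_bounded_shift unit_bounded_mdiff)
      \<comment> \<open>The reflection has composed the surviving function with a fixed power of
        \<open>T\<close>. It commutes with the differences and with the orbit sum, and invariance
        removes it from the integral.\<close>
      also have "(\<lambda>hs. \<integral>x. cmod ((\<Sum>n=1..L - h - sum_list hs.
        mdiffs T (map2 (*) (slopes m s') hs) (\<lambda>x. mdiff T ((Suc (Suc m) - s') * h) (g (Suc (Suc m) - s')) ((T ^^ ?c s') x)) ((T ^^ n) x)) / of_nat N) \<partial>M)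
        = (\<lambda>hs. \<integral>x. cmod ((\<Sum>n=1..L - h - sum_list hs.
        mdiffs T (map2 (*) (slopes m s') hs) (mdiff T h (g 1)) ((T ^^ n) x)) / of_nat N) \<partial>M)"
      proof (rule ext)
        fix hs
        let ?F = "mdiffs T (map2 (*) (slopes m s') hs) (mdiff T h (g 1))"
        have s'e: "s' = Suc m" using s1 by (simp add: s'_def)
        have "unit_bounded M ?F" by (intro unit_bounded_mdiffs unit_bounded_mdiff Cons.prems(1))
        then have [measurable]: "?F \<in> borel_measurable M" by auto
        have "(\<integral>x. cmod ((\<Sum>n=1..L - h - sum_list hs. ?F ((T ^^ ?c s') ((T ^^ n) x))) / of_nat N) \<partial>M)
          = (\<integral>x. cmod ((\<Sum>n=1..L - h - sum_list hs. ?F ((T ^^ n) ((T ^^ ?c s') x))) / of_nat N) \<partial>M)"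
          by (simp only: funpow_commute_apply[of "?c s'"])
        also have "\<dots> = (\<integral>x. cmod ((\<Sum>n=1..L - h - sum_list hs. ?F ((T ^^ n) x)) / of_nat N) \<partial>M)"
          by (rule integral_iterate[of "\<lambda>x. cmod ((\<Sum>n=1..L - h - sum_list hs. ?F ((T ^^ n) x)) / of_nat N)"]) measurable
        finally show "(\<integral>x. cmod ((\<Sum>n=1..L - h - sum_list hs.
           mdiffs T (map2 (*) (slopes m s') hs) (\<lambda>x. mdiff T ((Suc (Suc m) - s') * h) (g (Suc (Suc m) - s')) ((T ^^ ?c s') x)) ((T ^^ n) x)) / of_nat N) \<partial>M)
          = (\<integral>x. cmod ((\<Sum>n=1..L - h - sum_list hs. ?F ((T ^^ n) x)) / of_nat N) \<partial>M)"
          unfolding mdiffs_shift by (simp add: s'e)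
      qed
      finally show "mean_norm N (Suc m) (initial (L - h))
          (\<lambda>k x. mdiff T ((Suc (Suc m) - k) * h) (g (Suc (Suc m) - k)) ((T ^^ ?c k) x)) ^ (2 ^ m)
        \<le> 8 ^ (2 ^ m) * (recip_sum Hs + z h)"
        using s1 by (simp add: z_def s'_def)
    qed (use H in \<open>auto simp: mean_norm_nonneg recip_sum_nonneg\<close>)
  qed
  then show ?case unfolding m_def z_def by (simp only: length_Cons iavg.simps recip_sum_simps)
qed

section \<open>The weight bound integrated over x\<close>

lemma integrable_iavg:
  "(\<And>hs. integrable M (\<phi> hs)) \<Longrightarrow> integrable M (\<lambda>x. iavg Hs (\<lambda>hs. \<phi> hs x))"
  by (induction Hs arbitrary: \<phi>) (auto simp: avg_def)

lemma integral_iavg: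
  "(\<And>hs. integrable M (\<phi> hs)) \<Longrightarrow> (\<integral>x. iavg Hs (\<lambda>hs. \<phi> hs x) \<partial>M) = iavg Hs (\<lambda>hs. \<integral>x. \<phi> hs x \<partial>M)"
proof (induction Hs arbitrary: \<phi>)
  case (Cons H Hs)
  have "integrable M (\<lambda>x. iavg Hs (\<lambda>hs. \<phi> (h # hs) x))" for h
    by (rule integrable_iavg[of "\<lambda>hs. \<phi> (h # hs)"]) (rule Cons.prems)
  then have "(\<integral>x. iavg (H # Hs) (\<lambda>hs. \<phi> hs x) \<partial>M) = avg H (\<lambda>h. \<integral>x. iavg Hs (\<lambda>hs. \<phi> (h # hs) x) \<partial>M)"
    by (simp add: avg_def Bochner_Integration.integral_sum)
  also have "\<dots> = iavg (H # Hs) (\<lambda>hs. \<integral>x. \<phi> hs x \<partial>M)"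
    using Cons.prems by (simp add: Cons.IH[of "\<lambda>hs. \<phi> (_ # hs)"])
  finally show ?case .
qed simp

lemma unit_bounded_sdiffs_average:
  assumes "\<And>j. unit_bounded M (f j)"
  shows "unit_bounded M (\<lambda>x. (\<Sum>n=1..N. sdiffs hs (orbit_weights T L J f x) n) / of_nat N)"
  unfolding sdiffs_orbit_weights orbit_weights_def
  by (intro unit_bounded_average unit_bounded_term norm_initial unit_bounded_mdiffs assms)

lemma integrable_weight_norm:
  assumes "\<And>j. unit_bounded M (f j)"
  shows "integrable M (\<lambda>x. weight_norm N Hs (orbit_weights T L J f x))"
  unfolding weight_norm_def
  by (intro integrable_iavg integrable_norm integrable_unit_bounded unit_bounded_sdiffs_average assms)

text \<open>The first \<open>length Hs\<close> differences were made in \<open>n\<close> for the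
  other system and reach \<open>f s\<close> with slope \<open>s\<close>; the others come from
  eliminations on \<open>M\<close> and follow \<open>slopes\<close>. Convexity moves the power
  inside the first group of averages, where \<open>initial_mean_norm_le\<close> applies to the
  differenced functions.\<close>

lemma integral_weight_norm_le:
  assumes f: "\<And>j. unit_bounded M (f j)" and sc: "scales N (Hs @ Hs')" and s: "1 \<le> s" "s \<le> Suc (length Hs')"
  shows "(\<integral>x. weight_norm N Hs (orbit_weights T N (Suc (length Hs')) f x) \<partial>M) ^ (2 ^ length Hs')
    \<le> 8 ^ (2 ^ length Hs') * (recip_sum Hs' + iavg (Hs @ Hs') (\<lambda>hs. \<integral>x. cmod ((\<Sum>n=1..N - sum_list hs.
        mdiffs T (map2 (*) (replicate (length Hs) s @ slopes (length Hs') s) hs) (f s) ((T ^^ n) x)) / of_nat N) \<partial>M))"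
proof -
  define m where "m = length Hs'"
  have sc': "scales N Hs" "scales N Hs'" using sc by auto
  have "(\<integral>x. weight_norm N Hs (orbit_weights T N (Suc m) f x) \<partial>M)
    = iavg Hs (\<lambda>hs. \<integral>x. cmod ((\<Sum>n=1..N. sdiffs hs (orbit_weights T N (Suc m) f x) n) / of_nat N) \<partial>M)"
    unfolding weight_norm_def
    by (intro integral_iavg integrable_norm integrable_unit_bounded unit_bounded_sdiffs_average f)
  also have "\<dots> = iavg Hs (\<lambda>hs. mean_norm N (Suc m) (initial (N - sum_list hs)) (\<lambda>j. mdiffs T (map ((*) j) hs) (f j)))"
    unfolding sdiffs_orbit_weights orbit_weights_def mean_norm_def ..
  finally have "(\<integral>x. weight_norm N Hs (orbit_weights T N (Suc m) f x) \<partial>M) ^ (2 ^ m)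
    \<le> iavg Hs (\<lambda>hs. mean_norm N (Suc m) (initial (N - sum_list hs)) (\<lambda>j. mdiffs T (map ((*) j) hs) (f j)) ^ (2 ^ m))"
    by (simp add: iavg_power_le mean_norm_nonneg)
  also have "\<dots> \<le> iavg Hs (\<lambda>hs. 8 ^ (2 ^ m) * (recip_sum Hs' + iavg Hs' (\<lambda>hs'. \<integral>x. cmod ((\<Sum>n=1..N - sum_list (hs @ hs').
        mdiffs T (map2 (*) (replicate (length Hs) s @ slopes m s) (hs @ hs')) (f s) ((T ^^ n) x)) / of_nat N) \<partial>M)))"
  proof (rule iavg_mono)
    fix hs assume "below hs Hs"
    then have len: "length hs = length Hs" by (rule list_all2_lengthD)
    have "map2 (*) (replicate (length hs) s) hs = map ((*) s) hs"
      by (induction hs) auto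
    then have eq: "map2 (*) (replicate (length Hs) s @ slopes m s) (hs @ hs') = map ((*) s) hs @ map2 (*) (slopes m s) hs'" for hs'
      by (simp add: len)
    show "mean_norm N (Suc m) (initial (N - sum_list hs)) (\<lambda>j. mdiffs T (map ((*) j) hs) (f j)) ^ (2 ^ m)
     \<le> 8 ^ (2 ^ m) * (recip_sum Hs' + iavg Hs' (\<lambda>hs'. \<integral>x. cmod ((\<Sum>n=1..N - sum_list (hs @ hs').
        mdiffs T (map2 (*) (replicate (length Hs) s @ slopes m s) (hs @ hs')) (f s) ((T ^^ n) x)) / of_nat N) \<partial>M))"
      unfolding eq mdiffs_append sum_list_append diff_diff_left[symmetric]
      unfolding m_def using s by (intro initial_mean_norm_le unit_bounded_mdiffs f sc'(2)) auto
  qed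
  also have "\<dots> = 8 ^ (2 ^ m) * (recip_sum Hs' + iavg (Hs @ Hs') (\<lambda>hs. \<integral>x. cmod ((\<Sum>n=1..N - sum_list hs.
        mdiffs T (map2 (*) (replicate (length Hs) s @ slopes m s) hs) (f s) ((T ^^ n) x)) / of_nat N) \<partial>M))"
    by (simp add: iavg_cmult iavg_add iavg_const[OF sc'(1)] iavg_append)
  finally show ?thesis by (simp add: m_def)
qed

end

subsection \<open>Correlations and the Wiener-Wintner supremum\<close>

text \<open>Factors of modulus at most one turn the moduli into a linear form, to which
  \<open>correlations_le_exponential_sum\<close> applies. Two truncations are paid for: replacing
  the range L - h by L changes at most H terms for each h, which gives H/N, and the exponential sums
  over {1..L} and {1..N} differ by at most N - L.\<close>

lemma avg_correlations_le:
  fixes u :: "nat \<Rightarrow> complex"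
  assumes u: "\<And>n. cmod (u n) \<le> 1" and c: "c \<ge> 1" and H: "1 \<le> H" "H \<le> N" and L: "L \<le> N"
    and S: "\<And>t::real. cmod ((\<Sum>n=1..N. u n * cis (2 * pi * real n * t)) / of_nat N) \<le> S"
  shows "avg H (\<lambda>h. cmod ((\<Sum>n=1..L - h. u n * cnj (u (n + c * h))) / of_nat N))
    \<le> real H / real N + (1 + real c) * (real N / real H) * (S + real (N - L) / real N)"
proof -
  have N: "N > 0" using H by simp
  define z where "z h = (\<Sum>n=1..L. u n * cnj (u (n + c * h)))" for h
  define \<theta> where "\<theta> h = cnj (sgn (z h))" for h
  have \<theta>z: "\<theta> h * z h = of_real (cmod (z h))" for h
  proof (cases "z h = 0")
    case False
    have "cnj (z h) * z h = of_real (cmod (z h)) * of_real (cmod (z h))"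
      by (metis complex_norm_square mult.commute power2_eq_square of_real_mult)
    then show ?thesis using False by (simp add: \<theta>_def sgn_eq field_simps)
  qed (simp add: \<theta>_def)
  have S': "cmod (\<Sum>n=1..L. u n * cis (2 * pi * real n * t)) \<le> real N * S + real (N - L)" for t :: real
  proof -
    have "(\<Sum>n=1..N. u n * cis (2 * pi * real n * t))
       = (\<Sum>n=1..L. u n * cis (2 * pi * real n * t)) + (\<Sum>n\<in>{Suc L..N}. u n * cis (2 * pi * real n * t))"
    proof -
      have "{1..N} = {1..L} \<union> {Suc L..N}" using L by auto
      then show ?thesis by (simp only:) (rule sum.union_disjoint, auto)
    qed
    then have "(\<Sum>n=1..L. u n * cis (2 * pi * real n * t))
       = (\<Sum>n=1..N. u n * cis (2 * pi * real n * t)) - (\<Sum>n\<in>{Suc L..N}. u n * cis (2 * pi * real n * t))" by simp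
    then have "cmod (\<Sum>n=1..L. u n * cis (2 * pi * real n * t))
       \<le> cmod (\<Sum>n=1..N. u n * cis (2 * pi * real n * t)) + cmod (\<Sum>n\<in>{Suc L..N}. u n * cis (2 * pi * real n * t))"
      by (simp only: norm_triangle_ineq4)
    also have "cmod (\<Sum>n=1..N. u n * cis (2 * pi * real n * t)) \<le> real N * S"
      using S[of t] N by (simp add: norm_divide field_simps)
    also have "cmod (\<Sum>n\<in>{Suc L..N}. u n * cis (2 * pi * real n * t)) \<le> (\<Sum>n\<in>{Suc L..N}. 1)"
      using u by (intro sum_norm_le) (simp add: norm_mult)
    finally show ?thesis using L by (simp add: of_nat_diff)
  qed
  have S0: "0 \<le> real N * S + real (N - L)" using S'[of 0] norm_ge_zero order_trans by blast
  have "(\<Sum>h=1..H. cmod (z h)) = cmod (\<Sum>h=1..H. \<theta> h * z h)"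
    unfolding \<theta>z of_real_sum[symmetric] norm_of_real by (simp add: sum_nonneg)
  also have "\<dots> \<le> (real N * S + real (N - L)) * real (L + c * H)"
    unfolding z_def using u c S' by (intro correlations_le_exponential_sum) (auto simp: \<theta>_def norm_sgn)
  also have "\<dots> \<le> (real N * S + real (N - L)) * ((1 + real c) * real N)"
  proof (rule mult_left_mono[OF _ S0])
    have "L + c * H \<le> N + c * N" using L H by (intro add_mono mult_mono) auto
    then have "real (L + c * H) \<le> real (N + c * N)" by (rule of_nat_mono)
    then show "real (L + c * H) \<le> (1 + real c) * real N" by (simp add: distrib_right)
  qed
  finally have zsum: "(\<Sum>h=1..H. cmod (z h)) \<le> (real N * S + real (N - L)) * ((1 + real c) * real N)" .
  have "(\<Sum>h=1..H. cmod (\<Sum>n=1..L - h. u n * cnj (u (n + c * h)))) \<le> (\<Sum>h=1..H. real H + cmod (z h))"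
  proof (rule sum_mono)
    fix h assume h: "h \<in> {1..H}"
    have "z h = (\<Sum>n=1..L - h. u n * cnj (u (n + c * h))) + (\<Sum>n\<in>{Suc (L - h)..L}. u n * cnj (u (n + c * h)))"
    proof -
      have "{1..L} = {1..L - h} \<union> {Suc (L - h)..L}" by auto
      then show ?thesis unfolding z_def by (simp only:) (rule sum.union_disjoint, auto)
    qed
    then have "(\<Sum>n=1..L - h. u n * cnj (u (n + c * h))) = z h - (\<Sum>n\<in>{Suc (L - h)..L}. u n * cnj (u (n + c * h)))" by simp
    then have "cmod (\<Sum>n=1..L - h. u n * cnj (u (n + c * h)))
        \<le> cmod (z h) + cmod (\<Sum>n\<in>{Suc (L - h)..L}. u n * cnj (u (n + c * h)))"
      by (simp only: norm_triangle_ineq4)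
    also have "cmod (\<Sum>n\<in>{Suc (L - h)..L}. u n * cnj (u (n + c * h))) \<le> (\<Sum>n\<in>{Suc (L - h)..L}. 1)"
      using u by (intro sum_norm_le) (simp add: norm_mult mult_le_one)
    also have "\<dots> \<le> real H" using h by (cases "h \<le> L") (auto simp: of_nat_diff)
    finally show "cmod (\<Sum>n=1..L - h. u n * cnj (u (n + c * h))) \<le> real H + cmod (z h)" by simp
  qed
  also have "\<dots> \<le> real H * real H + (real N * S + real (N - L)) * ((1 + real c) * real N)"
    using zsum by (simp add: sum.distrib)
  finally have fin: "(\<Sum>h=1..H. cmod (\<Sum>n=1..L - h. u n * cnj (u (n + c * h))))
      \<le> real H * real H + (real N * S + real (N - L)) * ((1 + real c) * real N)" .
  have "avg H (\<lambda>h. cmod ((\<Sum>n=1..L - h. u n * cnj (u (n + c * h))) / of_nat N))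
     = (\<Sum>h=1..H. cmod (\<Sum>n=1..L - h. u n * cnj (u (n + c * h)))) / (real H * real N)"
    unfolding avg_def norm_divide norm_of_nat sum_divide_distrib[symmetric] by (simp add: mult.commute)
  also have "\<dots> \<le> (real H * real H + (real N * S + real (N - L)) * ((1 + real c) * real N)) / (real H * real N)"
    by (intro divide_right_mono fin) simp
  also have "\<dots> = real H / real N + (1 + real c) * (real N / real H) * (S + real (N - L) / real N)"
    using N H by (simp add: divide_simps)
  finally show ?thesis .
qed

section \<open>The Wiener-Wintner supremum of a function\<close>

definition ww_sup :: "('a \<Rightarrow> 'a) \<Rightarrow> nat \<Rightarrow> ('a \<Rightarrow> complex) \<Rightarrow> 'a \<Rightarrow> real" where
  "ww_sup T N F x = (\<Squnion>t::real. cmod ((1 / of_nat N) *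
     (\<Sum>n=1..N. exp (2 * of_real pi * \<i> * of_nat n * of_real t) * F ((T ^^ n) x))))"

lemma ww_exp_eq_cis: "exp (2 * of_real pi * \<i> * of_nat n * of_real t) = cis (2 * pi * real n * t)"
  unfolding cis_conv_exp by (rule arg_cong[of _ _ exp]) (simp add: mult_ac)

lemma ww_term_le:
  "cmod ((1 / of_nat N) * (\<Sum>n=1..N. exp (2 * of_real pi * \<i> * of_nat n * of_real t) * F ((T ^^ n) x)))
    \<le> (\<Sum>n=1..N. cmod (F ((T ^^ n) x))) / real N"
proof -
  have "cmod (\<Sum>n=1..N. exp (2 * of_real pi * \<i> * of_nat n * of_real t) * F ((T ^^ n) x)) \<le> (\<Sum>n=1..N. cmod (F ((T ^^ n) x)))"
    unfolding ww_exp_eq_cis by (intro sum_norm_le) (simp add: norm_mult)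
  then show ?thesis by (simp add: norm_mult norm_divide divide_right_mono)
qed

text \<open>A supremum of reals is meaningful only for bounded sets; the upper-bound property of
  \<open>ww_sup\<close> rests on this.\<close>

lemma ww_bdd: "bdd_above (range (\<lambda>t::real. cmod ((1 / of_nat N) *
     (\<Sum>n=1..N. exp (2 * of_real pi * \<i> * of_nat n * of_real t) * F ((T ^^ n) x)))))"
  by (rule bdd_aboveI2[OF ww_term_le])

lemma ww_sup_upper: "cmod ((\<Sum>n=1..N. F ((T ^^ n) x) * cis (2 * pi * real n * t)) / of_nat N) \<le> ww_sup T N F x"
proof -
  have "(\<Sum>n=1..N. F ((T ^^ n) x) * cis (2 * pi * real n * t)) / of_nat N
     = (1 / of_nat N) * (\<Sum>n=1..N. exp (2 * of_real pi * \<i> * of_nat n * of_real t) * F ((T ^^ n) x))"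
    unfolding ww_exp_eq_cis by (simp add: mult.commute)
  also have "cmod \<dots> \<le> ww_sup T N F x"
    unfolding ww_sup_def by (rule cSUP_upper[OF UNIV_I ww_bdd])
  finally show ?thesis .
qed

lemma ww_sup_nonneg: "0 \<le> ww_sup T N F x"
  by (rule order_trans[OF norm_ge_zero ww_sup_upper[where t = 0]])

lemma ww_sup_le: "(\<And>n. cmod (F ((T ^^ n) x)) \<le> B) \<Longrightarrow> 0 \<le> B \<Longrightarrow> ww_sup T N F x \<le> B"
  unfolding ww_sup_def
proof (rule cSUP_least)
  fix t :: real assume B: "\<And>n. cmod (F ((T ^^ n) x)) \<le> B" "0 \<le> B"
  have "(\<Sum>n=1..N. cmod (F ((T ^^ n) x))) \<le> (\<Sum>n=1..N. B)" by (intro sum_mono B)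
  then have "(\<Sum>n=1..N. cmod (F ((T ^^ n) x))) / real N \<le> B" using B(2) by (cases "N = 0") (auto simp: field_simps)
  then show "cmod ((1 / of_nat N) * (\<Sum>n=1..N. exp (2 * of_real pi * \<i> * of_nat n * of_real t) * F ((T ^^ n) x))) \<le> B"
    by (rule order_trans[OF ww_term_le])
qed auto

lemma ww_sup_cong: "(\<And>n. F ((T ^^ n) x) = c * G ((T ^^ n) x)) \<Longrightarrow> ww_sup T N F x = cmod c * ww_sup T N G x"
proof -
  assume *: "\<And>n. F ((T ^^ n) x) = c * G ((T ^^ n) x)"
  define \<phi> where "\<phi> t = cmod ((1 / of_nat N) *
     (\<Sum>n=1..N. exp (2 * of_real pi * \<i> * of_nat n * of_real t) * G ((T ^^ n) x)))" for t :: real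
  have bdd: "bdd_above (range \<phi>)" unfolding \<phi>_def by (rule ww_bdd)
  have eq: "cmod ((1 / of_nat N) * (\<Sum>n=1..N. exp (2 * of_real pi * \<i> * of_nat n * of_real t) * F ((T ^^ n) x))) = cmod c * \<phi> t" for t
  proof -
    have "(1 / of_nat N) * (\<Sum>n=1..N. exp (2 * of_real pi * \<i> * of_nat n * of_real t) * F ((T ^^ n) x))
      = c * ((1 / of_nat N) * (\<Sum>n=1..N. exp (2 * of_real pi * \<i> * of_nat n * of_real t) * G ((T ^^ n) x)))"
      unfolding * sum_distrib_left by (simp only: mult_ac)
    then show ?thesis by (simp only: norm_mult \<phi>_def)
  qed
  have "(SUP t. cmod c * \<phi> t) = cmod c * (SUP t. \<phi> t)"
  proof (cases "c = 0")
    case False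
    show ?thesis
    proof (rule antisym)
      show "(SUP t. cmod c * \<phi> t) \<le> cmod c * (SUP t. \<phi> t)"
        by (rule cSUP_least) (auto intro!: mult_left_mono cSUP_upper bdd)
      obtain b where b: "\<And>t. \<phi> t \<le> b" using bdd by (auto simp: bdd_above_def)
      then have "bdd_above (range (\<lambda>t. cmod c * \<phi> t))"
        by (intro bdd_aboveI2[of _ _ "cmod c * b"]) (auto intro: mult_left_mono)
      then have "\<phi> t \<le> (SUP t. cmod c * \<phi> t) / cmod c" for t
        using cSUP_upper[of t UNIV "\<lambda>t. cmod c * \<phi> t"] False by (simp add: field_simps)
      then have "(SUP t. \<phi> t) \<le> (SUP t. cmod c * \<phi> t) / cmod c" by (intro cSUP_least) auto
      then show "cmod c * (SUP t. \<phi> t) \<le> (SUP t. cmod c * \<phi> t)" using False by (simp add: field_simps)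
    qed
  qed simp
  then show ?thesis unfolding ww_sup_def eq \<phi>_def[symmetric] .
qed

context mp_system
begin

text \<open>The averages are continuous in \<open>t\<close>, so the uncountable supremum is already
  approached at rational \<open>t\<close>.\<close>

lemma measurable_ww_sup [measurable]:
  assumes [measurable]: "F \<in> borel_measurable M"
  shows "ww_sup T N F \<in> borel_measurable M"
proof -
  define \<phi> where "\<phi> t x = cmod ((1 / of_nat N) *
     (\<Sum>n=1..N. exp (2 * of_real pi * \<i> * of_nat n * of_real t) * F ((T ^^ n) x)))" for t x
  have [measurable]: "\<phi> t \<in> borel_measurable M" for t unfolding \<phi>_def by measurable
  have cont: "continuous_on UNIV (\<lambda>t. \<phi> t x)" for x
    unfolding \<phi>_def ww_exp_eq_cis by (intro continuous_intros)
  show ?thesis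
  proof (rule borel_measurableI_greater)
    fix a
    have "{x \<in> space M. a < ww_sup T N F x} = (\<Union>q::rat. {x \<in> space M. a < \<phi> (of_rat q) x})"
    proof safe
      fix x assume x: "x \<in> space M" "a < ww_sup T N F x"
      then obtain t where "a < \<phi> t x"
        unfolding ww_sup_def \<phi>_def by (subst (asm) less_cSUP_iff[OF _ ww_bdd]) auto
      moreover have "open {t. a < \<phi> t x}" using cont by (intro open_Collect_less continuous_on_const)
      ultimately obtain e where e: "e > 0" "\<And>y. \<bar>y - t\<bar> < e \<Longrightarrow> a < \<phi> y x"
        unfolding open_real by blast
      obtain q where "q \<in> \<rat>" "t < q" "q < t + e"
        using Rats_dense_in_real[of t "t + e"] e(1) by auto
      with e(2)[of q] have "\<exists>q\<in>\<rat>. a < \<phi> q x" by auto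
      then show "x \<in> (\<Union>q::rat. {x \<in> space M. a < \<phi> (of_rat q) x})" using x by (auto elim!: Rats_cases)
    next
      fix x q assume "x \<in> space M" "a < \<phi> (of_rat q) x"
      then show "a < ww_sup T N F x"
        unfolding ww_sup_def \<phi>_def by (subst less_cSUP_iff[OF _ ww_bdd]) auto
    qed
    also have "\<dots> \<in> sets M" by measurable
    finally show "{x \<in> space M. a < ww_sup T N F x} \<in> sets M" .
  qed
qed

lemma integrable_ww_sup:
  assumes "unit_bounded M F" shows "integrable M (ww_sup T N F)"
  using assms by (intro integrable_const_bound[of _ 1] AE_I2) (auto simp: ww_sup_nonneg intro!: ww_sup_le)

text \<open>Along the orbit of \<open>x\<close> the differenced function is the correlation of
  \<open>F ((T ^^ n) x)\<close> at lag \<open>c * h\<close>, so the pointwise bound can be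
  integrated.\<close>

lemma avg_integral_mdiff_le:
  assumes F: "unit_bounded M F" and c: "c \<ge> 1" and H: "1 \<le> H" "H \<le> N" and L: "L \<le> N"
  shows "avg H (\<lambda>h. \<integral>x. cmod ((\<Sum>n=1..L - h. mdiff T (c * h) F ((T ^^ n) x)) / of_nat N) \<partial>M)
    \<le> real H / real N + (1 + real c) * (real N / real H) * ((\<integral>x. ww_sup T N F x \<partial>M) + real (N - L) / real N)"
proof -
  have G: "unit_bounded M (mdiff T (c * h) F)" for h using F by (rule unit_bounded_mdiff)
  have [measurable]: "mdiff T (c * h) F \<in> borel_measurable M" for h using G by auto
  have bd: "cmod ((\<Sum>n=1..L - h. mdiff T (c * h) F ((T ^^ n) x)) / of_nat N) \<le> 1" for h x
  proof -
    have "cmod (\<Sum>n=1..L - h. mdiff T (c * h) F ((T ^^ n) x)) \<le> (\<Sum>n=1..L - h. 1)"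
      using G by (intro sum_norm_le) auto
    then show ?thesis using L H by (simp add: norm_divide)
  qed
  have int: "integrable M (\<lambda>x. cmod ((\<Sum>n=1..L - h. mdiff T (c * h) F ((T ^^ n) x)) / of_nat N))" for h
    by (intro integrable_norm integrable_const_bound[of _ 1] AE_I2 bd) measurable
  have "avg H (\<lambda>h. \<integral>x. cmod ((\<Sum>n=1..L - h. mdiff T (c * h) F ((T ^^ n) x)) / of_nat N) \<partial>M)
    = (\<integral>x. avg H (\<lambda>h. cmod ((\<Sum>n=1..L - h. mdiff T (c * h) F ((T ^^ n) x)) / of_nat N)) \<partial>M)"
    using int by (simp add: avg_def Bochner_Integration.integral_sum)
  also have "\<dots> \<le> (\<integral>x. real H / real N + (1 + real c) * (real N / real H) * (ww_sup T N F x + real (N - L) / real N) \<partial>M)"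
  proof (rule integral_mono)
    show "integrable M (\<lambda>x. avg H (\<lambda>h. cmod ((\<Sum>n=1..L - h. mdiff T (c * h) F ((T ^^ n) x)) / of_nat N)))"
      unfolding avg_def using int by auto
    show "integrable M (\<lambda>x. real H / real N + (1 + real c) * (real N / real H) * (ww_sup T N F x + real (N - L) / real N))"
      using integrable_ww_sup[OF F] by auto
    fix x
    have "mdiff T (c * h) F ((T ^^ n) x) = F ((T ^^ n) x) * cnj (F ((T ^^ (n + c * h)) x))" for h n
      unfolding mdiff_def by (metis add.commute comp_apply funpow_add)
    then show "avg H (\<lambda>h. cmod ((\<Sum>n=1..L - h. mdiff T (c * h) F ((T ^^ n) x)) / of_nat N))
      \<le> real H / real N + (1 + real c) * (real N / real H) * (ww_sup T N F x + real (N - L) / real N)"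
      using avg_correlations_le[of "\<lambda>n. F ((T ^^ n) x)" c H N L "ww_sup T N F x", OF _ c H L ww_sup_upper] F
      by auto
  qed
  also have "\<dots> = real H / real N + (1 + real c) * (real N / real H) * ((\<integral>x. ww_sup T N F x \<partial>M) + real (N - L) / real N)"
    using integrable_ww_sup[OF F, of N] by (simp add: prob_space)
  finally show ?thesis .
qed

end

subsection \<open>Sums over boxes of index vectors\<close>

abbreviation index_list :: "nat \<Rightarrow> (nat \<Rightarrow> 'b) \<Rightarrow> 'b list" where
  "index_list d h \<equiv> map h [1..<Suc d]"

lemma sum_index_box_Suc:
  fixes \<phi> :: "(nat \<Rightarrow> nat) \<Rightarrow> 'b::comm_monoid_add"
  shows "(\<Sum>h\<in>index_box (Suc d) m. \<phi> h) = (\<Sum>h\<in>index_box d m. \<Sum>k=1..m. \<phi> (h(Suc d := k)))"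
proof -
  have "{1..Suc d} = insert (Suc d) {1..d}" by auto
  then have "index_box (Suc d) m = (\<lambda>(k, h). h(Suc d := k)) ` ({1..m} \<times> index_box d m)"
    unfolding index_box_def by (simp only: PiE_insert_eq)
  then have "(\<Sum>h\<in>index_box (Suc d) m. \<phi> h) = (\<Sum>(k, h)\<in>{1..m} \<times> index_box d m. \<phi> (h(Suc d := k)))"
    using inj_combinator[of "Suc d" "{1..d}" "\<lambda>_. {1..m}"]
    by (simp add: sum.reindex index_box_def comp_def case_prod_unfold)
  also have "\<dots> = (\<Sum>k=1..m. \<Sum>h\<in>index_box d m. \<phi> (h(Suc d := k)))"
    by (rule sum.cartesian_product[symmetric])
  also have "\<dots> = (\<Sum>h\<in>index_box d m. \<Sum>k=1..m. \<phi> (h(Suc d := k)))" by (rule sum.swap)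
  finally show ?thesis .
qed

text \<open>Passes from lists of shifts, as van der Corput produces them, to the extensional index
  vectors of the Wiener-Wintner condition.\<close>

lemma iavg_replicate:
  "iavg (replicate d H) \<phi> = (\<Sum>h\<in>index_box d H. \<phi> (index_list d h)) / real H ^ d"
proof (induction d arbitrary: \<phi>)
  case 0
  have "index_box 0 H = {\<lambda>_. undefined}" by (simp add: index_box_def)
  then show ?case by simp
next
  case (Suc d)
  have "iavg (replicate (Suc d) H) \<phi> = iavg (replicate d H) (\<lambda>hs. avg H (\<lambda>k. \<phi> (hs @ [k])))"
    unfolding replicate_Suc replicate_append_same[symmetric] iavg_append by simp
  also have "\<dots> = (\<Sum>h\<in>index_box d H. \<Sum>k=1..H. \<phi> (index_list d h @ [k])) / real H ^ Suc d"
    unfolding Suc.IH avg_def by (simp add: sum_divide_distrib mult.commute)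
  also have "(\<Sum>h\<in>index_box d H. \<Sum>k=1..H. \<phi> (index_list d h @ [k])) = (\<Sum>h\<in>index_box (Suc d) H. \<phi> (index_list (Suc d) h))"
    unfolding sum_index_box_Suc
  proof (intro sum.cong refl)
    fix h :: "nat \<Rightarrow> nat" and k
    have "index_list (Suc d) (h(Suc d := k)) = index_list d h @ [k]" by simp
    then show "\<phi> (index_list d h @ [k]) = \<phi> (index_list (Suc d) (h(Suc d := k)))" by simp
  qed
  finally show ?case .
qed

text \<open>Dilating each coordinate by its entry of \<open>cs\<close> maps the box of side
  \<open>H\<close> injectively into the box of side \<open>R\<close>, and nonnegativity of
  \<open>W\<close> allows the sum over the image to be enlarged to the whole box. The factor is the
  ratio of the two normalisations.\<close>

lemma iavg_dilate_le:
  assumes W: "\<And>hs. 0 \<le> W hs" and cs: "length cs = d" "\<And>c. c \<in> set cs \<Longrightarrow> 1 \<le> c \<and> c * H \<le> R" and H: "1 \<le> H" and R: "1 \<le> R"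
  shows "iavg (replicate d H) (\<lambda>hs. W (map2 (*) cs hs))
    \<le> (real R / real H) ^ d * ((\<Sum>h\<in>index_box d R. W (index_list d h)) / real R ^ d)"
proof -
  define \<delta> where "\<delta> h = restrict (\<lambda>j. cs ! (j - 1) * h j) {1..d}" for h :: "nat \<Rightarrow> nat"
  have csj: "cs ! (j - 1) \<in> set cs" if "j \<in> {1..d}" for j using that cs(1) by (intro nth_mem) auto
  have \<delta>: "map2 (*) cs (index_list d h) = index_list d (\<delta> h)" for h
    by (rule nth_equalityI) (auto simp: cs(1) \<delta>_def simp del: upt_Suc)
  have inj: "inj_on \<delta> (index_box d H)"
  proof (rule inj_onI)
    fix h h' assume hh: "h \<in> index_box d H" "h' \<in> index_box d H" "\<delta> h = \<delta> h'"
    show "h = h'"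
    proof (rule PiE_ext)
      fix j assume j: "j \<in> {1..d}"
      have "cs ! (j - 1) * h j = cs ! (j - 1) * h' j" using fun_cong[OF hh(3), of j] j by (simp add: \<delta>_def)
      moreover have "cs ! (j - 1) \<noteq> 0" using cs(2)[OF csj[OF j]] by auto
      ultimately show "h j = h' j" by simp
    next
      show "h \<in> Pi\<^sub>E {1..d} (\<lambda>_. {1..H})" "h' \<in> Pi\<^sub>E {1..d} (\<lambda>_. {1..H})"
        using hh(1,2) by (simp_all add: index_box_def)
    qed
  qed
  have sub: "\<delta> ` index_box d H \<subseteq> index_box d R"
  proof safe
    fix h assume h: "h \<in> index_box d H"
    show "\<delta> h \<in> index_box d R" unfolding index_box_def \<delta>_def
    proof (rule restrict_PiE_iff[THEN iffD2], rule ballI)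
      fix j assume j: "j \<in> {1..d}"
      have hj: "1 \<le> h j" "h j \<le> H" using PiE_mem[OF h[unfolded index_box_def] j] by auto
      have c: "1 \<le> cs ! (j - 1)" "cs ! (j - 1) * H \<le> R" using cs(2)[OF csj[OF j]] by auto
      have "1 * 1 \<le> cs ! (j - 1) * h j" using c hj by (intro mult_mono) auto
      moreover have "cs ! (j - 1) * h j \<le> R"
        by (rule order_trans[OF mult_le_mono2[OF hj(2)] c(2)])
      ultimately show "cs ! (j - 1) * h j \<in> {1..R}" by simp
    qed
  qed
  have fin: "finite (index_box d R)" unfolding index_box_def by (intro finite_PiE) auto
  have "iavg (replicate d H) (\<lambda>hs. W (map2 (*) cs hs)) = (\<Sum>h\<in>index_box d H. W (index_list d (\<delta> h))) / real H ^ d"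
    unfolding iavg_replicate \<delta> ..
  also have "(\<Sum>h\<in>index_box d H. W (index_list d (\<delta> h))) = (\<Sum>h\<in>\<delta> ` index_box d H. W (index_list d h))"
    using inj by (simp add: sum.reindex)
  also have "\<dots> / real H ^ d \<le> (\<Sum>h\<in>index_box d R. W (index_list d h)) / real H ^ d"
    by (intro divide_right_mono sum_mono2 fin sub W) simp
  also have "\<dots> = (real R / real H) ^ d * ((\<Sum>h\<in>index_box d R. W (index_list d h)) / real R ^ d)"
    using R by (simp add: power_divide)
  finally show ?thesis .
qed

text \<open>The cube splits into the faces with last coordinate 0 and 1; on the second face every
  factor is shifted by \<open>h (Suc d)\<close> and conjugated once more.\<close>

lemma cube_prod_Suc: "cube_prod T (Suc d) f h = mdiff T (h (Suc d)) (cube_prod T d f h)"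
proof (rule ext)
  fix x
  define g where "g \<eta> y = (cnj ^^ (\<Sum>j=1..d. \<eta> j)) (f ((T ^^ (\<Sum>j=1..d. h j * \<eta> j)) y))" for \<eta> y
  define G where "G \<eta> = (cnj ^^ (\<Sum>j=1..Suc d. \<eta> j)) (f ((T ^^ (\<Sum>j=1..Suc d. h j * \<eta> j)) x))" for \<eta>
  have G_upd: "G (\<eta>(Suc d := b))
      = (cnj ^^ ((\<Sum>j=1..d. \<eta> j) + b)) (f ((T ^^ ((\<Sum>j=1..d. h j * \<eta> j) + h (Suc d) * b)) x))" for \<eta> b
  proof -
    have "(\<Sum>j=1..Suc d. (\<eta>(Suc d := b)) j) = (\<Sum>j=1..d. \<eta> j) + b"
      unfolding sum.cl_ivl_Suc by (auto intro!: sum.cong)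
    moreover have "(\<Sum>j=1..Suc d. h j * (\<eta>(Suc d := b)) j) = (\<Sum>j=1..d. h j * \<eta> j) + h (Suc d) * b"
      unfolding sum.cl_ivl_Suc by (auto intro!: sum.cong)
    ultimately show ?thesis unfolding G_def by (simp only:)
  qed
  have "{1..Suc d} = insert (Suc d) {1..d}" by auto
  then have "cube (Suc d) = (\<lambda>(b, \<eta>). \<eta>(Suc d := b)) ` ({0, 1} \<times> cube d)"
    unfolding cube_def by (simp only: PiE_insert_eq)
  then have "(\<Prod>\<eta>\<in>cube (Suc d). G \<eta>) = (\<Prod>(b, \<eta>)\<in>{0, 1} \<times> cube d. G (\<eta>(Suc d := b)))"
    using inj_combinator[of "Suc d" "{1..d}" "\<lambda>_. {0, 1::nat}"]
    by (simp add: prod.reindex cube_def comp_def case_prod_unfold)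
  also have "\<dots> = (\<Prod>b\<in>{0, 1}. \<Prod>\<eta>\<in>cube d. G (\<eta>(Suc d := b)))"
    by (rule prod.cartesian_product[symmetric])
  also have "\<dots> = (\<Prod>\<eta>\<in>cube d. G (\<eta>(Suc d := 0))) * (\<Prod>\<eta>\<in>cube d. G (\<eta>(Suc d := 1)))" by simp
  also have "(\<Prod>\<eta>\<in>cube d. G (\<eta>(Suc d := 0))) = (\<Prod>\<eta>\<in>cube d. g \<eta> x)"
    by (simp add: G_upd g_def)
  also have "(\<Prod>\<eta>\<in>cube d. G (\<eta>(Suc d := 1))) = (\<Prod>\<eta>\<in>cube d. cnj (g \<eta> ((T ^^ h (Suc d)) x)))"
    by (simp add: G_upd funpow_add g_def)
  finally show "cube_prod T (Suc d) f h x = mdiff T (h (Suc d)) (cube_prod T d f h) x"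
    unfolding cube_prod_def mdiff_def G_def g_def by (simp add: cnj_prod)
qed

lemma cube_prod_eq_mdiffs: "cube_prod T d f h = mdiffs T (index_list d h) f"
proof (induction d)
  case 0
  show ?case by (simp add: cube_prod_def cube_def)
next
  case (Suc d)
  have "index_list (Suc d) h = index_list d h @ [h (Suc d)]" by simp
  then show ?case unfolding cube_prod_Suc Suc.IH by (simp only: mdiffs_append mdiffs.simps)
qed

subsection \<open>Wiener-Wintner functions bounded by one\<close>

text \<open>The tangent at 1 of a convex power. The point \<open>y = 0\<close> is separate because
  the tangent argument runs on the open half-line.\<close>

lemma powr_Bernoulli:
  assumes "0 \<le> y" "1 \<le> q"
  shows "1 + q * (y - 1) \<le> y powr (q::real)"
proof (cases "y = 0")
  case True
  then show ?thesis using assms by simp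
next
  case False
  have "((\<lambda>x. x powr q) has_real_derivative q) (at 1)"
    using DERIV_fun_powr[of "\<lambda>x. x" 1 1 q] by (auto intro!: derivative_eq_intros)
  then have "((\<lambda>x. x powr q) has_real_derivative q) (at 1 within {0<..})"
    by (rule DERIV_subset) simp
  then have "y powr q - 1 powr q \<ge> q * (y - 1)"
    using assms False
    by (intro convex_on_imp_above_tangent[OF powr_convex]) (auto simp: interior_open)
  then show ?thesis by simp
qed

text \<open>For finite \<open>p\<close>, Bernoulli's inequality at u/c, with c the mean of u,
  integrates to c^q <= integral of u^q, because the linear term has mean zero. The bound
  \<open>B\<close> makes the norm finite, hence its real value meaningful.\<close>

lemma (in prob_space) integral_le_Lp_norm:
  assumes u [measurable]: "u \<in> borel_measurable M" and u0: "\<And>x. 0 \<le> u x" and B: "AE x in M. u x \<le> B" and p: "1 \<le> p"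
  shows "(\<integral>x. u x \<partial>M) \<le> Lp_norm p M u"
proof (cases "p = \<infinity>")
  case True
  define e where "e = esssup M (\<lambda>x. ereal \<bar>u x\<bar>)"
  have AEe: "AE x in M. ereal \<bar>u x\<bar> \<le> e" unfolding e_def by (rule esssup_AE)
  \<comment> \<open>Both bounds together exclude the infinite values, which
    \<open>real_of_ereal\<close> would send to 0.\<close>
  have "e \<le> ereal B" unfolding e_def using B u0 by (intro esssup_I) auto
  moreover have "0 \<le> e"
  proof -
    have "AE x in M. 0 \<le> e" using AEe by eventually_elim (metis abs_ge_zero ereal_less_eq(5) order_trans)
    then show ?thesis by simp
  qed
  ultimately obtain r where r: "e = ereal r" by (cases e) auto
  have "AE x in M. u x \<le> r" using AEe by eventually_elim (use u0 in \<open>auto simp: r\<close>)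
  moreover have "integrable M u" using B u0 by (intro integrable_const_bound[of _ B]) auto
  ultimately have "(\<integral>x. u x \<partial>M) \<le> (\<integral>x. r \<partial>M)" by (intro integral_mono_AE) auto
  then show ?thesis using True by (simp add: Lp_norm_def e_def[symmetric] r prob_space)
next
  case False
  define q where "q = enn2real p"
  have "p < top" using False by (simp add: less_top)
  then have q: "1 \<le> q" using enn2real_mono[OF p] by (simp add: q_def)
  define c where "c = (\<integral>x. u x \<partial>M)"
  have c0: "0 \<le> c" unfolding c_def by (simp add: u0)
  have ui: "integrable M u" using B u0 by (intro integrable_const_bound[of _ B]) auto
  have "c powr q \<le> (\<integral>x. u x powr q \<partial>M)"
  proof (cases "c = 0")
    case True
    then show ?thesis using q by simp
  next
    case False
    then have c: "c > 0" using c0 by simp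
    have ui': "integrable M (\<lambda>x. u x powr q)"
      using B by (intro integrable_const_bound[of _ "\<bar>B\<bar> powr q"]) (auto elim!: eventually_mono intro!: powr_mono2 simp: u0 q order_trans[OF zero_le_one])
    have "(\<integral>x. c powr q * (1 + q * (u x / c - 1)) \<partial>M) \<le> (\<integral>x. u x powr q \<partial>M)"
    proof (rule integral_mono[OF _ ui'])
      fix x
      have "c powr q * (1 + q * (u x / c - 1)) \<le> c powr q * (u x / c) powr q"
        using c u0 q by (intro mult_left_mono powr_Bernoulli) auto
      also have "\<dots> = u x powr q" using c u0 by (simp flip: powr_mult)
      finally show "c powr q * (1 + q * (u x / c - 1)) \<le> u x powr q" .
    qed (use ui in auto)
    moreover have "(\<integral>x. c powr q * (1 + q * (u x / c - 1)) \<partial>M) = c powr q * (1 + q * (c / c - 1))"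
      using ui by (simp add: prob_space c_def[symmetric])
    ultimately show ?thesis using c by simp
  qed
  then have "(c powr q) powr (1 / q) \<le> (\<integral>x. u x powr q \<partial>M) powr (1 / q)"
    using q by (intro powr_mono2) auto
  then show ?thesis using False q c0 u0 by (simp add: Lp_norm_def q_def[symmetric] c_def[symmetric] powr_powr)
qed

text \<open>If \<open>B\<close> is an essential bound for \<open>F\<close>, the cut-off affects a
  null set only, so this is a version of F/B that is bounded by one everywhere.\<close>

definition clip :: "real \<Rightarrow> ('a \<Rightarrow> complex) \<Rightarrow> 'a \<Rightarrow> complex" where
  "clip B F x = (if cmod (F x) \<le> B then F x / of_real B else 0)"

lemma unit_bounded_clip:
  assumes "B > 0" and [measurable]: "F \<in> borel_measurable M"
  shows "unit_bounded M (clip B F)"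
proof -
  have "clip B F \<in> borel_measurable M" unfolding clip_def by measurable
  moreover have "cmod (clip B F x) \<le> 1" for x using assms(1) by (simp add: clip_def norm_divide)
  ultimately show ?thesis by (simp add: unit_bounded_def)
qed

lemma clip_eq: "B > 0 \<Longrightarrow> cmod (F x) \<le> B \<Longrightarrow> F x = of_real B * clip B F x"
  by (simp add: clip_def)

text \<open>The Wiener-Wintner bound of order \<open>d + 1\<close> at N = R^2, where the side
  floor(sqrt N) of the box is exactly R, with the L^1 norm and exponent one.\<close>

definition ww_average_bound :: "'a measure \<Rightarrow> ('a \<Rightarrow> 'a) \<Rightarrow> nat \<Rightarrow> real \<Rightarrow> real \<Rightarrow> ('a \<Rightarrow> complex) \<Rightarrow> bool" where
  "ww_average_bound M T d \<alpha> C F \<longleftrightarrow> (\<forall>R\<ge>1.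
     (\<Sum>h\<in>index_box d R. \<integral>x. ww_sup T (R ^ 2) (mdiffs T (index_list d h) F) x \<partial>M) / real R ^ d
       \<le> C / real (R ^ 2) powr \<alpha>)"

context mp_system
begin

lemma AE_orbit_clip:
  assumes "B > 0" "AE x in M. cmod (F x) \<le> B"
  shows "AE x in M. \<forall>n. F ((T ^^ n) x) = of_real B * clip B F ((T ^^ n) x)"
proof -
  have "AE x in M. F ((T ^^ n) x) = of_real B * clip B F ((T ^^ n) x)" for n
    using AE_iterate[OF assms(2), of n] by eventually_elim (rule clip_eq[OF assms(1)])
  then show ?thesis by (simp add: AE_all_countable)
qed

text \<open>Each difference squares the factor, which conjugation leaves alone because
  \<open>b\<close> is real. The hypothesis covers the whole orbit of \<open>x\<close> since
  differences look ahead.\<close>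

lemma mdiffs_scale:
  fixes F G :: "'a \<Rightarrow> complex"
  assumes "\<And>n. F ((T ^^ n) x) = of_real b * G ((T ^^ n) x)"
  shows "mdiffs T hs F ((T ^^ n) x) = of_real (b ^ 2 ^ length hs) * mdiffs T hs G ((T ^^ n) x)"
  using assms
proof (induction hs arbitrary: F G b n)
  case (Cons h hs)
  have "mdiff T h F ((T ^^ n) x) = of_real (b ^ 2) * mdiff T h G ((T ^^ n) x)" for n
    unfolding mdiff_def funpow_add[THEN fun_cong, unfolded comp_apply, symmetric] Cons.prems
    by (simp add: power2_eq_square)
  then have "mdiffs T hs (mdiff T h F) ((T ^^ n) x)
      = of_real ((b ^ 2) ^ 2 ^ length hs) * mdiffs T hs (mdiff T h G) ((T ^^ n) x)"
    by (rule Cons.IH)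
  then show ?case by (simp add: power_mult)
qed simp

text \<open>The clipped supremum has integral W <= 1, so W <= W^(2/3), which accounts for the
  exponent 2/3. Restoring the factor, a power of \<open>B\<close> and so at least 1, only increases
  W, and the L^1 norm is bounded by the L^p norm.\<close>

lemma ww_average_bound_clip:
  assumes ww: "WW_function M T (Suc d) \<alpha> p g" and B: "1 \<le> B" "AE x in M. cmod (g x) \<le> B" and p: "1 \<le> p"
  shows "\<exists>C>0. ww_average_bound M T d \<alpha> C (clip B g)"
proof -
  obtain C where C: "C > 0" and bound: "\<And>N. 1 \<le> N \<Longrightarrow>
      (1 / real (nat \<lfloor>sqrt (real N)\<rfloor> ^ d)) * (\<Sum>h\<in>index_box d (nat \<lfloor>sqrt (real N)\<rfloor>).
           Lp_norm p M (\<lambda>x. ww_sup T N (cube_prod T d g h) x) powr (2/3)) \<le> C / real N powr \<alpha>"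
    using ww unfolding WW_function_def ww_sup_def by auto
  have [measurable]: "g \<in> borel_measurable M" using ww by (simp add: WW_function_def Linf_def)
  have B0: "B > 0" using B by simp
  have ub: "unit_bounded M (mdiffs T hs (clip B g))" for hs
    using B0 by (intro unit_bounded_mdiffs unit_bounded_clip) auto
  have meas: "mdiffs T hs F \<in> borel_measurable M" if "F \<in> borel_measurable M" for hs and F :: "'a \<Rightarrow> complex"
    using that
  proof (induction hs arbitrary: F)
    case (Cons h hs)
    have [measurable]: "F \<in> borel_measurable M" by (rule Cons.prems)
    have "mdiff T h F \<in> borel_measurable M" unfolding mdiff_def[abs_def] by measurable
    then show ?case using Cons.IH by simp
  qed simp
  have le: "(\<integral>x. ww_sup T N (mdiffs T hs (clip B g)) x \<partial>M) \<le> Lp_norm p M (ww_sup T N (mdiffs T hs g)) powr (2/3)" for N hs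
  proof -
    define W where "W = (\<integral>x. ww_sup T N (mdiffs T hs (clip B g)) x \<partial>M)"
    define b where "b = B ^ 2 ^ length hs"
    have b: "1 \<le> b" using B by (simp add: b_def)
    have AEeq: "AE x in M. ww_sup T N (mdiffs T hs g) x = b * ww_sup T N (mdiffs T hs (clip B g)) x"
      using AE_orbit_clip[OF B0 B(2)]
    proof eventually_elim
      case (elim x)
      have "ww_sup T N (mdiffs T hs g) x = cmod (of_real b) * ww_sup T N (mdiffs T hs (clip B g)) x"
        unfolding b_def by (rule ww_sup_cong, rule mdiffs_scale) (use elim in blast)
      then show ?case using b by simp
    qed
    have W1: "W \<le> 1" unfolding W_def
    proof (rule integral_le_const)
      show "AE x in M. ww_sup T N (mdiffs T hs (clip B g)) x \<le> 1"
        using ub by (intro AE_I2 ww_sup_le) auto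
    qed (rule integrable_ww_sup[OF ub])
    have W0: "0 \<le> W" unfolding W_def by (simp add: ww_sup_nonneg)
    have [measurable]: "ww_sup T N (mdiffs T hs g) \<in> borel_measurable M" "ww_sup T N (mdiffs T hs (clip B g)) \<in> borel_measurable M"
      by (intro measurable_ww_sup meas, measurable) (intro measurable_ww_sup unit_boundedD(1) ub)
    have "W \<le> b * W" using b W0 by (simp add: mult_le_cancel_right1)
    also have "b * W = (\<integral>x. b * ww_sup T N (mdiffs T hs (clip B g)) x \<partial>M)" unfolding W_def by simp
    also have "\<dots> = (\<integral>x. ww_sup T N (mdiffs T hs g) x \<partial>M)"
      by (rule integral_cong_AE) (use AEeq in \<open>auto elim: eventually_mono\<close>)
    also have "\<dots> \<le> Lp_norm p M (ww_sup T N (mdiffs T hs g))"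
    proof (rule integral_le_Lp_norm[OF _ ww_sup_nonneg _ p])
      show "AE x in M. ww_sup T N (mdiffs T hs g) x \<le> b * 1"
        using AEeq
      proof eventually_elim
        case (elim x)
        have "ww_sup T N (mdiffs T hs (clip B g)) x \<le> 1" using ub by (intro ww_sup_le) auto
        then show ?case unfolding elim using b by (intro mult_left_mono) auto
      qed
    qed measurable
    finally have L: "W \<le> Lp_norm p M (ww_sup T N (mdiffs T hs g))" .
    have "W \<le> W powr (2/3)"
    proof (cases "W = 0")
      case False
      then have "W powr 1 \<le> W powr (2/3)" using W0 W1 by (intro powr_mono') auto
      then show ?thesis using W0 by simp
    qed simp
    also have "\<dots> \<le> Lp_norm p M (ww_sup T N (mdiffs T hs g)) powr (2/3)"
      using L W0 by (intro powr_mono2) auto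
    finally show ?thesis unfolding W_def .
  qed
  have "ww_average_bound M T d \<alpha> C (clip B g)"
    unfolding ww_average_bound_def
  proof (intro allI impI)
    fix R :: nat assume R: "1 \<le> R"
    have sq: "nat \<lfloor>sqrt (real (R ^ 2))\<rfloor> = R" by simp
    have "(\<Sum>h\<in>index_box d R. \<integral>x. ww_sup T (R ^ 2) (mdiffs T (index_list d h) (clip B g)) x \<partial>M) / real R ^ d
      \<le> (\<Sum>h\<in>index_box d R. Lp_norm p M (ww_sup T (R ^ 2) (mdiffs T (index_list d h) g)) powr (2/3)) / real R ^ d"
      by (intro divide_right_mono sum_mono le) simp
    also have "\<dots> \<le> C / real (R ^ 2) powr \<alpha>"
      using bound[of "R ^ 2"] R unfolding sq cube_prod_eq_mdiffs by simp
    finally show "(\<Sum>h\<in>index_box d R. \<integral>x. ww_sup T (R ^ 2) (mdiffs T (index_list d h) (clip B g)) x \<partial>M) / real R ^ d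
      \<le> C / real (R ^ 2) powr \<alpha>" .
  qed
  then show ?thesis using C by blast
qed

subsection \<open>Choice of the scales\<close>

text \<open>The last shift has its own scale \<open>H'\<close> and is removed by the exponential-sum
  bound; the other \<open>d\<close> shifts, of scale \<open>H\<close>, are dilated into the
  Wiener-Wintner box. They shorten the interval by at most \<open>d * H\<close>, which gives the
  last summand.\<close>

lemma iavg_last_scale_le:
  assumes F: "unit_bounded M F" and cs: "length cs = d" "\<And>c. c \<in> set cs \<Longrightarrow> 1 \<le> c \<and> c * H \<le> R" and c: "1 \<le> c"
    and H: "1 \<le> H" "1 \<le> H'" "H' \<le> N" and R: "1 \<le> R" "N = R ^ 2"
    and ww: "ww_average_bound M T d \<alpha> C F"
  shows "iavg (replicate d H @ [H']) (\<lambda>hs. \<integral>x. cmod ((\<Sum>n=1..N - sum_list hs.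
        mdiffs T (map2 (*) (cs @ [c]) hs) F ((T ^^ n) x)) / of_nat N) \<partial>M)
    \<le> real H' / real N + (1 + real c) * (real N / real H') * ((real R / real H) ^ d * (C / real N powr \<alpha>) + real (d * H) / real N)"
proof -
  define W where "W hs = (\<integral>x. ww_sup T N (mdiffs T hs F) x \<partial>M)" for hs
  have W0: "0 \<le> W hs" for hs unfolding W_def by (simp add: ww_sup_nonneg)
  have "iavg (replicate d H @ [H']) (\<lambda>hs. \<integral>x. cmod ((\<Sum>n=1..N - sum_list hs.
        mdiffs T (map2 (*) (cs @ [c]) hs) F ((T ^^ n) x)) / of_nat N) \<partial>M)
    = iavg (replicate d H) (\<lambda>hs. avg H' (\<lambda>h. \<integral>x. cmod ((\<Sum>n=1..N - sum_list (hs @ [h]).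
        mdiffs T (map2 (*) (cs @ [c]) (hs @ [h])) F ((T ^^ n) x)) / of_nat N) \<partial>M))"
    by (simp add: iavg_append)
  also have "\<dots> \<le> iavg (replicate d H) (\<lambda>hs. real H' / real N
      + (1 + real c) * (real N / real H') * (W (map2 (*) cs hs) + real (d * H) / real N))"
  proof (rule iavg_mono)
    fix hs assume hs: "below hs (replicate d H)"
    have len: "length hs = d" using list_all2_lengthD[OF hs] by simp
    have "\<forall>h\<in>set hs. h \<le> H"
      using hs len by (auto simp: list_all2_conv_all_nth in_set_conv_nth)
    then have "sum_list hs \<le> length hs * H" by (induction hs) auto
    then have sl: "sum_list hs \<le> d * H" by (simp add: len)
    have eq: "mdiffs T (map2 (*) (cs @ [c]) (hs @ [h])) F = mdiff T (c * h) (mdiffs T (map2 (*) cs hs) F)" for h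
      using len cs(1) by (simp add: mdiffs_append)
    have "avg H' (\<lambda>h. \<integral>x. cmod ((\<Sum>n=1..N - sum_list hs - h. mdiff T (c * h) (mdiffs T (map2 (*) cs hs) F) ((T ^^ n) x)) / of_nat N) \<partial>M)
      \<le> real H' / real N + (1 + real c) * (real N / real H') * (W (map2 (*) cs hs) + real (N - (N - sum_list hs)) / real N)"
      unfolding W_def using c H by (intro avg_integral_mdiff_le unit_bounded_mdiffs F) auto
    also have "\<dots> \<le> real H' / real N + (1 + real c) * (real N / real H') * (W (map2 (*) cs hs) + real (d * H) / real N)"
      by (intro add_left_mono mult_left_mono divide_right_mono of_nat_mono) (use sl in auto)
    finally show "avg H' (\<lambda>h. \<integral>x. cmod ((\<Sum>n=1..N - sum_list (hs @ [h]).
        mdiffs T (map2 (*) (cs @ [c]) (hs @ [h])) F ((T ^^ n) x)) / of_nat N) \<partial>M)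
      \<le> real H' / real N + (1 + real c) * (real N / real H') * (W (map2 (*) cs hs) + real (d * H) / real N)"
      unfolding eq by (simp add: diff_diff_left)
  qed
  also have "\<dots> = real H' / real N + (1 + real c) * (real N / real H')
      * (iavg (replicate d H) (\<lambda>hs. W (map2 (*) cs hs)) + real (d * H) / real N)"
  proof -
    have sc: "scales H (replicate d H)" using H(1) by (simp add: scales_def)
    show ?thesis by (simp only: iavg_add iavg_cmult iavg_const[OF sc])
  qed
  also have "\<dots> \<le> real H' / real N + (1 + real c) * (real N / real H')
      * ((real R / real H) ^ d * (C / real N powr \<alpha>) + real (d * H) / real N)"
  proof (intro add_left_mono mult_left_mono add_right_mono)
    have "iavg (replicate d H) (\<lambda>hs. W (map2 (*) cs hs))
      \<le> (real R / real H) ^ d * ((\<Sum>h\<in>index_box d R. W (index_list d h)) / real R ^ d)"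
      by (intro iavg_dilate_le W0 cs H(1) R(1)) auto
    also have "\<dots> \<le> (real R / real H) ^ d * (C / real N powr \<alpha>)"
      using ww R unfolding ww_average_bound_def W_def by (intro mult_left_mono) auto
    finally show "iavg (replicate d H) (\<lambda>hs. W (map2 (*) cs hs)) \<le> (real R / real H) ^ d * (C / real N powr \<alpha>)" .
  qed auto
  finally show ?thesis .
qed

end

lemma recip_sum_replicate: "recip_sum (replicate d H) = real d / real H"
  by (induction d) (auto simp: add_divide_distrib)

lemma (in mp_system) weight_norm_rate:
  assumes f: "\<And>j. unit_bounded M (f j)" and s: "1 \<le> s" "s \<le> Suc m" and d: "d + 1 = K + m"
    and ww: "ww_average_bound M T d \<alpha> C (f s)" and C: "0 < C" and \<alpha>: "0 < \<alpha>"
  shows "\<exists>r C'. 1 \<le> C' \<and> (\<forall>l\<ge>Suc m. \<exists>Hs. length Hs = K \<and> scales (l ^ (2 * r + 2)) Hs \<and> recip_sum Hs \<le> C' / real l \<and>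
     (\<integral>x. weight_norm (l ^ (2 * r + 2)) Hs (orbit_weights T (l ^ (2 * r + 2)) (Suc m) f x) \<partial>M) ^ (2 ^ m) \<le> C' / real l)"
proof -
  \<comment> \<open>This choice yields \<open>L ^ (d + 2) \<le> real N powr \<alpha>\<close> in
    \<open>e5\<close>; the successor ensures that \<open>H\<close> is at least
    \<open>l\<close>.\<close>
  obtain r0 :: nat where r0: "real (d + 2) / \<alpha> \<le> real r0" using real_arch_simple by blast
  define r where "r = Suc r0"
  have r: "r \<ge> 1" by (simp add: r_def)
  have "real (d + 2) \<le> real r0 * \<alpha>" using r0 \<alpha> by (simp add: field_simps)
  also have "\<dots> \<le> real (2 * r + 2) * \<alpha>" using \<alpha> by (intro mult_right_mono) (auto simp: r_def)
  finally have r\<alpha>: "real (d + 2) \<le> real (2 * r + 2) * \<alpha>" .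
  \<comment> \<open>The summand \<open>d + 1\<close> bounds the reciprocals of all scales, the rest
    is the bound \<open>leaf'\<close> for the remaining average.\<close>
  define C' where "C' = 8 ^ (2 ^ m) * (real (d + 1) + (1 + (2 + real m) * (C + real d)))"
  have pos: "0 \<le> (2 + real m) * (C + real d)" using C by simp
  have C'1: "real (d + 1) \<le> C'"
  proof -
    have "1 * real (d + 1) \<le> 8 ^ (2 ^ m) * (real (d + 1) + (1 + (2 + real m) * (C + real d)))"
      using pos by (intro mult_mono) auto
    then show ?thesis by (simp add: C'_def)
  qed
  show ?thesis
  proof (rule exI[of _ r], rule exI[of _ C'], intro conjI allI impI)
    show "1 \<le> C'" using C'1 by simp
    \<comment> \<open>The lower bound on \<open>l\<close> makes every slope, being at most
      \<open>Suc m\<close>, fit into the factor \<open>l\<close> between \<open>H\<close> and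
      \<open>R\<close>.\<close>
    fix l assume l: "Suc m \<le> l"
    define L where "L = real l"
    have L1: "1 \<le> L" using l by (simp add: L_def)
    define N where "N = l ^ (2 * r + 2)"
    define H where "H = l ^ r"
    define H' where "H' = l ^ (2 * r + 1)"
    define R where "R = l ^ (r + 1)"
    have l1: "1 \<le> l" using l by simp
    have H1: "1 \<le> H" and H'1: "1 \<le> H'" and R1: "1 \<le> R" using l1 by (simp_all add: H_def H'_def R_def)
    have "(r + 1) * 2 = 2 * r + 2" by simp
    then have NR: "N = R ^ 2" unfolding N_def R_def power_mult[symmetric] by (simp only:)
    have HN: "H \<le> N" unfolding H_def N_def using l1 by (intro power_increasing) auto
    have H'N: "H' \<le> N" unfolding H'_def N_def using l1 by (intro power_increasing) auto
    \<comment> \<open>One list for both chains: the first \<open>K\<close> scales serve the other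
      system, the last \<open>m\<close> the eliminations on \<open>M\<close>. The large scale
      \<open>H'\<close> stands last because the last difference is the one removed by Parseval; for
      \<open>m = 0\<close> it belongs to the first group.\<close>
    define Hs where "Hs = replicate d H @ [H']"
    have lenHs: "length Hs = K + m" using d by (simp add: Hs_def)
    have sc: "scales N Hs" using H1 H'1 HN H'N by (auto simp: Hs_def scales_def)
    have tdsc: "scales N (take K Hs @ drop K Hs)" using sc by simp
    have sct: "scales N (take K Hs)" using sc by (auto simp: scales_def dest: in_set_takeD)
    have rH: "1 / real H \<le> 1 / L" and rH': "1 / real H' \<le> 1 / L"
      using L1 r self_le_power[of L r] self_le_power[of L "2 * r + 1"]
      by (auto simp: H_def H'_def L_def[symmetric] intro!: divide_left_mono)
    have "recip_sum Hs = real d * (1 / real H) + 1 / real H'" by (simp add: Hs_def recip_sum_replicate)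
    also have "\<dots> \<le> real d * (1 / L) + 1 / L" using rH rH' by (intro add_mono mult_left_mono) auto
    finally have rec: "recip_sum Hs \<le> real (d + 1) / L" by (simp add: add_divide_distrib)
    have split: "recip_sum Hs = recip_sum (take K Hs) + recip_sum (drop K Hs)"
      by (metis append_take_drop_id recip_sum_simps(3))
    have rt: "recip_sum (take K Hs) \<le> real (d + 1) / L" and rd: "recip_sum (drop K Hs) \<le> real (d + 1) / L"
      using rec split recip_sum_nonneg[of "take K Hs"] recip_sum_nonneg[of "drop K Hs"] by linarith+
    define cs where "cs = replicate K s @ slopes m s"
    have lencs: "length cs = d + 1" using d by (simp add: cs_def)
    have csb: "1 \<le> c \<and> c \<le> Suc m" if "c \<in> set cs" for c
      using that s slopes_bounds[OF s, of c] by (auto simp: cs_def)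
    have csne: "cs \<noteq> []" using lencs by auto
    define c where "c = last cs"
    have cs: "cs = butlast cs @ [c]" using csne by (simp add: c_def)
    have c: "1 \<le> c" "c \<le> Suc m" using csb[of c] csne by (auto simp: c_def)
    have lb: "length (butlast cs) = d" using lencs by simp
    have leaf: "iavg Hs (\<lambda>hs. \<integral>x. cmod ((\<Sum>n=1..N - sum_list hs.
        mdiffs T (map2 (*) cs hs) (f s) ((T ^^ n) x)) / of_nat N) \<partial>M)
        \<le> real H' / real N + (1 + real c) * (real N / real H') * ((real R / real H) ^ d * (C / real N powr \<alpha>) + real (d * H) / real N)"
      unfolding Hs_def
    proof (subst cs, rule iavg_last_scale_le[OF f lb _ c(1) H1 H'1 H'N R1 NR ww])
      fix b assume "b \<in> set (butlast cs)"
      then have b: "1 \<le> b" "b \<le> l" using csb[of b] l by (auto dest: in_set_butlastD)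
      have "b * H \<le> l * H" using b by simp
      also have "\<dots> = R" by (simp add: R_def H_def)
      finally show "1 \<le> b \<and> b * H \<le> R" using b by simp
    qed
    have e1: "real H' / real N = 1 / L"
      using L1 by (simp add: H'_def N_def L_def[symmetric] field_simps)
    have e2: "real N / real H' = L"
      using L1 by (simp add: H'_def N_def L_def[symmetric] field_simps)
    have e3: "real R / real H = L"
      using L1 by (simp add: R_def H_def L_def[symmetric] field_simps)
    have e4: "real (d * H) / real N \<le> real d / L ^ 2"
    proof -
      have "L ^ r * L ^ 2 \<le> L ^ (2 * r + 2)" unfolding power_add[symmetric] using L1 by (intro power_increasing) auto
      then have "L ^ r / L ^ (2 * r + 2) \<le> 1 / L ^ 2" using L1 by (simp add: field_simps)
      then have "real d * (L ^ r / L ^ (2 * r + 2)) \<le> real d * (1 / L ^ 2)" by (rule mult_left_mono) simp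
      then show ?thesis by (simp add: H_def N_def L_def)
    qed
    have e5: "C / real N powr \<alpha> \<le> C / L ^ (d + 2)"
    proof -
      have "L ^ (d + 2) = L powr real (d + 2)" using L1 by (subst powr_realpow) auto
      also have "\<dots> \<le> L powr (real (2 * r + 2) * \<alpha>)" using L1 r\<alpha> by (intro powr_mono) auto
      also have "\<dots> = (L powr real (2 * r + 2)) powr \<alpha>" by (simp add: powr_powr)
      also have "L powr real (2 * r + 2) = real N"
        using L1 by (subst powr_realpow) (auto simp: N_def L_def)
      finally have "L ^ (d + 2) \<le> real N powr \<alpha>" .
      moreover have "0 < real N" using l1 by (simp add: N_def)
      ultimately show ?thesis using C L1 by (intro divide_left_mono) auto
    qed
    have "(real R / real H) ^ d * (C / real N powr \<alpha>) + real (d * H) / real N \<le> L ^ d * (C / L ^ (d + 2)) + real d / L ^ 2"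
      unfolding e3 using e4 e5 L1 by (intro add_mono mult_left_mono) auto
    also have "L ^ d * (C / L ^ (d + 2)) + real d / L ^ 2 = (C + real d) / L ^ 2"
      using L1 by (simp add: power_add add_divide_distrib power2_eq_square)
    finally have e6: "(real R / real H) ^ d * (C / real N powr \<alpha>) + real (d * H) / real N \<le> (C + real d) / L ^ 2" .
    have "real H' / real N + (1 + real c) * (real N / real H') * ((real R / real H) ^ d * (C / real N powr \<alpha>) + real (d * H) / real N)
      \<le> 1 / L + (2 + real m) * L * ((C + real d) / L ^ 2)"
      unfolding e1 e2 using e6 c L1 C by (intro add_left_mono mult_mono) auto
    also have "\<dots> = (1 + (2 + real m) * (C + real d)) / L"
      using L1 by (simp add: field_simps power2_eq_square)
    finally have leaf': "iavg Hs (\<lambda>hs. \<integral>x. cmod ((\<Sum>n=1..N - sum_list hs.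
        mdiffs T (map2 (*) cs hs) (f s) ((T ^^ n) x)) / of_nat N) \<partial>M) \<le> (1 + (2 + real m) * (C + real d)) / L"
      using leaf by linarith
    have "(\<integral>x. weight_norm N (take K Hs) (orbit_weights T N (Suc m) f x) \<partial>M) ^ (2 ^ m)
      \<le> 8 ^ (2 ^ m) * (recip_sum (drop K Hs) + iavg Hs (\<lambda>hs. \<integral>x. cmod ((\<Sum>n=1..N - sum_list hs.
        mdiffs T (map2 (*) cs hs) (f s) ((T ^^ n) x)) / of_nat N) \<partial>M))"
      using integral_weight_norm_le[OF f tdsc, of s] s lenHs by (simp add: cs_def)
    also have "\<dots> \<le> 8 ^ (2 ^ m) * (real (d + 1) / L + (1 + (2 + real m) * (C + real d)) / L)"
      using rd leaf' by (intro mult_left_mono add_mono) auto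
    also have "\<dots> = C' / L"
      by (simp only: C'_def add_divide_distrib[symmetric] times_divide_eq_right)
    finally have I: "(\<integral>x. weight_norm N (take K Hs) (orbit_weights T N (Suc m) f x) \<partial>M) ^ (2 ^ m) \<le> C' / L" .
    have "recip_sum (take K Hs) \<le> C' / L"
      using rt divide_right_mono[OF C'1, of L] L1 by linarith
    then show "\<exists>Hs. length Hs = K \<and> scales (l ^ (2 * r + 2)) Hs \<and> recip_sum Hs \<le> C' / real l \<and>
     (\<integral>x. weight_norm (l ^ (2 * r + 2)) Hs (orbit_weights T (l ^ (2 * r + 2)) (Suc m) f x) \<partial>M) ^ (2 ^ m) \<le> C' / real l"
      using I sct lenHs by (intro exI[of _ "take K Hs"]) (auto simp: N_def L_def)
  qed
qed

subsection \<open>Almost everywhere convergence\<close>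

text \<open>The integrals are summable, so the sum of the \<open>u i\<close> is integrable and hence
  finite almost everywhere.\<close>

lemma AE_tendsto_zero:
  fixes u :: "nat \<Rightarrow> 'a \<Rightarrow> real"
  assumes int: "\<And>i. integrable M (u i)" and nonneg: "\<And>i x. 0 \<le> u i x"
    and le: "\<And>i. i \<ge> i0 \<Longrightarrow> (\<integral>x. u i x \<partial>M) \<le> C / real i ^ 2"
  shows "AE x in M. (\<lambda>i. u i x) \<longlonglongrightarrow> 0"
proof -
  have [measurable]: "u i \<in> borel_measurable M" for i using int by auto
  have "summable (\<lambda>i. C * (1 / real i ^ 2))"
    using inverse_power_summable[of 2] by (intro summable_mult) (simp add: inverse_eq_divide)
  then have sm: "summable (\<lambda>i. \<integral>x. u i x \<partial>M)"
    by (rule summable_comparison_test'[of _ i0]) (use le nonneg in simp)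
  have "(\<integral>\<^sup>+x. (\<Sum>i. ennreal (u i x)) \<partial>M) = (\<Sum>i. \<integral>\<^sup>+x. ennreal (u i x) \<partial>M)"
    by (rule nn_integral_suminf) measurable
  also have "\<dots> = (\<Sum>i. ennreal (\<integral>x. u i x \<partial>M))"
    using int nonneg by (simp add: nn_integral_eq_integral)
  also have "\<dots> \<noteq> \<infinity>"
    using sm nonneg by (subst suminf_ennreal2) auto
  finally have "AE x in M. (\<Sum>i. ennreal (u i x)) \<noteq> \<infinity>"
    by (intro nn_integral_noteq_infinite) auto
  then show ?thesis
  proof eventually_elim
    case (elim x)
    then have "summable (\<lambda>i. u i x)"
      by (intro summable_suminf_not_top nonneg) (auto simp: infinity_ennreal_def)
    then show ?case by (rule summable_LIMSEQ_zero)
  qed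
qed

lemma norm_prod_le_1:
  fixes z :: "'i \<Rightarrow> complex"
  assumes "\<And>k. k \<in> A \<Longrightarrow> cmod (z k) \<le> 1"
  shows "cmod (\<Prod>k\<in>A. z k) \<le> 1"
  using assms by (auto simp flip: prod_norm intro!: prod_le_1)

text \<open>If i^P <= N <= (i + 1)^P, the terms beyond i^P contribute at most N - i^P, which
  relative to i^P is at most (1 + 1/i)^P - 1 and tends to 0.\<close>

lemma averages_tendsto_zero_of_powers:
  fixes b :: "nat \<Rightarrow> complex"
  assumes b: "\<And>n. cmod (b n) \<le> 1" and P: "P \<ge> 1"
    and lim: "(\<lambda>i. (\<Sum>n=1..i ^ P. b n) / of_nat (i ^ P)) \<longlonglongrightarrow> 0"
  shows "(\<lambda>N. (\<Sum>n=1..N. b n) / of_nat N) \<longlonglongrightarrow> 0"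
proof -
  define A where "A N = (\<Sum>n=1..N. b n) / of_nat N" for N
  define g where "g N = nat \<lfloor>root P (real N)\<rfloor>" for N
  have g_le: "g N ^ P \<le> N" for N
  proof -
    have "real (g N) \<le> root P (real N)" unfolding g_def by (rule of_nat_floor) (rule real_root_ge_zero, simp)
    then have "real (g N) ^ P \<le> root P (real N) ^ P" by (rule power_mono) simp
    also have "\<dots> = real N" using P by (simp add: real_root_pow_pos2)
    finally show ?thesis by (metis of_nat_le_iff of_nat_power)
  qed
  have g_gt: "real N \<le> (real (g N) + 1) ^ P" for N
  proof -
    have "root P (real N) \<le> real (g N) + 1"       unfolding g_def
      using real_root_ge_zero[of "real N" P] real_of_int_floor_add_one_ge[of "root P (real N)"] by simp
    then have "root P (real N) ^ P \<le> (real (g N) + 1) ^ P"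
      by (rule power_mono) (rule real_root_ge_zero, simp)
    then show ?thesis using P by (simp add: real_root_pow_pos2)
  qed
  have g_lim: "filterlim g at_top sequentially"
    unfolding filterlim_at_top eventually_sequentially
  proof (intro allI exI impI)
    fix Z N :: nat assume "Z ^ P \<le> N"
    then have "real Z ^ P \<le> real N" by (metis of_nat_le_iff of_nat_power)
    then have "root P (real Z ^ P) \<le> root P (real N)" using P by simp
    then have "real Z \<le> root P (real N)" using P by (simp add: real_root_power_cancel)
    then show "Z \<le> g N" unfolding g_def by (simp add: le_nat_floor)
  qed
  have bound: "cmod (A N) \<le> cmod (A (g N ^ P)) + ((1 + 1 / real (g N)) ^ P - 1)" if g1: "1 \<le> g N" for N
  proof -
    define i where "i = g N"
    have i: "1 \<le> i" "i ^ P \<le> N" "real N \<le> (real i + 1) ^ P" using g1 g_le g_gt by (auto simp: i_def)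
    have iP: "1 \<le> i ^ P" using i by simp
    have N: "N > 0" using i iP by linarith
    have "{1..N} = {1..i ^ P} \<union> {Suc (i ^ P)..N}" using i by auto
    then have "(\<Sum>n=1..N. b n) = (\<Sum>n=1..i ^ P. b n) + (\<Sum>n\<in>{Suc (i ^ P)..N}. b n)"
      by (simp only:) (rule sum.union_disjoint, auto)
    then have "cmod (\<Sum>n=1..N. b n) \<le> cmod (\<Sum>n=1..i ^ P. b n) + cmod (\<Sum>n\<in>{Suc (i ^ P)..N}. b n)"
      by (simp only: norm_triangle_ineq)
    also have "cmod (\<Sum>n\<in>{Suc (i ^ P)..N}. b n) \<le> (\<Sum>n\<in>{Suc (i ^ P)..N}. 1)" by (intro sum_norm_le b)
    also have "\<dots> = real N - real (i ^ P)" using i by (simp add: of_nat_diff)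
    finally have 1: "cmod (\<Sum>n=1..N. b n) \<le> cmod (\<Sum>n=1..i ^ P. b n) + (real N - real (i ^ P))" by simp
    have "cmod (A N) = cmod (\<Sum>n=1..N. b n) / real N" by (simp add: A_def norm_divide)
    also have "\<dots> \<le> cmod (\<Sum>n=1..N. b n) / real (i ^ P)"
      using iP i(1,2) N by (intro divide_left_mono mult_pos_pos) auto
    also have "\<dots> \<le> (cmod (\<Sum>n=1..i ^ P. b n) + (real N - real (i ^ P))) / real (i ^ P)"
      by (intro divide_right_mono 1) simp
    also have "\<dots> = cmod (A (i ^ P)) + (real N / real (i ^ P) - 1)"
      using iP i(1) by (simp add: A_def norm_divide norm_power add_divide_distrib diff_divide_distrib)
    also have "real N / real (i ^ P) \<le> (real i + 1) ^ P / real i ^ P"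
      using i by (simp add: divide_right_mono)
    also have "\<dots> = (1 + 1 / real i) ^ P" using i by (simp add: power_divide[symmetric] add_divide_distrib)
    finally show ?thesis by (simp add: i_def)
  qed
  have "(\<lambda>i. cmod (A (i ^ P)) + ((1 + 1 / real i) ^ P - 1)) \<longlonglongrightarrow> 0 + ((1 + 0) ^ P - 1)"
    using tendsto_norm_zero[OF lim] by (intro tendsto_intros lim_1_over_n) (simp add: A_def)
  then have "(\<lambda>N. cmod (A (g N ^ P)) + ((1 + 1 / real (g N)) ^ P - 1)) \<longlonglongrightarrow> 0"
    using g_lim by (simp add: filterlim_compose[where g = "\<lambda>i. cmod (A (i ^ P)) + ((1 + 1 / real i) ^ P - 1)"])
  moreover have "\<forall>\<^sub>F N in sequentially. norm (A N) \<le> cmod (A (g N ^ P)) + ((1 + 1 / real (g N)) ^ P - 1)"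
    using filterlim_at_top[THEN iffD1, OF g_lim, rule_format, of 1]
    by eventually_elim (use bound in auto)
  ultimately have "A \<longlonglongrightarrow> 0" by (rule Lim_null_comparison[rotated])
  then show ?thesis by (simp add: A_def[abs_def])
qed

text \<open>Both error terms are of order 1 / i^(2 * 2^K); the root of order 2^K leaves 1 / i^2,
  which is summable along N = i^P.\<close>

lemma (in mp_system) AE_weighted_averages_tendsto_zero:
  fixes \<beta> :: "nat \<Rightarrow> complex"
  assumes \<beta>: "\<And>n. cmod (\<beta> n) \<le> 1" and g: "\<And>k. unit_bounded M (g k)" and P: "1 \<le> P" and C: "0 \<le> C"
    and Hs: "\<And>i. i \<ge> m \<Longrightarrow> length (Hs i) = K \<and> scales (i ^ P) (Hs i) \<and> recip_sum (Hs i) \<le> C / real i ^ (2 * 2 ^ K)"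
    and w: "(\<lambda>i. real i ^ (2 * 2 ^ K) * weight_norm (i ^ P) (Hs i) (\<lambda>n. initial (i ^ P) n * \<beta> n)) \<longlonglongrightarrow> 0"
  shows "AE y in M. (\<lambda>N. (\<Sum>n=1..N. \<beta> n * (\<Prod>k=1..K. g k ((T ^^ (k * n)) y))) / of_nat N) \<longlonglongrightarrow> 0"
proof -
  define E where "E = 2 * (2::nat) ^ K"
  define u where "u i y = cmod ((\<Sum>n=1..i ^ P. \<beta> n * (\<Prod>k=1..K. g k ((T ^^ (k * n)) y))) / of_nat (i ^ P))" for i y
  define v where "v i = weight_norm (i ^ P) (Hs i) (\<lambda>n. initial (i ^ P) n * \<beta> n)" for i
  \<comment> \<open>Convergence is turned into the bound
    \<open>v i \<le> B / real i ^ E\<close>.\<close>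
  have "convergent (\<lambda>i. real i ^ E * v i)" using w unfolding E_def v_def by (rule convergentI)
  then have "Bseq (\<lambda>i. real i ^ E * v i)" by (rule convergent_imp_Bseq)
  then obtain B where B: "B > 0" "\<And>i. norm (real i ^ E * v i) \<le> B"
    unfolding Bseq_def by auto
  have "AE y in M. (\<lambda>i. u i y) \<longlonglongrightarrow> 0"
  proof (rule AE_tendsto_zero)
    fix i
    show "integrable M (u i)"
      unfolding u_def by (intro integrable_norm integrable_unit_bounded unit_bounded_average unit_bounded_term \<beta> g)
    show "0 \<le> u i y" for y by (simp add: u_def)
    assume i: "i \<ge> max 1 m"
    have i1: "real i > 0" using i by simp
    have hs: "length (Hs i) = K" "scales (i ^ P) (Hs i)" "recip_sum (Hs i) \<le> C / real i ^ E"
      using Hs[of i] i by (auto simp: E_def)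
    have "(\<Sum>n=1..i ^ P. \<beta> n * (\<Prod>k=1..K. g k ((T ^^ (k * n)) y)))
      = (\<Sum>n=1..i ^ P. initial (i ^ P) n * \<beta> n * (\<Prod>k=1..K. g k ((T ^^ (k * n)) y)))" for y
      by (intro sum.cong) (auto simp: initial_def)
    then have "(\<integral>y. u i y \<partial>M) = mean_norm (i ^ P) K (\<lambda>n. initial (i ^ P) n * \<beta> n) g"
      by (simp add: u_def mean_norm_def)
    moreover have
      "mean_norm (i ^ P) (length (Hs i)) (\<lambda>n. initial (i ^ P) n * \<beta> n) g ^ (2 ^ length (Hs i))
        \<le> 8 ^ (2 ^ length (Hs i)) * (recip_sum (Hs i)
          + iavg (Hs i) (\<lambda>hs. cmod ((\<Sum>n=1..i ^ P. sdiffs hs (\<lambda>n. initial (i ^ P) n * \<beta> n) n) / of_nat (i ^ P))))"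
      by (rule weighted_mean_norm_le[OF _ _ g hs(2)]) (use \<beta> in \<open>auto simp: initial_def\<close>)
    then have "mean_norm (i ^ P) K (\<lambda>n. initial (i ^ P) n * \<beta> n) g ^ (2 ^ K) \<le> 8 ^ (2 ^ K) * (recip_sum (Hs i) + v i)"
      unfolding hs(1) v_def weight_norm_def .
    ultimately have "(\<integral>y. u i y \<partial>M) ^ (2 ^ K) \<le> 8 ^ (2 ^ K) * (recip_sum (Hs i) + v i)"
      by (simp only:)
    also have "\<dots> \<le> 8 ^ (2 ^ K) * (C / real i ^ E + B / real i ^ E)"
    proof -
      have "v i \<le> B / real i ^ E" using B(2)[of i] i1 by (simp add: field_simps abs_le_iff)
      then show ?thesis using hs(3) by (intro mult_left_mono add_mono) auto
    qed
    \<comment> \<open>Adding 1 makes the constant at least 1, so it may be raised to the power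
      \<open>2 ^ K\<close> and the right-hand side becomes an exact power.\<close>
    also have "\<dots> \<le> 8 ^ (2 ^ K) * ((C + B + 1) / real i ^ E)"
      using i1 by (intro mult_left_mono) (auto simp: field_simps)
    also have "\<dots> \<le> 8 ^ (2 ^ K) * ((C + B + 1) ^ (2 ^ K) / real i ^ E)"
      using C B(1) by (intro mult_left_mono divide_right_mono self_le_power) auto
    also have "\<dots> = (8 * (C + B + 1) / real i ^ 2) ^ (2 ^ K)"
      unfolding E_def power_divide power_mult_distrib power_mult by simp
    finally have "(\<integral>y. u i y \<partial>M) ^ Suc (2 ^ K - 1) \<le> (8 * (C + B + 1) / real i ^ 2) ^ Suc (2 ^ K - 1)" by simp
    then show "(\<integral>y. u i y \<partial>M) \<le> 8 * (C + B + 1) / real i ^ 2"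
      by (rule power_le_imp_le_base) (use C B(1) in simp)
  qed
  then show ?thesis
  proof eventually_elim
    case (elim y)
    show ?case
    proof (rule averages_tendsto_zero_of_powers[OF _ P])
      have "cmod (\<Prod>k=1..K. g k ((T ^^ (k * n)) y)) \<le> 1" for n
        by (rule norm_prod_le_1) (use g in auto)
      then show "cmod (\<beta> n * (\<Prod>k=1..K. g k ((T ^^ (k * n)) y))) \<le> 1" for n
        using \<beta> by (simp add: norm_mult mult_le_one)
      show "(\<lambda>i. (\<Sum>n=1..i ^ P. \<beta> n * (\<Prod>k=1..K. g k ((T ^^ (k * n)) y))) / of_nat (i ^ P)) \<longlonglongrightarrow> 0"
        by (rule tendsto_norm_zero_cancel) (use elim in \<open>simp only: u_def\<close>)
    qed
  qed
qed

lemma (in mp_system) AE_double_averages_tendsto_zero: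
  assumes f: "\<And>j. unit_bounded M (f j)" and s: "1 \<le> s" "s \<le> Suc m" and d: "d + 1 = K + m"
    and ww: "ww_average_bound M T d \<alpha> C (f s)" and C: "0 < C" and \<alpha>: "0 < \<alpha>"
  shows "AE x in M. \<forall>(N :: 'b measure) S g. mp_system N S \<and> (\<forall>k. unit_bounded N (g k)) \<longrightarrow>
     (AE y in N. (\<lambda>n. (\<Sum>i=1..n. (\<Prod>j=1..Suc m. f j ((T ^^ (j * i)) x)) * (\<Prod>k=1..K. g k ((S ^^ (k * i)) y))) / of_nat n) \<longlonglongrightarrow> 0)"
proof -
  obtain r C' where C': "1 \<le> C'" and ex: "\<And>l. l \<ge> Suc m \<Longrightarrow> \<exists>Hs. length Hs = K \<and> scales (l ^ (2 * r + 2)) Hs \<and> recip_sum Hs \<le> C' / real l \<and>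
     (\<integral>x. weight_norm (l ^ (2 * r + 2)) Hs (orbit_weights T (l ^ (2 * r + 2)) (Suc m) f x) \<partial>M) ^ (2 ^ m) \<le> C' / real l"
    using weight_norm_rate[where f = f and s = s and m = m and d = d and K = K and C = C and \<alpha> = \<alpha>, OF f s d ww C \<alpha>] by blast
  obtain Hs where Hs: "\<And>l. l \<ge> Suc m \<Longrightarrow> length (Hs l) = K \<and> scales (l ^ (2 * r + 2)) (Hs l) \<and> recip_sum (Hs l) \<le> C' / real l \<and>
     (\<integral>x. weight_norm (l ^ (2 * r + 2)) (Hs l) (orbit_weights T (l ^ (2 * r + 2)) (Suc m) f x) \<partial>M) ^ (2 ^ m) \<le> C' / real l"
    using ex by metis
  \<comment> \<open>Along l = i^D the integral of \<open>w i\<close>, after a root of order 2^m, is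
    at most C' / i^(E + 2). The factor i^E is the decay needed on the other system, and the
    remaining i^2 gives summability in x.\<close>
  define E where "E = 2 * (2::nat) ^ K"
  define D where "D = 2 ^ m * (E + 2)"
  define P where "P = D * (2 * r + 2)"
  have pw: "(i ^ D) ^ (2 * r + 2) = i ^ P" for i :: nat by (simp only: P_def power_mult)
  have "0 < D" "0 < P" by (simp_all add: D_def P_def)
  then have D1: "1 \<le> D" and P1: "1 \<le> P" by simp_all
  have big: "Suc m \<le> i ^ D" if "Suc m \<le> i" for i
    using that self_le_power[of i D] D1 by linarith
  define w where "w i x = weight_norm (i ^ P) (Hs (i ^ D)) (orbit_weights T (i ^ P) (Suc m) f x)" for i x
  have "AE x in M. (\<lambda>i. real i ^ E * w i x) \<longlonglongrightarrow> 0"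
  proof (rule AE_tendsto_zero)
    fix i
    show "integrable M (\<lambda>x. real i ^ E * w i x)"
      unfolding w_def by (intro integrable_mult_right integrable_weight_norm f)
    show "0 \<le> real i ^ E * w i x" for x by (simp add: w_def weight_norm_nonneg)
    assume i: "i \<ge> Suc m"
    have i1: "real i > 0" using i by simp
    have "(\<integral>x. w i x \<partial>M) ^ (2 ^ m) \<le> C' / real (i ^ D)"
      using Hs[OF big[OF i]] unfolding w_def pw by blast
    also have "\<dots> \<le> C' ^ (2 ^ m) / real (i ^ D)"
      using C' by (intro divide_right_mono self_le_power) auto
    also have "\<dots> = (C' / real i ^ (E + 2)) ^ (2 ^ m)"
      unfolding D_def power_divide power_mult[symmetric] of_nat_power by (simp only: mult.commute)
    finally have "(\<integral>x. w i x \<partial>M) ^ Suc (2 ^ m - 1) \<le> (C' / real i ^ (E + 2)) ^ Suc (2 ^ m - 1)" by simp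
    then have "(\<integral>x. w i x \<partial>M) \<le> C' / real i ^ (E + 2)"
      by (rule power_le_imp_le_base) (use C' in simp)
    then have "real i ^ E * (\<integral>x. w i x \<partial>M) \<le> real i ^ E * (C' / real i ^ (E + 2))"
      by (rule mult_left_mono) simp
    also have "\<dots> = C' / real i ^ 2" using i1 by (simp add: power_add power2_eq_square)
    finally show "(\<integral>x. real i ^ E * w i x \<partial>M) \<le> C' / real i ^ 2" by simp
  qed
  then show ?thesis
  proof (eventually_elim, intro allI impI)
    fix x and N :: "'b measure" and S and g :: "nat \<Rightarrow> 'b \<Rightarrow> complex"
    assume lim: "(\<lambda>i. real i ^ E * w i x) \<longlonglongrightarrow> 0" and N: "mp_system N S \<and> (\<forall>k. unit_bounded N (g k))"
    interpret Y: mp_system N S using N by simp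
    have rec: "length (Hs (i ^ D)) = K \<and> scales (i ^ P) (Hs (i ^ D)) \<and> recip_sum (Hs (i ^ D)) \<le> C' / real i ^ (2 * 2 ^ K)"
      if i: "i \<ge> Suc m" for i
    proof -
      have "recip_sum (Hs (i ^ D)) \<le> C' / real i ^ D" using Hs[OF big[OF i]] by simp
      also have "\<dots> \<le> C' / real i ^ E"
      proof (intro divide_left_mono power_increasing)
        have "1 * E \<le> 2 ^ m * (E + 2)" by (intro mult_mono) auto
        then show "E \<le> D" by (simp add: D_def)
      qed (use i C' in auto)
      finally show ?thesis using Hs[OF big[OF i], unfolded pw] by (simp add: E_def)
    qed
    show "AE y in N. (\<lambda>n. (\<Sum>i=1..n. (\<Prod>j=1..Suc m. f j ((T ^^ (j * i)) x)) * (\<Prod>k=1..K. g k ((S ^^ (k * i)) y))) / of_nat n) \<longlonglongrightarrow> 0"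
    proof (rule Y.AE_weighted_averages_tendsto_zero[where m = "Suc m" and P = P and C = C' and Hs = "\<lambda>i. Hs (i ^ D)"])
      show "cmod (\<Prod>j=1..Suc m. f j ((T ^^ (j * n)) x)) \<le> 1" for n
        by (rule norm_prod_le_1) (use f in auto)
      show "(\<lambda>i. real i ^ (2 * 2 ^ K) * weight_norm (i ^ P) (Hs (i ^ D))
         (\<lambda>n. initial (i ^ P) n * (\<Prod>j=1..Suc m. f j ((T ^^ (j * n)) x)))) \<longlonglongrightarrow> 0"
        using lim unfolding w_def E_def orbit_weights_def[abs_def] .
    qed (use N P1 C' rec in auto)
  qed
qed

subsection \<open>The maximal ergodic inequality\<close>

text \<open>\<open>partial_max \<psi> T N\<close> is the maximum of \<open>0\<close> and the ergodic sums of \<open>\<psi>\<close> of length at most \<open>N\<close>;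
  the recursion is what makes Garsia's argument work.\<close>

fun partial_max :: "('a \<Rightarrow> real) \<Rightarrow> ('a \<Rightarrow> 'a) \<Rightarrow> nat \<Rightarrow> 'a \<Rightarrow> real" where
  "partial_max \<psi> T 0 x = 0"
| "partial_max \<psi> T (Suc N) x = max 0 (\<psi> x + partial_max \<psi> T N (T x))"

lemma partial_max_nonneg: "0 \<le> partial_max \<psi> T N x"
  by (cases N) auto

lemma partial_max_le_Suc: "partial_max \<psi> T N x \<le> partial_max \<psi> T (Suc N) x"
proof (induction N arbitrary: x)
  case (Suc N)
  have "\<psi> x + partial_max \<psi> T N (T x) \<le> \<psi> x + partial_max \<psi> T (Suc N) (T x)" using Suc by (rule add_left_mono)
  then show ?case by (simp only: partial_max.simps)
qed simp

lemma ergodic_sum_le_partial_max: "(\<Sum>n<N. \<psi> ((T ^^ n) x)) \<le> partial_max \<psi> T N x"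
proof (induction N arbitrary: x)
  case (Suc N)
  have "(\<Sum>n<Suc N. \<psi> ((T ^^ n) x)) = \<psi> x + (\<Sum>n<N. \<psi> ((T ^^ n) (T x)))"
    unfolding sum.lessThan_Suc_shift by (simp add: funpow_swap1)
  then show ?case using Suc[of "T x"] by (simp add: max_def)
qed simp

context mp_system
begin

lemma measurable_partial_max [measurable]:
  "\<psi> \<in> borel_measurable M \<Longrightarrow> partial_max \<psi> T N \<in> borel_measurable M"
proof (induction N)
  case (Suc N)
  then have [measurable]: "\<psi> \<in> borel_measurable M" "partial_max \<psi> T N \<in> borel_measurable M" by auto
  show ?case unfolding partial_max.simps(2)[abs_def] by measurable
qed (simp add: partial_max.simps(1)[abs_def])

lemma abs_partial_max_le: "(\<And>x. \<bar>\<psi> x\<bar> \<le> B) \<Longrightarrow> \<bar>partial_max \<psi> T N x\<bar> \<le> real N * B"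
proof (induction N arbitrary: x)
  case (Suc N)
  have "\<bar>\<psi> x\<bar> \<le> B" "\<bar>partial_max \<psi> T N (T x)\<bar> \<le> real N * B" using Suc by auto
  then show ?case by (auto simp: max_def distrib_right abs_le_iff)
qed simp

text \<open>Write m for the partial maximum. Where m > 0 the recursion gives m <= \<psi> + m o T;
  elsewhere m = 0 <= m o T. The difference m - m o T has integral 0 by invariance.\<close>

lemma Garsia:
  assumes [measurable]: "\<psi> \<in> borel_measurable M" and B: "\<And>x. \<bar>\<psi> x\<bar> \<le> B"
  shows "0 \<le> (\<integral>x. indicator {x \<in> space M. 0 < partial_max \<psi> T N x} x * \<psi> x \<partial>M)"
proof -
  let ?m = "partial_max \<psi> T N"
  let ?A = "{x \<in> space M. 0 < ?m x}"
  have mi: "integrable M ?m"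
    using abs_partial_max_le[of \<psi> B N] B by (intro integrable_const_bound[of _ "real N * B"]) auto
  have mi': "integrable M (\<lambda>x. ?m (T x))"
    using abs_partial_max_le[of \<psi> B N] B by (intro integrable_const_bound[of _ "real N * B"]) auto
  have \<psi>i: "integrable M (\<lambda>x. indicator ?A x * \<psi> x)"
    using order_trans[OF abs_ge_zero B]
    by (intro integrable_const_bound[of _ B]) (auto simp: indicator_def B)
  have "0 = (\<integral>x. ?m x \<partial>M) - (\<integral>x. ?m (T x) \<partial>M)"
    using integral_iterate[of ?m 1] by simp
  also have "\<dots> = (\<integral>x. ?m x - ?m (T x) \<partial>M)" using mi mi' by simp
  also have "\<dots> \<le> (\<integral>x. indicator ?A x * \<psi> x \<partial>M)"
  proof (rule integral_mono[OF _ \<psi>i])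
    fix x assume x: "x \<in> space M"
    show "?m x - ?m (T x) \<le> indicator ?A x * \<psi> x"
    proof (cases "0 < ?m x")
      case True
      then obtain N' where N: "N = Suc N'" by (cases N) auto
      have "?m x = \<psi> x + partial_max \<psi> T N' (T x)" using True unfolding N by (simp add: max_def split: if_splits)
      also have "\<dots> \<le> \<psi> x + ?m (T x)" unfolding N using partial_max_le_Suc by (intro add_left_mono)
      finally show ?thesis using True x by simp
    next
      case False
      then have "?m x = 0" using partial_max_nonneg[of \<psi> T N x] by simp
      then show ?thesis using False partial_max_nonneg[of \<psi> T N "T x"] by simp
    qed
  qed (use mi mi' in auto)
  finally show ?thesis .
qed

text \<open>Garsia's inequality for \<phi> o T - c on the increasing sets \<open>E N\<close>,
  followed by the limit in \<open>N\<close>.\<close>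

lemma maximal_ergodic_inequality:
  assumes [measurable]: "\<phi> \<in> borel_measurable M" and \<phi>: "\<And>x. 0 \<le> \<phi> x" "\<And>x. \<phi> x \<le> B" and c: "0 < c"
  defines "A \<equiv> {x \<in> space M. \<exists>N. c * real N < (\<Sum>n=1..N. \<phi> ((T ^^ n) x))}"
  shows "A \<in> sets M" "c * prob A \<le> (\<integral>x. \<phi> x \<partial>M)"
proof -
  show "A \<in> sets M" unfolding A_def by measurable
  \<comment> \<open>Composition with \<open>T\<close> matches the index ranges: the averages start
    at n = 1, the sums in \<open>partial_max\<close> at n = 0.\<close>
  define \<psi> where "\<psi> x = \<phi> (T x) - c" for x
  have [measurable]: "\<psi> \<in> borel_measurable M" unfolding \<psi>_def by measurable
  have B0: "0 \<le> B" using \<phi> order_trans by blast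
  have \<psi>B: "\<bar>\<psi> x\<bar> \<le> B + c" for x using \<phi>[of "T x"] c B0 by (auto simp: \<psi>_def abs_le_iff)
  define E where "E N = {x \<in> space M. 0 < partial_max \<psi> T N x}" for N
  have [measurable]: "E N \<in> sets M" for N unfolding E_def by measurable
  have "c * prob (E N) \<le> (\<integral>x. \<phi> x \<partial>M)" for N
  proof -
    have \<phi>i: "integrable M (\<lambda>x. \<phi> (T x))"
      using \<phi> by (intro integrable_const_bound[of _ B]) auto
    have \<phi>i': "integrable M (\<lambda>x. indicator (E N) x * \<phi> (T x))"
      using \<phi> B0 by (intro integrable_const_bound[of _ B]) (auto simp: indicator_def)
    have "0 \<le> (\<integral>x. indicator (E N) x * \<psi> x \<partial>M)"
      unfolding E_def by (rule Garsia[OF _ \<psi>B]) measurable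
    also have "(\<integral>x. indicator (E N) x * \<psi> x \<partial>M) = (\<integral>x. indicator (E N) x * \<phi> (T x) - c * indicator (E N) x \<partial>M)"
      unfolding \<psi>_def by (simp add: algebra_simps)
    also have "\<dots> = (\<integral>x. indicator (E N) x * \<phi> (T x) \<partial>M) - c * prob (E N)"
      using \<phi>i' by (subst Bochner_Integration.integral_diff) (auto simp: emeasure_eq_measure)
    finally have "c * prob (E N) \<le> (\<integral>x. indicator (E N) x * \<phi> (T x) \<partial>M)" by simp
    also have "\<dots> \<le> (\<integral>x. \<phi> (T x) \<partial>M)"
      by (rule integral_mono[OF \<phi>i' \<phi>i]) (auto simp: indicator_def \<phi>)
    also have "\<dots> = (\<integral>x. \<phi> x \<partial>M)" using integral_iterate[of \<phi> 1] by simp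
    finally show ?thesis .
  qed
  moreover have "(\<lambda>N. c * prob (E N)) \<longlonglongrightarrow> c * prob (\<Union>N. E N)"
  proof (intro tendsto_mult tendsto_const finite_Lim_measure_incseq)
    show "incseq E" unfolding E_def
      by (intro incseq_SucI) (auto intro: less_le_trans[OF _ partial_max_le_Suc] simp del: partial_max.simps)
  qed auto
  ultimately have "c * prob (\<Union>N. E N) \<le> (\<integral>x. \<phi> x \<partial>M)"
    by (intro LIMSEQ_le_const2) auto
  moreover have "prob A \<le> prob (\<Union>N. E N)"
  proof (rule finite_measure_mono)
    show "A \<subseteq> (\<Union>N. E N)"
    proof
      fix x assume "x \<in> A"
      then obtain N where x: "x \<in> space M" and N: "c * real N < (\<Sum>n=1..N. \<phi> ((T ^^ n) x))" by (auto simp: A_def)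
      have "(\<Sum>n=1..N. \<phi> ((T ^^ n) x)) = (\<Sum>n<N. \<phi> (T ((T ^^ n) x)))"
        by (rule sum.reindex_bij_witness[of _ Suc "\<lambda>n. n - 1"]) (auto simp flip: funpow.simps(2)[unfolded comp_def, THEN fun_cong])
      then have "0 < (\<Sum>n<N. \<psi> ((T ^^ n) x))" using N by (simp add: \<psi>_def sum_subtractf mult.commute)
      also have "\<dots> \<le> partial_max \<psi> T N x" by (rule ergodic_sum_le_partial_max)
      finally show "x \<in> (\<Union>N. E N)" using x by (auto simp: E_def)
    qed
  qed auto
  ultimately show "c * prob A \<le> (\<integral>x. \<phi> x \<partial>M)" using c by (meson mult_left_mono less_imp_le order_trans)
qed

text \<open>At level 2^(-i) the maximal inequality leaves an exceptional set of measure at most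
  4^(-i) / 2^(-i) = 2^(-i), and Borel-Cantelli applies. The inequality is used for
  \<open>T ^^ s\<close>, the map along which the distinguished function moves.\<close>

lemma AE_eventually_averages_le:
  assumes [measurable]: "\<And>i. \<phi> i \<in> borel_measurable M" and \<phi>: "\<And>i x. 0 \<le> \<phi> i x" "\<And>i x. \<phi> i x \<le> B i"
    and int: "\<And>i. (\<integral>x. \<phi> i x \<partial>M) \<le> (1/4) ^ i"
  shows "AE x in M. \<forall>\<^sub>F i in sequentially. \<forall>N. (\<Sum>n=1..N. \<phi> i ((T ^^ (s * n)) x)) \<le> (1/2) ^ i * real N"
proof -
  interpret Ts: mp_system M "T ^^ s"
    by unfold_locales (auto simp: distr_iterate)
  define A where "A i = {x \<in> space M. \<exists>N. (1/2) ^ i * real N < (\<Sum>n=1..N. \<phi> i (((T ^^ s) ^^ n) x))}" for i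
  have Am: "A i \<in> sets M" and le: "(1/2) ^ i * prob (A i) \<le> (\<integral>x. \<phi> i x \<partial>M)" for i
    unfolding A_def by (rule Ts.maximal_ergodic_inequality[OF _ \<phi>]; simp)+
  have "prob (A i) \<le> (1/2) ^ i" for i
  proof -
    have "(1/2) ^ i * prob (A i) \<le> (1/2) ^ i * (1/2) ^ i"
      using order_trans[OF le int[of i]] by (simp add: power_mult_distrib[symmetric])
    then show ?thesis by (rule mult_left_le_imp_le) simp
  qed
  then have "summable (\<lambda>i. prob (A i))"
    by (intro summable_comparison_test'[OF summable_geometric[of "1/2"], of 0]) auto
  then have "AE x in M. \<forall>\<^sub>F i in sequentially. x \<in> space M - A i"
    by (intro borel_cantelli_AE1 Am) (auto simp: emeasure_eq_measure)
  then show ?thesis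
  proof eventually_elim
    case (elim x)
    then show ?case by eventually_elim (auto simp: A_def funpow_mult not_less)
  qed
qed

end

subsection \<open>Essentially bounded functions\<close>

lemma Linf_common_bound:
  assumes "finite A" "\<And>j. j \<in> A \<Longrightarrow> F j \<in> Linf M"
  obtains B where "1 \<le> B" "\<And>j. j \<in> A \<Longrightarrow> AE x in M. cmod (F j x) \<le> B"
proof -
  have "\<forall>j\<in>A. \<exists>b. AE x in M. cmod (F j x) \<le> b" using assms(2) by (auto simp: Linf_def)
  then obtain b where b: "\<And>j. j \<in> A \<Longrightarrow> AE x in M. cmod (F j x) \<le> b j" by metis
  show thesis
  proof (rule that[of "1 + (\<Sum>j\<in>A. \<bar>b j\<bar>)"])
    fix j assume j: "j \<in> A"
    have le: "\<bar>b j\<bar> \<le> (\<Sum>j\<in>A. \<bar>b j\<bar>)" by (rule member_le_sum[OF j]) (auto simp: assms)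
    show "AE x in M. cmod (F j x) \<le> 1 + (\<Sum>j\<in>A. \<bar>b j\<bar>)"
      using b[OF j] by eventually_elim (use le in linarith)
  qed (simp add: sum_nonneg)
qed

context mp_system
begin

text \<open>Along almost every orbit each function is a constant multiple of its clipped version,
  and the constants leave the average. The orders match as J = m + 1 and J + K - 1 = d + 1.\<close>

lemma AE_vanishing_point_of_WW_function:
  assumes J: "1 \<le> J" and K: "1 \<le> K" and s: "s \<in> {1..J}" and f: "\<And>j. j \<in> {1..J} \<Longrightarrow> f j \<in> Linf M"
    and ww: "WW_function M T (J + K - 1) \<alpha> p (f s)" and p: "1 \<le> p" and \<alpha>: "0 < \<alpha>"
  shows "AE x in M. x \<in> vanishing_points TYPE('b) M T J K f"
proof -
  obtain B where B: "1 \<le> B" "\<And>j. j \<in> {1..J} \<Longrightarrow> AE x in M. cmod (f j x) \<le> B"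
    using Linf_common_bound[of "{1..J}" f M] f by auto
  \<comment> \<open>Indices outside {1..J} get the zero function, since the results for unit-bounded
    functions ask for a bound at every index.\<close>
  define h where "h j = (if j \<in> {1..J} then clip B (f j) else (\<lambda>_. 0))" for j
  have h: "unit_bounded M (h j)" for j
    using B(1) f by (auto simp: h_def Linf_def intro!: unit_bounded_clip unit_bounded_const)
  obtain m where m: "J = Suc m" using J by (cases J) auto
  obtain d where d: "d + 1 = K + m" using K by (cases K) auto
  have "J + K - 1 = Suc d" using d m by simp
  then have "WW_function M T (Suc d) \<alpha> p (f s)" using ww by (simp only:)
  from ww_average_bound_clip[OF this B(1) B(2)[OF s] p]
  obtain C where C: "0 < C" "ww_average_bound M T d \<alpha> C (h s)" using s by (auto simp: h_def)
  have "AE x in M. \<forall>(N :: 'b measure) S g. mp_system N S \<and> (\<forall>k. unit_bounded N (g k)) \<longrightarrow>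
     (AE y in N. (\<lambda>n. (\<Sum>i=1..n. (\<Prod>j=1..Suc m. h j ((T ^^ (j * i)) x)) * (\<Prod>k=1..K. g k ((S ^^ (k * i)) y))) / of_nat n) \<longlonglongrightarrow> 0)"
    using s m by (intro AE_double_averages_tendsto_zero[where f = h and s = s, OF h _ _ d C(2,1) \<alpha>]) auto
  moreover have "AE x in M. \<forall>j\<in>{1..J}. \<forall>n. f j ((T ^^ n) x) = of_real B * h j ((T ^^ n) x)"
  proof (rule AE_finite_allI)
    fix j assume j: "j \<in> {1..J}"
    have "AE x in M. \<forall>n. f j ((T ^^ n) x) = of_real B * clip B (f j) ((T ^^ n) x)"
      using B(1) B(2)[OF j] by (intro AE_orbit_clip) auto
    then show "AE x in M. \<forall>n. f j ((T ^^ n) x) = of_real B * h j ((T ^^ n) x)" using j by (simp add: h_def)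
  qed simp
  moreover note AE_space[of M]
  ultimately show ?thesis
  proof (eventually_elim, goal_cases)
    case (1 x)
    note conv = 1(1) and fh = 1(2)
    show ?case unfolding vanishing_points_def
    proof (intro CollectI conjI allI impI)
      show "x \<in> space M" by (rule 1(3))
      fix N :: "'b measure" and S g assume N: "mps N S \<and> (\<forall>k\<in>{1..K}. g k \<in> Linf N)"
      interpret Y: mp_system N S using N by (simp add: mp_system_iff)
      obtain B' where B': "1 \<le> B'" "\<And>k. k \<in> {1..K} \<Longrightarrow> AE y in N. cmod (g k y) \<le> B'"
        using Linf_common_bound[of "{1..K}" g N] N by auto
      define g' where "g' k = (if k \<in> {1..K} then clip B' (g k) else (\<lambda>_. 0))" for k
      have g': "unit_bounded N (g' k)" for k
        using B'(1) N by (auto simp: g'_def Linf_def intro!: unit_bounded_clip Y.unit_bounded_const)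
      have "AE y in N. (\<lambda>n. (\<Sum>i=1..n. (\<Prod>j=1..Suc m. h j ((T ^^ (j * i)) x)) * (\<Prod>k=1..K. g' k ((S ^^ (k * i)) y))) / of_nat n) \<longlonglongrightarrow> 0"
        using conv g' Y.mp_system_axioms by blast
      moreover have "AE y in N. \<forall>k\<in>{1..K}. \<forall>n. g k ((S ^^ n) y) = of_real B' * g' k ((S ^^ n) y)"
      proof (rule AE_finite_allI)
        fix k assume k: "k \<in> {1..K}"
        have "AE y in N. \<forall>n. g k ((S ^^ n) y) = of_real B' * clip B' (g k) ((S ^^ n) y)"
          using B'(1) B'(2)[OF k] by (intro Y.AE_orbit_clip) auto
        then show "AE y in N. \<forall>n. g k ((S ^^ n) y) = of_real B' * g' k ((S ^^ n) y)" using k by (simp add: g'_def)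
      qed simp
      ultimately show "AE y in N. (\<lambda>n. (1 / of_nat n) *
          (\<Sum>i=1..n. (\<Prod>j=1..J. f j ((T ^^ (j * i)) x)) * (\<Prod>k=1..K. g k ((S ^^ (k * i)) y)))) \<longlonglongrightarrow> 0"
      proof eventually_elim
        case (elim y)
        let ?c = "complex_of_real B ^ J * complex_of_real B' ^ K"
        have "(\<Prod>j=1..J. f j ((T ^^ (j * i)) x)) = of_real B ^ J * (\<Prod>j=1..J. h j ((T ^^ (j * i)) x))" for i
        proof -
          have "(\<Prod>j=1..J. f j ((T ^^ (j * i)) x)) = (\<Prod>j=1..J. of_real B * h j ((T ^^ (j * i)) x))"
            using fh by (intro prod.cong) auto
          then show ?thesis by (simp add: prod.distrib)
        qed
        moreover have "(\<Prod>k=1..K. g k ((S ^^ (k * i)) y)) = of_real B' ^ K * (\<Prod>k=1..K. g' k ((S ^^ (k * i)) y))" for i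
        proof -
          have "(\<Prod>k=1..K. g k ((S ^^ (k * i)) y)) = (\<Prod>k=1..K. of_real B' * g' k ((S ^^ (k * i)) y))"
            using elim(2) by (intro prod.cong) auto
          then show ?thesis by (simp add: prod.distrib)
        qed
        ultimately have eq: "(1 / of_nat n) * (\<Sum>i=1..n. (\<Prod>j=1..J. f j ((T ^^ (j * i)) x)) * (\<Prod>k=1..K. g k ((S ^^ (k * i)) y)))
          = ?c * ((\<Sum>i=1..n. (\<Prod>j=1..J. h j ((T ^^ (j * i)) x)) * (\<Prod>k=1..K. g' k ((S ^^ (k * i)) y))) / of_nat n)" for n
          by (simp add: sum_distrib_left sum_divide_distrib mult_ac)
        show ?case unfolding eq using tendsto_mult_right_zero[OF elim(1), of ?c] unfolding m .
      qed
    qed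
  qed
qed

end

subsection \<open>Approximation by Wiener-Wintner functions\<close>

lemma norm_prod_le_power:
  fixes z :: "nat \<Rightarrow> complex"
  assumes "\<And>j. j \<in> A \<Longrightarrow> cmod (z j) \<le> B"
  shows "cmod (\<Prod>j\<in>A. z j) \<le> B ^ card A"
proof -
  have "cmod (\<Prod>j\<in>A. z j) \<le> (\<Prod>j\<in>A. B)"
    unfolding prod_norm[symmetric] using assms by (intro prod_mono) auto
  then show ?thesis by simp
qed

text \<open>All factors but the replaced one are bounded by \<open>A\<close> and \<open>B\<close>,
  so only the mean distance of \<open>f s\<close> and \<open>F\<close> along the orbit of
  \<open>x\<close> enters; the bound is independent of the point \<open>y\<close>.\<close>

lemma norm_average_diff_le:
  fixes f :: "nat \<Rightarrow> 'a \<Rightarrow> complex" and g :: "nat \<Rightarrow> 'b \<Rightarrow> complex"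
  assumes s: "s \<in> {1..J}" and A: "\<And>n j. j \<in> {1..J} \<Longrightarrow> cmod (f j ((T ^^ n) x)) \<le> A" "0 \<le> A"
    and B: "\<And>n k. k \<in> {1..K} \<Longrightarrow> cmod (g k ((S ^^ n) y)) \<le> B" "0 \<le> B"
    and le: "(\<Sum>i=1..n. cmod (f s ((T ^^ (s * i)) x) - F ((T ^^ (s * i)) x))) \<le> c * real n" and c: "0 \<le> c"
  shows "cmod ((1 / of_nat n) * (\<Sum>i=1..n. (\<Prod>j=1..J. f j ((T ^^ (j * i)) x)) * (\<Prod>k=1..K. g k ((S ^^ (k * i)) y)))
     - (1 / of_nat n) * (\<Sum>i=1..n. (\<Prod>j=1..J. (f(s := F)) j ((T ^^ (j * i)) x)) * (\<Prod>k=1..K. g k ((S ^^ (k * i)) y))))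
     \<le> A ^ (J - 1) * B ^ K * c"
proof -
  define G where "G i = (\<Prod>k=1..K. g k ((S ^^ (k * i)) y))" for i
  define R where "R i = (\<Prod>j\<in>{1..J} - {s}. f j ((T ^^ (j * i)) x))" for i
  have R: "(\<Prod>j=1..J. f j ((T ^^ (j * i)) x)) = f s ((T ^^ (s * i)) x) * R i" for i
    unfolding R_def using s by (intro prod.remove) auto
  have R': "(\<Prod>j=1..J. (f(s := F)) j ((T ^^ (j * i)) x)) = F ((T ^^ (s * i)) x) * R i" for i
  proof -
    have "(\<Prod>j=1..J. (f(s := F)) j ((T ^^ (j * i)) x)) = (f(s := F)) s ((T ^^ (s * i)) x) * (\<Prod>j\<in>{1..J} - {s}. (f(s := F)) j ((T ^^ (j * i)) x))"
      using s by (intro prod.remove) auto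
    also have "(\<Prod>j\<in>{1..J} - {s}. (f(s := F)) j ((T ^^ (j * i)) x)) = R i"
      unfolding R_def by (intro prod.cong) auto
    finally show ?thesis by simp
  qed
  have Rn: "cmod (R i) \<le> A ^ (J - 1)" for i
  proof -
    have "cmod (R i) \<le> A ^ card ({1..J} - {s})" unfolding R_def using A by (intro norm_prod_le_power) auto
    then show ?thesis using s by simp
  qed
  have Gn: "cmod (G i) \<le> B ^ K" for i
  proof -
    have "cmod (G i) \<le> B ^ card {1..K}" unfolding G_def using B by (intro norm_prod_le_power) auto
    then show ?thesis by simp
  qed
  define D where "D i = f s ((T ^^ (s * i)) x) - F ((T ^^ (s * i)) x)" for i
  have "(1 / of_nat n) * (\<Sum>i=1..n. f s ((T ^^ (s * i)) x) * R i * G i) - (1 / of_nat n) * (\<Sum>i=1..n. F ((T ^^ (s * i)) x) * R i * G i)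
    = (1 / of_nat n) * (\<Sum>i=1..n. D i * R i * G i)"
    by (simp add: D_def sum_subtractf left_diff_distrib right_diff_distrib diff_divide_distrib)
  also have "cmod \<dots> \<le> (1 / real n) * (\<Sum>i=1..n. cmod (D i) * (A ^ (J - 1) * B ^ K))"
  proof -
    have "cmod (\<Sum>i=1..n. D i * R i * G i) \<le> (\<Sum>i=1..n. cmod (D i) * (A ^ (J - 1) * B ^ K))"
    proof (rule sum_norm_le)
      fix i
      have "cmod (R i) * cmod (G i) \<le> A ^ (J - 1) * B ^ K"
        using Rn Gn A(2) by (intro mult_mono) auto
      then show "cmod (D i * R i * G i) \<le> cmod (D i) * (A ^ (J - 1) * B ^ K)"
        by (simp add: norm_mult mult.assoc mult_left_mono)
    qed
    then show ?thesis by (simp add: norm_mult norm_divide divide_right_mono)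
  qed
  also have "\<dots> = (1 / real n) * (\<Sum>i=1..n. cmod (D i)) * (A ^ (J - 1) * B ^ K)"
    by (simp add: sum_distrib_right)
  also have "\<dots> \<le> c * (A ^ (J - 1) * B ^ K)"
  proof (rule mult_right_mono)
    show "(1 / real n) * (\<Sum>i=1..n. cmod (D i)) \<le> c"
      using le c by (cases "n = 0") (auto simp: D_def field_simps)
  qed (use A(2) B(2) in auto)
  finally show ?thesis unfolding R R' G_def[symmetric] by (simp add: mult_ac)
qed

lemma (in mp_system) AE_vanishing_point:
  assumes J: "1 \<le> J" and K: "1 \<le> K" and s: "s \<in> {1..J}" and f: "\<And>j. j \<in> {1..J} \<Longrightarrow> f j \<in> Linf M"
    and p: "1 \<le> p" and \<alpha>: "0 < \<alpha>"
    and approx: "\<And>\<epsilon>. 0 < \<epsilon> \<Longrightarrow> \<exists>F. WW_function M T (J + K - 1) \<alpha> p F \<and> Lp_norm 2 M (\<lambda>x. cmod (f s x - F x)) < \<epsilon>"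
  shows "AE x in M. x \<in> vanishing_points TYPE('b) M T J K f"
proof -
  \<comment> \<open>The rate 1/4 is the one required by
    \<open>AE_eventually_averages_le\<close>.\<close>
  have "\<forall>i::nat. \<exists>F. WW_function M T (J + K - 1) \<alpha> p F \<and> Lp_norm 2 M (\<lambda>x. cmod (f s x - F x)) < (1/4) ^ i"
    using approx by simp
  then obtain F where F: "\<And>i. WW_function M T (J + K - 1) \<alpha> p (F i)" "\<And>i::nat. Lp_norm 2 M (\<lambda>x. cmod (f s x - F i x)) < (1/4) ^ i"
    by metis
  have Fi: "F i \<in> Linf M" for i using F(1)[of i] by (simp add: WW_function_def)
  have [measurable]: "F i \<in> borel_measurable M" "f s \<in> borel_measurable M" for i
    using Fi[of i] f[OF s] by (auto simp: Linf_def)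
  obtain A where A: "1 \<le> A" "\<And>j. j \<in> {1..J} \<Longrightarrow> AE x in M. cmod (f j x) \<le> A"
    using Linf_common_bound[of "{1..J}" f M] f by auto
  have "\<exists>b. AE x in M. cmod (F i x) \<le> b" for i using Fi[of i] by (simp add: Linf_def)
  then obtain b where b: "\<And>i. AE x in M. cmod (F i x) \<le> b i" by metis
  \<comment> \<open>The minimum with \<open>A + b i\<close> changes nothing almost everywhere and
    makes the function bounded at every point, as the maximal inequality requires.\<close>
  define \<phi> where "\<phi> i x = min (cmod (f s x - F i x)) (A + b i)" for i x
  have \<phi>_eq: "AE x in M. \<phi> i x = cmod (f s x - F i x)" for i
    using A(2)[OF s] b[of i]
  proof eventually_elim
    case (elim x)
    then have "cmod (f s x - F i x) \<le> A + b i" using norm_triangle_ineq4[of "f s x" "F i x"] by linarith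
    then show ?case by (simp add: \<phi>_def)
  qed
  have b0: "0 \<le> b i" for i
  proof -
    have "AE x in M. 0 \<le> b i" using b[of i] by eventually_elim (rule order_trans[OF norm_ge_zero])
    then show ?thesis by simp
  qed
  have [measurable]: "\<phi> i \<in> borel_measurable M" for i unfolding \<phi>_def by measurable
  have "AE x in M. \<forall>\<^sub>F i in sequentially. \<forall>N. (\<Sum>n=1..N. \<phi> i ((T ^^ (s * n)) x)) \<le> (1/2) ^ i * real N"
  proof (rule AE_eventually_averages_le)
    fix i x
    show "0 \<le> \<phi> i x" using A(1) b0[of i] by (simp add: \<phi>_def)
    show "\<phi> i x \<le> A + b i" by (simp add: \<phi>_def)
    have "(\<integral>x. \<phi> i x \<partial>M) = (\<integral>x. cmod (f s x - F i x) \<partial>M)"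
      using \<phi>_eq by (intro integral_cong_AE) auto
    also have "\<dots> \<le> Lp_norm 2 M (\<lambda>x. cmod (f s x - F i x))"
    proof (rule integral_le_Lp_norm)
      show "AE x in M. cmod (f s x - F i x) \<le> A + b i"
        using \<phi>_eq[of i] by eventually_elim (simp add: \<phi>_def min_def split: if_splits)
    qed auto
    also have "\<dots> \<le> (1/4) ^ i" using F(2)[of i] by simp
    finally show "(\<integral>x. \<phi> i x \<partial>M) \<le> (1/4) ^ i" .
  qed measurable
  moreover have "AE x in M. \<forall>i n. \<phi> i ((T ^^ n) x) = cmod (f s ((T ^^ n) x) - F i ((T ^^ n) x))"
    using AE_iterate[OF \<phi>_eq] by (simp add: AE_all_countable)
  moreover have "AE x in M. \<forall>j\<in>{1..J}. \<forall>n. cmod (f j ((T ^^ n) x)) \<le> A"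
    using AE_iterate[OF A(2)] by (intro AE_finite_allI) (simp_all add: AE_all_countable)
  \<comment> \<open>There are countably many approximants, so one null set of \<open>x\<close>
    serves them all; it is fixed before any system on the other side is chosen.\<close>
  moreover have "AE x in M. \<forall>i. x \<in> vanishing_points TYPE('b) M T J K (f(s := F i))"
  proof (unfold AE_all_countable, rule allI)
    fix i
    show "AE x in M. x \<in> vanishing_points TYPE('b) M T J K (f(s := F i))"
      using F(1)[of i] Fi[of i] f by (intro AE_vanishing_point_of_WW_function[OF J K s _ _ p \<alpha>]) auto
  qed
  ultimately show ?thesis
  proof (eventually_elim, goal_cases)
    case (1 x)
    note small = 1(1) and \<phi>x = 1(2) and Ax = 1(3) and van = 1(4)
    show ?case unfolding vanishing_points_def
    proof (intro CollectI conjI allI impI)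
      show "x \<in> space M" using van by (simp add: vanishing_points_def)
      fix N :: "'b measure" and S and g :: "nat \<Rightarrow> 'b \<Rightarrow> complex"
      assume N: "mps N S \<and> (\<forall>k\<in>{1..K}. g k \<in> Linf N)"
      interpret Y: mp_system N S using N by (simp add: mp_system_iff)
      obtain B where B: "1 \<le> B" "\<And>k. k \<in> {1..K} \<Longrightarrow> AE y in N. cmod (g k y) \<le> B"
        using Linf_common_bound[of "{1..K}" g N] N by auto
      define V where "V h n y = (1 / of_nat n) * (\<Sum>i=1..n. (\<Prod>j=1..J. h j ((T ^^ (j * i)) x)) * (\<Prod>k=1..K. g k ((S ^^ (k * i)) y)))"
        for h :: "nat \<Rightarrow> 'a \<Rightarrow> complex" and n y
      have "AE y in N. \<forall>i. (\<lambda>n. V (f(s := F i)) n y) \<longlonglongrightarrow> 0"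
        unfolding AE_all_countable using van N by (auto simp: vanishing_points_def V_def simp del: fun_upd_apply)
      moreover have "AE y in N. \<forall>k\<in>{1..K}. \<forall>n. cmod (g k ((S ^^ n) y)) \<le> B"
        using Y.AE_iterate[OF B(2)] by (intro AE_finite_allI) (simp_all add: AE_all_countable)
      ultimately have "AE y in N. (\<lambda>n. V f n y) \<longlonglongrightarrow> 0"
      proof eventually_elim
        case (elim y)
        define c where "c = A ^ (J - 1) * B ^ K"
        have c: "0 < c" using A(1) B(1) by (simp add: c_def)
        show ?case
        proof (rule tendstoI, unfold dist_norm diff_0_right)
          fix \<epsilon> :: real assume \<epsilon>: "0 < \<epsilon>"
          have "(\<lambda>i. c * (1/2) ^ i) \<longlonglongrightarrow> c * 0" by (intro tendsto_intros LIMSEQ_power_zero) auto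
          then have "\<forall>\<^sub>F i in sequentially. c * (1/2) ^ i < \<epsilon> / 2" using \<epsilon> by (intro order_tendstoD) auto
          with small have "\<forall>\<^sub>F i in sequentially. c * (1/2) ^ i < \<epsilon> / 2
              \<and> (\<forall>N. (\<Sum>n=1..N. \<phi> i ((T ^^ (s * n)) x)) \<le> (1/2) ^ i * real N)"
            by (rule eventually_conj[rotated])
          \<comment> \<open>The approximant is fixed before \<open>n\<close> tends to infinity: its
            error is below \<open>\<epsilon> / 2\<close> for all \<open>n\<close> at once.\<close>
          then obtain i where i: "c * (1/2) ^ i < \<epsilon> / 2" "\<And>N. (\<Sum>n=1..N. \<phi> i ((T ^^ (s * n)) x)) \<le> (1/2) ^ i * real N"
            unfolding eventually_sequentially by blast
          have diff: "cmod (V f n y - V (f(s := F i)) n y) \<le> c * (1/2) ^ i" for n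
            unfolding V_def c_def
            using Ax elim(2) i(2)[of n] A(1) B(1) \<phi>x
            by (intro norm_average_diff_le[OF s]) auto
          have "\<forall>\<^sub>F n in sequentially. cmod (V (f(s := F i)) n y) < \<epsilon> / 2"
            using tendstoD[OF elim(1)[rule_format, of i], of "\<epsilon> / 2"] \<epsilon> by simp
          then show "\<forall>\<^sub>F n in sequentially. cmod (V f n y) < \<epsilon>"
          proof eventually_elim
            case (elim n)
            have "cmod (V f n y) \<le> cmod (V (f(s := F i)) n y) + cmod (V f n y - V (f(s := F i)) n y)"
              by (rule norm_triangle_sub)
            then show ?case using elim diff[of n] i(1) by linarith
          qed
        qed
      qed
      then show "AE y in N. (\<lambda>n. (1 / of_nat n) * (\<Sum>i=1..n. (\<Prod>j=1..J. f j ((T ^^ (j * i)) x)) * (\<Prod>k=1..K. g k ((S ^^ (k * i)) y)))) \<longlonglongrightarrow> 0"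
        by (simp only: V_def)
    qed
  qed
qed

subsection \<open>Reduction to the orbit space\<close>

text \<open>The map \<open>\<pi>\<close> intertwines \<open>S\<close> with the coordinate shift
  \<open>\<sigma>\<close>, so its law is invariant under \<open>\<sigma>\<close>, and the time-zero
  coordinates \<open>e k\<close> along the shift reproduce \<open>g k\<close> along
  \<open>S\<close>. Convergence almost everywhere for the law pulls back through
  \<open>\<pi>\<close>.\<close>

lemma vanishing_points_orbit_space_subset:
  "vanishing_points TYPE(orbit_space) M T J K f \<subseteq> vanishing_points TYPE('b) M T J K f"
proof
  fix x assume x: "x \<in> vanishing_points TYPE(orbit_space) M T J K f"
  show "x \<in> vanishing_points TYPE('b) M T J K f"
    unfolding vanishing_points_def
  proof (intro CollectI conjI allI impI)
    show "x \<in> space M" using x by (simp add: vanishing_points_def)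
    fix N :: "'b measure" and S and g :: "nat \<Rightarrow> 'b \<Rightarrow> complex"
    assume N: "mps N S \<and> (\<forall>k\<in>{1..K}. g k \<in> Linf N)"
    interpret Y: mp_system N S using N by (simp add: mp_system_iff)
    define \<Omega> :: "orbit_space measure" where "\<Omega> = (\<Pi>\<^sub>M n\<in>UNIV. \<Pi>\<^sub>M k\<in>UNIV. borel)"
    \<comment> \<open>Coordinates outside {1..K} are set to 0 because nothing is known there about
      the measurability of \<open>g k\<close>.\<close>
    define \<pi> :: "'b \<Rightarrow> orbit_space" where "\<pi> y n k = (if k \<in> {1..K} then g k ((S ^^ n) y) else 0)" for y n k
    define \<sigma> :: "orbit_space \<Rightarrow> orbit_space" where "\<sigma> \<omega> n = \<omega> (Suc n)" for \<omega> n
    define e :: "nat \<Rightarrow> orbit_space \<Rightarrow> complex" where "e k \<omega> = \<omega> 0 k" for k \<omega>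
    have \<pi>_meas [measurable]: "\<pi> \<in> measurable N \<Omega>"
      unfolding \<Omega>_def
    proof (rule measurable_PiM_single')
      fix n :: nat
      show "(\<lambda>y. \<pi> y n) \<in> measurable N (\<Pi>\<^sub>M k\<in>UNIV. borel)"
      proof (rule measurable_PiM_single')
        fix k :: nat
        show "(\<lambda>y. \<pi> y n k) \<in> borel_measurable N"
        proof (cases "k \<in> {1..K}")
          case True
          then have [measurable]: "g k \<in> borel_measurable N" using N by (auto simp: Linf_def)
          show ?thesis using True by (simp add: \<pi>_def)
        qed (auto simp: \<pi>_def)
      qed (auto simp: space_PiM)
    qed (auto simp: space_PiM)
    have \<sigma>_meas [measurable]: "\<sigma> \<in> measurable \<Omega> \<Omega>"
      unfolding \<Omega>_def \<sigma>_def[abs_def]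
      by (rule measurable_PiM_single') (auto simp: space_PiM intro: measurable_component_singleton)
    have e_meas [measurable]: "e k \<in> borel_measurable \<Omega>" for k
      unfolding \<Omega>_def e_def[abs_def]
      by (rule measurable_compose[of _ _ "\<Pi>\<^sub>M k\<in>UNIV. borel" "\<lambda>\<omega>. \<omega> k"])
        (auto intro: measurable_component_singleton)
    have \<sigma>\<pi>: "\<sigma> (\<pi> y) = \<pi> (S y)" for y
      by (simp add: \<sigma>_def[abs_def] \<pi>_def fun_eq_iff funpow_swap1)
    have \<sigma>\<pi>_pow: "(\<sigma> ^^ n) (\<pi> y) = \<pi> ((S ^^ n) y)" for n y
      by (induction n) (simp_all add: \<sigma>\<pi>)
    define N' where "N' = distr N \<Omega> \<pi>"
    have sets_N': "sets N' = sets \<Omega>" by (simp add: N'_def)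
    have "mps N' \<sigma>" unfolding mps_def
    proof (intro conjI)
      show "prob_space N'" unfolding N'_def by (rule Y.prob_space_distr) measurable
      show "\<sigma> \<in> measurable N' N'" using \<sigma>_meas by (simp add: N'_def)
      have "distr N' N' \<sigma> = distr N' \<Omega> \<sigma>" by (rule distr_cong) (simp_all add: sets_N')
      also have "\<dots> = distr N \<Omega> (\<lambda>y. \<pi> (S y))"
        unfolding N'_def by (subst distr_distr) (simp_all add: comp_def \<sigma>\<pi>)
      also have "\<dots> = distr (distr N N S) \<Omega> \<pi>"
        by (subst distr_distr) (simp_all add: comp_def)
      finally show "distr N' N' \<sigma> = N'" by (simp add: N'_def Y.distr_T)
    qed
    moreover have "e k \<in> Linf N'" if k: "k \<in> {1..K}" for k
    proof -
      have "g k \<in> Linf N" using N k by blast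
      then obtain B where B: "AE y in N. cmod (g k y) \<le> B" by (auto simp: Linf_def)
      have "AE y in N. cmod (e k (\<pi> y)) \<le> B" using B by eventually_elim (use k in \<open>simp add: e_def \<pi>_def\<close>)
      then have "AE \<omega> in N'. cmod (e k \<omega>) \<le> B"
        unfolding N'_def by (subst AE_distr_iff) auto
      moreover have "e k \<in> borel_measurable N'" using e_meas[of k] by (simp add: N'_def)
      ultimately show ?thesis unfolding Linf_def by blast
    qed
    ultimately have "AE \<omega> in N'. (\<lambda>n. (1 / of_nat n) *
       (\<Sum>i=1..n. (\<Prod>j=1..J. f j ((T ^^ (j * i)) x)) * (\<Prod>k=1..K. e k ((\<sigma> ^^ (k * i)) \<omega>)))) \<longlonglongrightarrow> 0"
      using x by (auto simp: vanishing_points_def)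
    then have "AE y in N. (\<lambda>n. (1 / of_nat n) *
       (\<Sum>i=1..n. (\<Prod>j=1..J. f j ((T ^^ (j * i)) x)) * (\<Prod>k=1..K. e k ((\<sigma> ^^ (k * i)) (\<pi> y))))) \<longlonglongrightarrow> 0"
      unfolding N'_def by (rule AE_distrD[OF \<pi>_meas])
    moreover have "(\<Prod>k=1..K. e k ((\<sigma> ^^ (k * i)) (\<pi> y))) = (\<Prod>k=1..K. g k ((S ^^ (k * i)) y))" for i y
      by (intro prod.cong) (auto simp: \<sigma>\<pi>_pow e_def \<pi>_def)
    ultimately show "AE y in N. (\<lambda>n. (1 / of_nat n) * (\<Sum>i=1..n. (\<Prod>j=1..J. f j ((T ^^ (j * i)) x)) * (\<Prod>k=1..K. g k ((S ^^ (k * i)) y)))) \<longlonglongrightarrow> 0"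
      by (simp only:)
  qed
qed

theorem corollary8p3:
  fixes M Z :: "'a measure" and T :: "'a \<Rightarrow> 'a"
    and J K :: nat and \<alpha> :: real and p :: ennreal
    and f :: "nat \<Rightarrow> 'a \<Rightarrow> complex"
  assumes "J \<ge> 1" and "K \<ge> 2"
    and "\<alpha> > 0" and "1 \<le> p"
    and "HKZ_factor M T (J + K - 1) Z"
    and "WW_system M T Z (J + K - 1) \<alpha> p"
    and "\<forall>j\<in>{1..J}. f j \<in> Linf M"
    and "\<exists>j\<in>{1..J}. f j \<in> L2_perp M Z"
  shows "(\<exists>X'\<in>sets M. measure M X' = 1 \<and>
            X' \<subseteq> vanishing_points TYPE(orbit_space) M T J K f) \<and>
         vanishing_points TYPE(orbit_space) M T J K f \<subseteq> vanishing_points TYPE('b) M T J K f"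
proof (rule conjI[OF _ vanishing_points_orbit_space_subset])
  interpret mp_system M T
    using assms(6) by (simp add: WW_system_def ergodic_mps_def mp_system_iff)
  obtain s where s: "s \<in> {1..J}" "f s \<in> L2_perp M Z" using assms(8) by blast
  have "AE x in M. x \<in> vanishing_points TYPE(orbit_space) M T J K f"
  proof (rule AE_vanishing_point[OF assms(1) _ s(1)])
    fix \<epsilon> :: real assume "0 < \<epsilon>"
    then show "\<exists>F. WW_function M T (J + K - 1) \<alpha> p F \<and> Lp_norm 2 M (\<lambda>x. cmod (f s x - F x)) < \<epsilon>"
      using assms(6) s(2) unfolding WW_system_def by blast
  qed (use assms in auto)
  \<comment> \<open>The set of vanishing points is not known to be measurable, so a measurable
    subset of full measure is extracted.\<close>
  then obtain X' where "X' \<subseteq> {x \<in> space M. x \<in> vanishing_points TYPE(orbit_space) M T J K f}" "X' \<in> sets M" "measure M X' = 1"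
    by (rule AE_E_prob)
  then show "\<exists>X'\<in>sets M. measure M X' = 1 \<and> X' \<subseteq> vanishing_points TYPE(orbit_space) M T J K f"
    by blast
qed

end
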